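(* Let $X,U,Z$, $A_m,G,M$ satisfy the standing assumptions (i)--(iv) of the context, with $X$ and $U$ Banach lattices, and let $P,L$ and the operator $\mathcal{A}_{P,L}$ be as in the context. In addition, assume that the operators $M$, $L$, $P$, $R(\lambda,A)$ and $D_\lambda$ are positive for $\lambda>s(A)$, and that there exists $\lambda_0>s(A)$ such that $$r(MD_{\lambda_0})<1 .$$ Then the strongly continuous semigroup $(\mathcal{T}_{P,L}(t))_{t\ge0}$ generated by $\mathcal{A}_{P,L}$ on $\mathbb{X}=X\times L^p([-1,0],X)$ is positive.
   Context: **Setting.** $X,U,Z$ are Banach spaces, $Z\subset X$ with dense and continuous embedding, and $p\ge 1$ is a real number. $A_m\colon Z\subset X\to X$ is a closed linear operator, and $G,M\colon Z\to U$ are linear operators. $\mathcal{L}(E,F)$ denotes the bounded linear operators $E\to F$; $R(\lambda,A)=(\lambda-A)^{-1}$; $s(A)$ is the spectral bound $\sup\{\operatorname{Re}\lambda:\lambda\in\sigma(A)\}$; $r(\cdot)$ is the spectral radius. The space $\mathbb{X}:=X\times L^p([-1,0],X)$ has norm $\|x\|+\|f\|_p$. **Delay operators.** $\mu\colon[-1,0]\to\mathcal{L}(X)$ and $\nu\colon[-1,0]\to\mathcal{L}(X,U)$ are functions of bounded variation, continuous at $0$, with $\mu(0)=0$, $\nu(0)=0$, and for $f\in W^{1,p}([-1,0],X)$ $$Pf:=\int_{-1}^0 d\mu(\theta)f(\theta)\in X,\qquad Lf:=\int_{-1}^0 d\nu(\theta)f(\theta)\in U .$$ **Standing assumptions.**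 (i) The restriction $A$ of $A_m$ to $D(A)=\ker G$ generates a $C_0$-semigroup $(T(t))_{t\ge0}$ on $X$. (ii) $G\colon Z\to U$ is surjective. Consequently for $\lambda\in\rho(A)$ one has $Z=D(A)\oplus\ker(\lambda-A_m)$, and the Dirichlet operator $D_\lambda:=(G|_{\ker(\lambda-A_m)})^{-1}\in\mathcal{L}(U,Z)$ exists. $X_{-1}$ is the completion of $X$ for $\|R(\lambda,A)x\|$; $T_{-1}$ and $A_{-1}\colon X\to X_{-1}$ are the extensions of $T$ and $A$ to $X_{-1}$. Put $B:=(\lambda-A_{-1})D_\lambda\in\mathcal{L}(U,X_{-1})$ (independent of $\lambda\in\rho(A)$) and $C:=M|_{D(A)}\in\mathcal{L}(D(A),U)$, where $D(A)$ carries the graph norm. (iii) The triple $(A,B,C)$ is regular on $X,U$, meaning all of the following. - $(C,A)$ is $p$-admissible: for some $\tau>0$ there is $\gamma>0$ with $\|CT(\cdot)x\|_{L^p([0,\tau],U)}\le\gamma\|x\|$ for all $x\in D(A)$. - $(A,B)$ is $p$-admissible: for some $\tau>0$, $\Phi_\tau u:=\int_0^\tau T_{-1}(\tau-s)Bu(s)\,ds\in X$ for all $u\in L^p([0,\infty),U)$. - Well-posedness: for every $\alpha>0$, the input-output operator $(F_\alpha u)(t):=M\Phi_t u$, $t\in[0,\alpha]$, defined for $u\in W^{1,p}([0,\alpha],U)$ with $u(0)=0$ (for such $u$ one has $\Phi_tu\in Z$), satisfies $\|F_\alpha u\|_{L^p([0,\alpha],U)}\le\kappa(\alpha)\|u\|_{L^p([0,\alpha],U)}$;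 it is then extended to $F_\alpha\in\mathcal{L}(L^p([0,\alpha],U))$. - Regularity with zero feedthrough: $\lim_{t\to0}\frac1t\int_0^t (F_\alpha(\mathbf{1}v))(\sigma)\,d\sigma=0$ for every $v\in U$, where $\mathbf{1}v$ is the constant input $v$. (iv) $I-F_\tau$ is invertible in $L^p([0,\tau],U)$ for some $\tau>0$. **Operator and semigroup.** $\mathcal{A}_{P,L}:=\begin{pmatrix} A_m&P\\ 0& \frac{d}{ds}\end{pmatrix}$ on $\mathbb{X}$ with domain $\{(x,\varphi)\in Z\times W^{1,p}([-1,0],X): (G-M)x=L\varphi,\ x=\varphi(0)\}$. Under (i)--(iv) it generates a $C_0$-semigroup $(\mathcal{T}_{P,L}(t))_{t\ge0}$ on $\mathbb{X}$. **Positivity.** $L^p([-1,0],X)$ carries the pointwise a.e. order and $\mathbb{X}$ the product order. A linear operator (defined on a subspace of a Banach lattice) is positive if it maps every nonnegative element of its domain to a nonnegative element; here $M$ is defined on $Z\subset X$, $P$ and $L$ on $W^{1,p}([-1,0],X)\subset L^p([-1,0],X)$. A semigroup is positive if each of its operators is. *)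

theory Defs
  imports "HOL-Analysis.Analysis" "HOL-Library.Lattice_Algebras"
begin

section \<open>Banach lattices\<close>

text \<open>Banach lattices are real, as usual; \<open>lattice_ab_group_add_abs\<close> provides
  \<open>\<bar>x\<bar> = sup x (- x)\<close>.\<close>

class banach_lattice = banach + ordered_real_vector + lattice_ab_group_add_abs +
  assumes norm_mono_abs: "\<bar>x\<bar> \<le> \<bar>y\<bar> \<Longrightarrow> norm x \<le> norm y"

section \<open>Strong measurability and Lebesgue spaces of vector-valued functions\<close>

text \<open>The Bochner integral of \<open>HOL-Analysis\<close> is restricted to second countable range
  types. To allow arbitrary Banach spaces, measurability is taken in the strong (Bochner) sense,
  and integrals are Henstock--Kurzweil integrals, which agree with the Bochner integral
  whenever the latter exists.\<close>

definition strongly_measurable :: "real set \<Rightarrow> (real \<Rightarrow> 'x::real_normed_vector) \<Rightarrow> bool" where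
  "strongly_measurable S f \<longleftrightarrow>
    (\<exists>s. (\<forall>n::nat. simple_function (lebesgue_on S) (s n)) \<and>
         (AE t in lebesgue_on S. (\<lambda>n. s n t) \<longlonglongrightarrow> f t))"

definition Lp_fun :: "real \<Rightarrow> real set \<Rightarrow> (real \<Rightarrow> 'x::real_normed_vector) \<Rightarrow> bool" where
  "Lp_fun p S f \<longleftrightarrow>
    strongly_measurable S f \<and> integrable (lebesgue_on S) (\<lambda>t. norm (f t) powr p)"

definition Lp_fun_norm :: "real \<Rightarrow> real set \<Rightarrow> (real \<Rightarrow> 'x::real_normed_vector) \<Rightarrow> real" where
  "Lp_fun_norm p S f = (integral\<^sup>L (lebesgue_on S) (\<lambda>t. norm (f t) powr p)) powr (1 / p)"

lemma strongly_measurable_const0: "strongly_measurable S (\<lambda>_. 0)"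
  unfolding strongly_measurable_def by (rule exI[of _ "\<lambda>_ _. 0"]) simp

lemma strongly_measurable_add:
  assumes "strongly_measurable S f" "strongly_measurable S g"
  shows "strongly_measurable S (\<lambda>t. f t + g t)"
proof -
  obtain s r where
    s: "\<And>n::nat. simple_function (lebesgue_on S) (s n)"
       "AE t in lebesgue_on S. (\<lambda>n. s n t) \<longlonglongrightarrow> f t" and
    r: "\<And>n::nat. simple_function (lebesgue_on S) (r n)"
       "AE t in lebesgue_on S. (\<lambda>n. r n t) \<longlonglongrightarrow> g t"
    using assms unfolding strongly_measurable_def by blast
  have "AE t in lebesgue_on S. (\<lambda>n. s n t + r n t) \<longlonglongrightarrow> f t + g t"
    using s(2) r(2) by eventually_elim (rule tendsto_add)
  moreover have "simple_function (lebesgue_on S) (\<lambda>t. s n t + r n t)" for n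
    by (rule simple_function_add[OF s(1) r(1)])
  ultimately show ?thesis
    unfolding strongly_measurable_def by (intro exI[of _ "\<lambda>n t. s n t + r n t"] conjI allI)
qed

lemma strongly_measurable_scaleR:
  assumes "strongly_measurable S f"
  shows "strongly_measurable S (\<lambda>t. c *\<^sub>R f t)"
proof -
  obtain s where
    s: "\<And>n::nat. simple_function (lebesgue_on S) (s n)"
       "AE t in lebesgue_on S. (\<lambda>n. s n t) \<longlonglongrightarrow> f t"
    using assms unfolding strongly_measurable_def by blast
  have "AE t in lebesgue_on S. (\<lambda>n. c *\<^sub>R s n t) \<longlonglongrightarrow> c *\<^sub>R f t"
    using s(2) by eventually_elim (intro tendsto_intros)
  moreover have "simple_function (lebesgue_on S) (\<lambda>t. c *\<^sub>R s n t)" for n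
    by (rule simple_function_compose1[OF s(1)])
  ultimately show ?thesis
    unfolding strongly_measurable_def by (intro exI[of _ "\<lambda>n t. c *\<^sub>R s n t"] conjI allI)
qed

lemma strongly_measurable_minus:
  "strongly_measurable S f \<Longrightarrow> strongly_measurable S (\<lambda>t. - f t)"
  using strongly_measurable_scaleR[of S f "-1"] by simp

lemma strongly_measurable_diff:
  "strongly_measurable S f \<Longrightarrow> strongly_measurable S g \<Longrightarrow> strongly_measurable S (\<lambda>t. f t - g t)"
  using strongly_measurable_add[of S f "\<lambda>t. - g t"] strongly_measurable_minus[of S g] by simp

lemma AE_eq_compose1:
  assumes "AE t in M. f t = f' t"
  shows "AE t in M. h (f t) = h (f' t)"
  using assms by eventually_elim simp

lemma AE_eq_compose2:
  assumes "AE t in M. f t = f' t" "AE t in M. g t = g' t"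
  shows "AE t in M. h (f t) (g t) = h (f' t) (g' t)"
  using assms by eventually_elim simp

text \<open>The space of all strongly measurable functions on the real line modulo equality almost
  everywhere. \<open>L\<^sup>p\<close> over \<open>S\<close> is the subspace of those classes that vanish outside
  \<open>S\<close> and are \<open>p\<close>-integrable, i.e. functions on \<open>S\<close> are extended by zero.\<close>

quotient_type (overloaded) 'x L0 = "real \<Rightarrow> 'x::real_normed_vector" / partial:
  "\<lambda>f g. strongly_measurable UNIV f \<and> strongly_measurable UNIV g \<and> (AE t in lebesgue. f t = g t)"
proof (rule part_equivpI)
  show "\<exists>f::real \<Rightarrow> 'x. strongly_measurable UNIV f \<and> strongly_measurable UNIV f \<and>
      (AE t in lebesgue. f t = f t)"
    by (rule exI[of _ "\<lambda>_. 0"]) (simp add: strongly_measurable_const0)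
  show "symp (\<lambda>f g::real \<Rightarrow> 'x. strongly_measurable UNIV f \<and> strongly_measurable UNIV g \<and>
      (AE t in lebesgue. f t = g t))"
  proof (rule sympI, elim conjE, intro conjI)
    fix f g :: "real \<Rightarrow> 'x"
    assume "AE t in lebesgue. f t = g t"
    then show "AE t in lebesgue. g t = f t"
      by eventually_elim simp
  qed
  show "transp (\<lambda>f g::real \<Rightarrow> 'x. strongly_measurable UNIV f \<and> strongly_measurable UNIV g \<and>
      (AE t in lebesgue. f t = g t))"
  proof (rule transpI, elim conjE, intro conjI)
    fix f g h :: "real \<Rightarrow> 'x"
    assume "AE t in lebesgue. f t = g t" "AE t in lebesgue. g t = h t"
    then show "AE t in lebesgue. f t = h t"
      by eventually_elim simp
  qed
qed

instantiation L0 :: (real_normed_vector) real_vector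
begin

lift_definition zero_L0 :: "'a L0" is "\<lambda>_. 0"
  by (simp add: strongly_measurable_const0)

lift_definition plus_L0 :: "'a L0 \<Rightarrow> 'a L0 \<Rightarrow> 'a L0" is "\<lambda>f g t. f t + g t"
  by (elim conjE, intro conjI strongly_measurable_add AE_eq_compose2[where h = "(+)"])

lift_definition minus_L0 :: "'a L0 \<Rightarrow> 'a L0 \<Rightarrow> 'a L0" is "\<lambda>f g t. f t - g t"
  by (elim conjE, intro conjI strongly_measurable_diff AE_eq_compose2[where h = "(-)"])

lift_definition uminus_L0 :: "'a L0 \<Rightarrow> 'a L0" is "\<lambda>f t. - f t"
  by (elim conjE, intro conjI strongly_measurable_minus AE_eq_compose1[where h = uminus])

lift_definition scaleR_L0 :: "real \<Rightarrow> 'a L0 \<Rightarrow> 'a L0" is "\<lambda>c f t. c *\<^sub>R f t"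
  subgoal for c f g
    by (elim conjE, intro conjI strongly_measurable_scaleR AE_eq_compose1[where h = "scaleR c"])
  done

instance
proof
  note sm = strongly_measurable_add strongly_measurable_scaleR strongly_measurable_const0
    strongly_measurable_minus strongly_measurable_diff
  fix f g h :: "'a L0" and c d :: real
  show "f + g + h = f + (g + h)" by transfer (elim conjE, intro conjI sm AE_I2; simp add: algebra_simps)
  show "f + g = g + f" by transfer (elim conjE, intro conjI sm AE_I2; simp add: algebra_simps)
  show "0 + f = f" by transfer (elim conjE, intro conjI sm AE_I2; simp add: algebra_simps)
  show "- f + f = 0" by transfer (elim conjE, intro conjI sm AE_I2; simp add: algebra_simps)
  show "f - g = f + - g" by transfer (elim conjE, intro conjI sm AE_I2; simp add: algebra_simps)
  show "c *\<^sub>R (f + g) = c *\<^sub>R f + c *\<^sub>R g" by transfer (elim conjE, intro conjI sm AE_I2; simp add: algebra_simps)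
  show "(c + d) *\<^sub>R f = c *\<^sub>R f + d *\<^sub>R f" by transfer (elim conjE, intro conjI sm AE_I2; simp add: algebra_simps)
  show "c *\<^sub>R d *\<^sub>R f = (c * d) *\<^sub>R f" by transfer (elim conjE, intro conjI sm AE_I2; simp add: algebra_simps)
  show "1 *\<^sub>R f = f" by transfer (elim conjE, intro conjI sm AE_I2; simp add: algebra_simps)
qed

end

instantiation L0 :: (banach_lattice) order
begin

lift_definition less_eq_L0 :: "'a L0 \<Rightarrow> 'a L0 \<Rightarrow> bool" is "\<lambda>f g. AE t in lebesgue. f t \<le> g t"
proof (elim conjE)
  fix f f' g g' :: "real \<Rightarrow> 'a"
  assume "AE t in lebesgue. f t = f' t" "AE t in lebesgue. g t = g' t"
  then have "AE t in lebesgue. (f t \<le> g t) = (f' t \<le> g' t)"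
    by eventually_elim simp
  then show "(AE t in lebesgue. f t \<le> g t) = (AE t in lebesgue. f' t \<le> g' t)"
    by (rule eventually_subst)
qed

definition less_L0 :: "'a L0 \<Rightarrow> 'a L0 \<Rightarrow> bool" where
  "less_L0 f g \<longleftrightarrow> f \<le> g \<and> \<not> g \<le> f"

instance
proof
  fix f g h :: "'a L0"
  show "f < g \<longleftrightarrow> f \<le> g \<and> \<not> g \<le> f" by (rule less_L0_def)
  show "f \<le> f" by transfer simp
  show "f \<le> g \<Longrightarrow> g \<le> h \<Longrightarrow> f \<le> h"
  proof transfer
    fix f g h :: "real \<Rightarrow> 'a"
    assume "AE t in lebesgue. f t \<le> g t" "AE t in lebesgue. g t \<le> h t"
    then show "AE t in lebesgue. f t \<le> h t" by eventually_elim (rule order_trans)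
  qed
  show "f \<le> g \<Longrightarrow> g \<le> f \<Longrightarrow> f = g"
  proof transfer
    fix f g :: "real \<Rightarrow> 'a"
    assume sm: "strongly_measurable UNIV f \<and> strongly_measurable UNIV f \<and>
        (AE t in lebesgue. f t = f t)" "strongly_measurable UNIV g \<and>
        strongly_measurable UNIV g \<and> (AE t in lebesgue. g t = g t)"
    assume "AE t in lebesgue. f t \<le> g t" "AE t in lebesgue. g t \<le> f t"
    then have "AE t in lebesgue. f t = g t" by eventually_elim (rule order.antisym)
    with sm show "strongly_measurable UNIV f \<and> strongly_measurable UNIV g \<and>
        (AE t in lebesgue. f t = g t)" by simp
  qed
qed

end

definition L0_of :: "real set \<Rightarrow> (real \<Rightarrow> 'x::real_normed_vector) \<Rightarrow> 'x L0" where
  "L0_of S f = abs_L0 (\<lambda>t. if t \<in> S then f t else 0)"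

definition Lp :: "real \<Rightarrow> real set \<Rightarrow> 'x::real_normed_vector L0 set" where
  "Lp p S = {L0_of S f | f. Lp_fun p S f}"

lift_definition Lp_norm :: "real \<Rightarrow> 'x::real_normed_vector L0 \<Rightarrow> real" is
  "\<lambda>p f. (integral\<^sup>L lebesgue (\<lambda>t. norm (f t) powr p)) powr (1 / p)"
proof -
  fix p and f g :: "real \<Rightarrow> 'x"
  assume *: "strongly_measurable UNIV f \<and> strongly_measurable UNIV g \<and>
    (AE t in lebesgue. f t = g t)"
  have meas: "(\<lambda>t. norm (h t) powr p) \<in> borel_measurable lebesgue"
    if h: "strongly_measurable UNIV h" for h :: "real \<Rightarrow> 'x"
  proof -
    obtain s where s: "(\<forall>n::nat. simple_function lebesgue (s n)) \<and>
        (AE t in lebesgue. (\<lambda>n. s n t) \<longlonglongrightarrow> h t)"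
      using h unfolding strongly_measurable_def lebesgue_on_UNIV_eq by (rule exE)
    have meas_s: "(\<lambda>t. norm (s n t)) \<in> borel_measurable lebesgue" for n
      by (rule borel_measurable_simple_function, rule simple_function_compose1)
        (rule spec[OF conjunct1[OF s]])
    have "AE t in lebesgue. lim (\<lambda>n. norm (s n t)) = norm (h t)"
      using conjunct2[OF s] by eventually_elim (rule limI, rule tendsto_norm)
    then have "(\<lambda>t. norm (h t)) \<in> borel_measurable lebesgue"
      by (rule borel_measurable_AE[OF borel_measurable_lim_metric[OF meas_s]])
    then show ?thesis
      by (intro powr_real_measurable borel_measurable_const)
  qed
  have "integral\<^sup>L lebesgue (\<lambda>t. norm (f t) powr p) = integral\<^sup>L lebesgue (\<lambda>t. norm (g t) powr p)"
  proof (rule integral_cong_AE)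
    show "AE t in lebesgue. norm (f t) powr p = norm (g t) powr p"
      using conjunct2[OF conjunct2[OF *]] by eventually_elim simp
  qed (rule meas, simp add: *)+
  then   show "(integral\<^sup>L lebesgue (\<lambda>t. norm (f t) powr p)) powr (1 / p) =
        (integral\<^sup>L lebesgue (\<lambda>t. norm (g t) powr p)) powr (1 / p)"
    by simp
qed

lift_definition L0_integral :: "real set \<Rightarrow> 'x::real_normed_vector L0 \<Rightarrow> 'x" is
  "\<lambda>S f. integral S f"
proof -
  fix S and f g :: "real \<Rightarrow> 'x"
  assume *: "strongly_measurable UNIV f \<and> strongly_measurable UNIV g \<and>
    (AE t in lebesgue. f t = g t)"
  obtain N where "N \<in> null_sets lebesgue" "{t \<in> space lebesgue. f t \<noteq> g t} \<subseteq> N"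
    using conjunct2[OF conjunct2[OF *]] unfolding eventually_ae_filter by (rule bexE)
  then have "negligible {t. f t \<noteq> g t}"
    using negligible_subset[of N "{t. f t \<noteq> g t}"] by (simp add: negligible_iff_null_sets)
  then show "integral S f = integral S g"
    by (rule integral_spike[where T = S and f = f and g = g]) simp
qed

text \<open>\<open>W1p_deriv p a b f g\<close>: \<open>f\<close> is the continuous representative of an element of
  \<open>W\<^sup>1\<^sup>,\<^sup>p([a,b])\<close> whose weak derivative is \<open>g\<close>.\<close>

definition W1p_deriv ::
  "real \<Rightarrow> real \<Rightarrow> real \<Rightarrow> (real \<Rightarrow> 'x::banach) \<Rightarrow> (real \<Rightarrow> 'x) \<Rightarrow> bool" where
  "W1p_deriv p a b f g \<longleftrightarrow>
    Lp_fun p {a..b} g \<and> (\<forall>t\<in>{a..b}. f t = f a + integral {a..t} g)"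

definition W1p :: "real \<Rightarrow> real \<Rightarrow> real \<Rightarrow> (real \<Rightarrow> 'x::banach) set" where
  "W1p p a b = {f. \<exists>g. W1p_deriv p a b f g}"

section \<open>Operators, semigroups and spectra\<close>

text \<open>Semigroups live on a subspace \<open>V\<close> of a real vector space, normed by \<open>N\<close>; this
  covers both a Banach space type (\<open>V = UNIV\<close>, \<open>N = norm\<close>) and spaces such as
  \<open>Lp p S\<close>. Unbounded operators are represented by their graphs.\<close>

definition bounded_op_on ::
  "'v::real_vector set \<Rightarrow> ('v \<Rightarrow> real) \<Rightarrow> ('v \<Rightarrow> 'v) \<Rightarrow> bool" where
  "bounded_op_on V N S \<longleftrightarrow>
    (\<forall>x\<in>V. S x \<in> V) \<and>
    (\<forall>x\<in>V. \<forall>y\<in>V. S (x + y) = S x + S y) \<and>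
    (\<forall>x\<in>V. \<forall>c. S (c *\<^sub>R x) = c *\<^sub>R S x) \<and>
    (\<exists>K. \<forall>x\<in>V. N (S x) \<le> K * N x)"

definition C0_semigroup ::
  "'v::real_vector set \<Rightarrow> ('v \<Rightarrow> real) \<Rightarrow> (real \<Rightarrow> 'v \<Rightarrow> 'v) \<Rightarrow> bool" where
  "C0_semigroup V N T \<longleftrightarrow>
    (\<forall>t\<ge>0. bounded_op_on V N (T t)) \<and>
    (\<forall>x\<in>V. T 0 x = x) \<and>
    (\<forall>s\<ge>0. \<forall>t\<ge>0. \<forall>x\<in>V. T (s + t) x = T s (T t x)) \<and>
    (\<forall>x\<in>V. ((\<lambda>t. N (T t x - x)) \<longlongrightarrow> 0) (at_right 0))"

definition generator ::
  "'v::real_vector set \<Rightarrow> ('v \<Rightarrow> real) \<Rightarrow> (real \<Rightarrow> 'v \<Rightarrow> 'v) \<Rightarrow> ('v \<times> 'v) set" where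
  "generator V N T =
    {(x, y). x \<in> V \<and> y \<in> V \<and> ((\<lambda>t. N ((1 / t) *\<^sub>R (T t x - x) - y)) \<longlongrightarrow> 0) (at_right 0)}"

definition generates ::
  "'v::real_vector set \<Rightarrow> ('v \<Rightarrow> real) \<Rightarrow> ('v \<times> 'v) set \<Rightarrow> (real \<Rightarrow> 'v \<Rightarrow> 'v) \<Rightarrow> bool" where
  "generates V N A T \<longleftrightarrow> C0_semigroup V N T \<and> generator V N T = A"

definition positive_semigroup ::
  "'v::{real_vector, ord} set \<Rightarrow> (real \<Rightarrow> 'v \<Rightarrow> 'v) \<Rightarrow> bool" where
  "positive_semigroup V T \<longleftrightarrow> (\<forall>t\<ge>0. \<forall>x\<in>V. 0 \<le> x \<longrightarrow> 0 \<le> T t x)"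

text \<open>The spectrum of an operator on a real Banach space is that of its complexification:
  a pair \<open>(x, y)\<close> stands for \<open>x + \<i>y\<close>, so \<open>cscale\<close> is multiplication by a
  complex number. The product norm is equivalent to any of the usual complexification norms.\<close>

definition cscale :: "complex \<Rightarrow> 'x::real_vector \<times> 'x \<Rightarrow> 'x \<times> 'x" where
  "cscale c z = (Re c *\<^sub>R fst z - Im c *\<^sub>R snd z, Im c *\<^sub>R fst z + Re c *\<^sub>R snd z)"

definition complexify :: "('x \<times> 'x) set \<Rightarrow> (('x \<times> 'x) \<times> ('x \<times> 'x)) set" where
  "complexify A = {((x1, x2), (y1, y2)). (x1, y1) \<in> A \<and> (x2, y2) \<in> A}"

definition resolvent_set :: "('x::real_normed_vector \<times> 'x) set \<Rightarrow> complex set" where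
  "resolvent_set A = {c.
    (\<forall>w. \<exists>!z. (z, cscale c z - w) \<in> complexify A) \<and>
    (\<exists>K. \<forall>z w. (z, cscale c z - w) \<in> complexify A \<longrightarrow> norm z \<le> K * norm w)}"

definition spectrum :: "('x::real_normed_vector \<times> 'x) set \<Rightarrow> complex set" where
  "spectrum A = - resolvent_set A"

text \<open>Extended values, so that an empty spectrum gives \<open>-\<infinity>\<close> and \<open>0\<close> respectively.\<close>

definition spectral_bound :: "('x::real_normed_vector \<times> 'x) set \<Rightarrow> ereal" where
  "spectral_bound A = (SUP c\<in>spectrum A. ereal (Re c))"

definition spectral_radius :: "('x::real_normed_vector \<Rightarrow> 'x) \<Rightarrow> ennreal" where
  "spectral_radius S = (SUP c\<in>spectrum {(x, S x) | x. True}. ennreal (cmod c))"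

definition resolvent :: "real \<Rightarrow> ('x::real_vector \<times> 'x) set \<Rightarrow> 'x \<Rightarrow> 'x" where
  "resolvent l A y = (THE x. (x, l *\<^sub>R x - y) \<in> A)"

section \<open>The boundary control system\<close>

text \<open>The space \<open>Z\<close> is a type of its own and \<open>J\<close> is its embedding into \<open>X\<close>.\<close>

definition dense_embedding :: "('z::real_normed_vector \<Rightarrow> 'x::real_normed_vector) \<Rightarrow> bool" where
  "dense_embedding J \<longleftrightarrow> bounded_linear J \<and> inj J \<and> closure (range J) = UNIV"

definition max_graph :: "('z \<Rightarrow> 'x) \<Rightarrow> ('z \<Rightarrow> 'x) \<Rightarrow> ('x \<times> 'x) set" where
  "max_graph J Am = {(J z, Am z) | z. True}"

definition ker_graph ::
  "('z \<Rightarrow> 'x) \<Rightarrow> ('z \<Rightarrow> 'x) \<Rightarrow> ('z \<Rightarrow> 'u::zero) \<Rightarrow> ('x \<times> 'x) set" where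
  "ker_graph J Am G = {(J z, Am z) | z. G z = 0}"

definition dirichlet ::
  "('z \<Rightarrow> 'x::real_vector) \<Rightarrow> ('z \<Rightarrow> 'x) \<Rightarrow> ('z \<Rightarrow> 'u) \<Rightarrow> real \<Rightarrow> 'u \<Rightarrow> 'z" where
  "dirichlet J Am G l u = (THE z. l *\<^sub>R J z - Am z = 0 \<and> G z = u)"

text \<open>\<open>extrapolation_space A j\<close>: the (complete) codomain of \<open>j\<close> is a completion of \<open>X\<close>
  for the norm \<open>\<lambda>x. norm (resolvent l A x)\<close>, with \<open>j\<close> the canonical map. Up to equivalence
  of norms the completion does not depend on \<open>l\<close>. One realisation always exists:
  the codomain \<open>X\<close> with \<open>j = resolvent l A\<close>.\<close>

definition extrapolation_space ::
  "('x::real_normed_vector \<times> 'x) set \<Rightarrow> ('x \<Rightarrow> 'e::banach) \<Rightarrow> bool" where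
  "extrapolation_space A j \<longleftrightarrow>
    linear j \<and> closure (range j) = UNIV \<and>
    (\<exists>l. complex_of_real l \<in> resolvent_set A \<and> (\<forall>x. norm (j x) = norm (resolvent l A x)))"

definition extrap_semigroup ::
  "('x \<Rightarrow> 'e::real_normed_vector) \<Rightarrow> (real \<Rightarrow> 'x \<Rightarrow> 'x) \<Rightarrow> real \<Rightarrow> 'e \<Rightarrow> 'e" where
  "extrap_semigroup j T t = (THE S. bounded_linear S \<and> (\<forall>x. S (j x) = j (T t x)))"

definition extrap_generator ::
  "('x::real_normed_vector \<Rightarrow> 'e::real_normed_vector) \<Rightarrow> ('x \<times> 'x) set \<Rightarrow> 'x \<Rightarrow> 'e" where
  "extrap_generator j A = (THE S. bounded_linear S \<and> (\<forall>(x, y)\<in>A. S x = j y))"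

text \<open>\<open>B = (l - A\<^sub>-\<^sub>1) D\<^sub>l\<close>, which is independent of the \<open>l\<close> chosen in the resolvent set.\<close>

definition control_op ::
  "('z \<Rightarrow> 'x::real_normed_vector) \<Rightarrow> ('z \<Rightarrow> 'x) \<Rightarrow> ('z \<Rightarrow> 'u::zero) \<Rightarrow>
    ('x \<Rightarrow> 'e::real_normed_vector) \<Rightarrow> 'u \<Rightarrow> 'e" where
  "control_op J Am G j u =
    (let A = ker_graph J Am G;
         l = (SOME l::real. complex_of_real l \<in> resolvent_set A);
         x = J (dirichlet J Am G l u)
     in l *\<^sub>R j x - extrap_generator j A x)"

definition input_map ::
  "('z \<Rightarrow> 'x::real_normed_vector) \<Rightarrow> ('z \<Rightarrow> 'x) \<Rightarrow> ('z \<Rightarrow> 'u::zero) \<Rightarrow>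
    (real \<Rightarrow> 'x \<Rightarrow> 'x) \<Rightarrow> ('x \<Rightarrow> 'e::banach) \<Rightarrow> real \<Rightarrow> (real \<Rightarrow> 'u) \<Rightarrow> 'e" where
  "input_map J Am G T j t u =
    integral {0..t} (\<lambda>s. extrap_semigroup j T (t - s) (control_op J Am G j (u s)))"

definition admissible_observation ::
  "real \<Rightarrow> ('z \<Rightarrow> 'x::real_normed_vector) \<Rightarrow> ('z \<Rightarrow> 'x) \<Rightarrow> ('z \<Rightarrow> 'u::real_normed_vector) \<Rightarrow>
    ('z \<Rightarrow> 'u) \<Rightarrow> (real \<Rightarrow> 'x \<Rightarrow> 'x) \<Rightarrow> bool" where
  "admissible_observation p J Am G M T \<longleftrightarrow>
    (\<exists>\<tau>>0. \<exists>\<gamma>>0. \<forall>x \<in> Domain (ker_graph J Am G).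
      Lp_fun p {0..\<tau>} (\<lambda>t. M (inv J (T t x))) \<and>
      Lp_fun_norm p {0..\<tau>} (\<lambda>t. M (inv J (T t x))) \<le> \<gamma> * norm x)"

definition admissible_control ::
  "real \<Rightarrow> ('z \<Rightarrow> 'x::real_normed_vector) \<Rightarrow> ('z \<Rightarrow> 'x) \<Rightarrow> ('z \<Rightarrow> 'u::real_normed_vector) \<Rightarrow>
    (real \<Rightarrow> 'x \<Rightarrow> 'x) \<Rightarrow> ('x \<Rightarrow> 'e::banach) \<Rightarrow> bool" where
  "admissible_control p J Am G T j \<longleftrightarrow>
    (\<exists>\<tau>>0. \<forall>u. Lp_fun p {0..} u \<longrightarrow> input_map J Am G T j \<tau> u \<in> range j)"

text \<open>\<open>t \<mapsto> M \<Phi>\<^sub>t u\<close>; used only for \<open>u\<close> in \<open>W\<^sup>1\<^sup>,\<^sup>p\<close> with \<open>u 0 = 0\<close>, where \<open>\<Phi>\<^sub>t u\<close>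
  lies in \<open>Z\<close>, so that both inverses are taken in the range of an injective map.\<close>

definition io_fun ::
  "('z \<Rightarrow> 'x::real_normed_vector) \<Rightarrow> ('z \<Rightarrow> 'x) \<Rightarrow> ('z \<Rightarrow> 'u::zero) \<Rightarrow>
    ('z \<Rightarrow> 'u) \<Rightarrow> (real \<Rightarrow> 'x \<Rightarrow> 'x) \<Rightarrow> ('x \<Rightarrow> 'e::banach) \<Rightarrow> (real \<Rightarrow> 'u) \<Rightarrow> real \<Rightarrow> 'u" where
  "io_fun J Am G M T j u t = M (inv J (inv j (input_map J Am G T j t u)))"

definition well_posed_io ::
  "real \<Rightarrow> ('z \<Rightarrow> 'x::real_normed_vector) \<Rightarrow> ('z \<Rightarrow> 'x) \<Rightarrow> ('z \<Rightarrow> 'u::banach) \<Rightarrow>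
    ('z \<Rightarrow> 'u) \<Rightarrow> (real \<Rightarrow> 'x \<Rightarrow> 'x) \<Rightarrow> ('x \<Rightarrow> 'e::banach) \<Rightarrow> bool" where
  "well_posed_io p J Am G M T j \<longleftrightarrow>
    (\<forall>\<alpha>>0. \<exists>\<kappa>. \<forall>u \<in> W1p p 0 \<alpha>. u 0 = 0 \<longrightarrow>
      Lp_fun p {0..\<alpha>} (io_fun J Am G M T j u) \<and>
      Lp_fun_norm p {0..\<alpha>} (io_fun J Am G M T j u) \<le> \<kappa> * Lp_fun_norm p {0..\<alpha>} u)"

text \<open>The bounded extension of the input-output operator to \<open>L\<^sup>p([0,\<alpha>],U)\<close>. Under
  \<open>well_posed_io\<close> it exists, and it is unique on \<open>Lp p {0..\<alpha>}\<close> by density.\<close>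

definition io_op ::
  "real \<Rightarrow> ('z \<Rightarrow> 'x::real_normed_vector) \<Rightarrow> ('z \<Rightarrow> 'x) \<Rightarrow> ('z \<Rightarrow> 'u::banach) \<Rightarrow>
    ('z \<Rightarrow> 'u) \<Rightarrow> (real \<Rightarrow> 'x \<Rightarrow> 'x) \<Rightarrow> ('x \<Rightarrow> 'e::banach) \<Rightarrow> real \<Rightarrow> 'u L0 \<Rightarrow> 'u L0" where
  "io_op p J Am G M T j \<alpha> =
    (SOME F. bounded_op_on (Lp p {0..\<alpha>}) (Lp_norm p) F \<and>
      (\<forall>u \<in> W1p p 0 \<alpha>. u 0 = 0 \<longrightarrow>
        F (L0_of {0..\<alpha>} u) = L0_of {0..\<alpha>} (io_fun J Am G M T j u)))"

definition zero_feedthrough ::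
  "real \<Rightarrow> ('z \<Rightarrow> 'x::real_normed_vector) \<Rightarrow> ('z \<Rightarrow> 'x) \<Rightarrow> ('z \<Rightarrow> 'u::banach) \<Rightarrow>
    ('z \<Rightarrow> 'u) \<Rightarrow> (real \<Rightarrow> 'x \<Rightarrow> 'x) \<Rightarrow> ('x \<Rightarrow> 'e::banach) \<Rightarrow> bool" where
  "zero_feedthrough p J Am G M T j \<longleftrightarrow>
    (\<forall>\<alpha>>0. \<forall>v.
      ((\<lambda>t. (1 / t) *\<^sub>R L0_integral {0..t} (io_op p J Am G M T j \<alpha> (L0_of {0..\<alpha>} (\<lambda>_. v))))
        \<longlongrightarrow> 0) (at_right 0))"

definition regular_triple ::
  "real \<Rightarrow> ('z \<Rightarrow> 'x::real_normed_vector) \<Rightarrow> ('z \<Rightarrow> 'x) \<Rightarrow> ('z \<Rightarrow> 'u::banach) \<Rightarrow>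
    ('z \<Rightarrow> 'u) \<Rightarrow> (real \<Rightarrow> 'x \<Rightarrow> 'x) \<Rightarrow> ('x \<Rightarrow> 'e::banach) \<Rightarrow> bool" where
  "regular_triple p J Am G M T j \<longleftrightarrow>
    admissible_observation p J Am G M T \<and>
    admissible_control p J Am G T j \<and>
    well_posed_io p J Am G M T j \<and>
    zero_feedthrough p J Am G M T j"

definition invertible_on ::
  "'v::real_vector set \<Rightarrow> ('v \<Rightarrow> real) \<Rightarrow> ('v \<Rightarrow> 'v) \<Rightarrow> bool" where
  "invertible_on V N S \<longleftrightarrow>
    bounded_op_on V N S \<and>
    (\<exists>R. bounded_op_on V N R \<and> (\<forall>x\<in>V. R (S x) = x \<and> S (R x) = x))"

section \<open>Delay operators\<close>

definition bounded_variation :: "real \<Rightarrow> real \<Rightarrow> (real \<Rightarrow> 'v::real_normed_vector) \<Rightarrow> bool" where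
  "bounded_variation a b m \<longleftrightarrow>
    (\<exists>V. \<forall>\<D>. \<D> division_of {a..b} \<longrightarrow> (\<Sum>K\<in>\<D>. norm (m (Sup K) - m (Inf K))) \<le> V)"

definition delay_kernel :: "(real \<Rightarrow> 'v::real_normed_vector) \<Rightarrow> bool" where
  "delay_kernel m \<longleftrightarrow>
    bounded_variation (-1) 0 m \<and> continuous (at 0 within {-1..0}) m \<and> m 0 = 0"

text \<open>The Riemann--Stieltjes integral of \<open>f\<close> against the operator-valued \<open>m\<close>, as a limit
  over tagged divisions whose mesh tends to zero.\<close>

definition has_stieltjes_integral ::
  "(real \<Rightarrow> 'x::real_normed_vector \<Rightarrow>\<^sub>L 'y::real_normed_vector) \<Rightarrow> (real \<Rightarrow> 'x) \<Rightarrow>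
    real \<Rightarrow> real \<Rightarrow> 'y \<Rightarrow> bool" where
  "has_stieltjes_integral m f a b I \<longleftrightarrow>
    (\<forall>e>0. \<exists>d>0. \<forall>\<D>. \<D> tagged_division_of {a..b} \<and> (\<lambda>x. ball x d) fine \<D> \<longrightarrow>
      norm ((\<Sum>(x, K)\<in>\<D>. blinfun_apply (m (Sup K) - m (Inf K)) (f x)) - I) < e)"

definition delay_op ::
  "(real \<Rightarrow> 'x::real_normed_vector \<Rightarrow>\<^sub>L 'y::real_normed_vector) \<Rightarrow> (real \<Rightarrow> 'x) \<Rightarrow> 'y" where
  "delay_op m f = (THE I. has_stieltjes_integral m f (-1) 0 I)"

section \<open>The delay boundary operator on the product space\<close>

definition state_space :: "real \<Rightarrow> ('x::real_normed_vector \<times> 'x L0) set" where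
  "state_space p = UNIV \<times> Lp p {-1..0}"

definition state_norm :: "real \<Rightarrow> 'x::real_normed_vector \<times> 'x L0 \<Rightarrow> real" where
  "state_norm p = (\<lambda>(x, f). norm x + Lp_norm p f)"

definition delay_graph ::
  "real \<Rightarrow> ('z \<Rightarrow> 'x::banach) \<Rightarrow> ('z \<Rightarrow> 'x) \<Rightarrow> ('z \<Rightarrow> 'u::real_normed_vector) \<Rightarrow> ('z \<Rightarrow> 'u) \<Rightarrow>
    ((real \<Rightarrow> 'x) \<Rightarrow> 'x) \<Rightarrow> ((real \<Rightarrow> 'x) \<Rightarrow> 'u) \<Rightarrow>
    (('x \<times> 'x L0) \<times> ('x \<times> 'x L0)) set" where
  "delay_graph p J Am G M P L =
    {((J z, L0_of {-1..0} \<phi>), (Am z + P \<phi>, L0_of {-1..0} \<psi>)) | z \<phi> \<psi>.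
      W1p_deriv p (-1) 0 \<phi> \<psi> \<and> G z - M z = L \<phi> \<and> J z = \<phi> 0}"

definition positive_on_W1p ::
  "real \<Rightarrow> ((real \<Rightarrow> 'x::banach_lattice) \<Rightarrow> 'y::{zero, ord}) \<Rightarrow> bool" where
  "positive_on_W1p p S \<longleftrightarrow>
    (\<forall>f \<in> W1p p (-1) 0. (AE t in lebesgue_on {-1..0}. 0 \<le> f t) \<longrightarrow> 0 \<le> S f)"

end

theory Submission
  imports Defs
begin

text \<open>Positivity of the semigroup follows from positivity of the resolvent \<open>R(l, \<A>)\<close>, \<open>\<A> = \<A>\<^sub>P\<^sub>,\<^sub>L\<close>, for all
  large \<open>l\<close> by Euler's formula. Solving \<open>\<phi>' = l \<phi> - \<psi>\<close> and splitting \<open>Z\<close> along \<open>D\<^sub>l\<close>, the resolvent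
  equation becomes a system for \<open>x = \<phi>(0)\<close> and \<open>u = G z\<close> with the positive block operator
  \<open>x \<mapsto> R(l,A) P (exp(l \<cdot>) x) + D\<^sub>l u\<close>, \<open>u \<mapsto> M R(l,A) P (exp(l \<cdot>) x) + L (exp(l \<cdot>) x) + M D\<^sub>l u\<close>.
  As \<open>l\<close> grows, all operators decrease, \<open>P (exp(l \<cdot>) x)\<close> and \<open>L (exp(l \<cdot>) x)\<close> tend to \<open>0\<close> in norm because \<open>\<mu>\<close> and
  \<open>\<nu>\<close> are continuous at \<open>0\<close>, and \<open>M D\<^sub>l\<close> stays below \<open>M D\<^bsub>l0\<^esub>\<close>, whose spectral radius is less than one; hence
  solutions of the system are unique, and positive for positive data. Applying the same estimate along a homotopy
  shows that it is solvable, so the resolvent exists.\<close>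

section \<open>Banach lattices and positive operators\<close>

text \<open>Norms alone do not carry the argument: \<open>M D\<^sub>l\<close> has spectral radius
  below one, but its norm may be large, and for \<open>D\<^sub>l\<close> only a bound uniform in
  \<open>l\<close> is at hand. The spectral condition is therefore turned into an order statement
  about the operator \<open>d0\<close> at \<open>l0\<close>: from \<open>0 \<le> u\<close> and
  \<open>u \<le> d0 u + v\<close> follows \<open>norm u \<le> C * norm v\<close>. Every positive
  operator below \<open>d0\<close> inherits it with the same \<open>C\<close>, so it holds uniformly
  for \<open>l \<ge> l0\<close>. In the coupled system each path from \<open>x\<close> back to
  \<open>x\<close> uses either the direct entry or the entry from \<open>x\<close> to
  \<open>u\<close>, and both contain a delay operator applied to
  \<open>exp (l * t) *\<^sub>R x\<close>. These factors are small for large \<open>l\<close>, and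
  this closes the estimate although the entries leaving \<open>u\<close> are not small. On the
  semigroup side the resolvent is not introduced as a Laplace transform of orbits. Surjectivity of
  \<open>l - \<A>\<close> comes from solving the system, injectivity from dissipativity in an
  equivalent norm, so that Euler's formula needs no integration of orbits.\<close>

lemma norm_abs_lattice: "norm \<bar>x\<bar> = norm (x::'a::banach_lattice)"
  by (rule order.antisym; rule norm_mono_abs) simp_all

lemma norm_mono_nonneg:
  fixes x y :: "'a::banach_lattice"
  assumes "0 \<le> x" "x \<le> y"
  shows "norm x \<le> norm y"
  by (rule norm_mono_abs) (use assms in \<open>simp add: abs_of_nonneg order_trans[OF assms]\<close>)

text \<open>\<open>pprt (- x)\<close> is the negative part of \<open>x\<close>. Its norm is at most
  the distance from \<open>x\<close> to any positive element, which makes the positive cone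
  closed.\<close>

lemma norm_pprt_uminus_le:
  fixes x y :: "'a::banach_lattice"
  assumes "0 \<le> y"
  shows "norm (pprt (- x)) \<le> norm (y - x)"
proof -
  have "- x \<le> y - x" using assms by simp
  also have "\<dots> \<le> \<bar>y - x\<bar>" by (rule abs_ge_self)
  finally have "pprt (- x) \<le> \<bar>y - x\<bar>"
    by (simp add: pprt_def)
  then have "norm (pprt (- x)) \<le> norm \<bar>y - x\<bar>" by (rule norm_mono_nonneg[OF zero_le_pprt])
  then show ?thesis by (simp add: norm_abs_lattice)
qed

lemma pprt_uminus_eq_0_iff: "pprt (- x) = 0 \<longleftrightarrow> 0 \<le> (x::'a::lattice_ab_group_add)"
  using le_zero_iff_zero_pprt[of "- x"] by simp

lemma LIMSEQ_nonneg_lattice: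
  fixes f :: "nat \<Rightarrow> 'a::banach_lattice"
  assumes "f \<longlonglongrightarrow> l" "\<And>n. 0 \<le> f n"
  shows "0 \<le> l"
proof -
  have "(\<lambda>n. norm (f n - l)) \<longlonglongrightarrow> 0"
    using assms(1) by (simp add: LIM_zero tendsto_norm_zero)
  then have "norm (pprt (- l)) \<le> 0"
    by (rule LIMSEQ_le_const) (use norm_pprt_uminus_le[OF assms(2)] in blast)
  then show ?thesis by (simp add: pprt_uminus_eq_0_iff)
qed

lemma positive_linear_mono:
  fixes S :: "'a::ordered_real_vector \<Rightarrow> 'b::ordered_real_vector"
  assumes "linear S" "\<And>x. 0 \<le> x \<Longrightarrow> 0 \<le> S x" "x \<le> y"
  shows "S x \<le> S y"
  using assms(2)[of "y - x"] assms(3) by (simp add: linear_diff[OF assms(1)])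

lemma positive_linear_abs_le:
  fixes S :: "'a::banach_lattice \<Rightarrow> 'b::banach_lattice"
  assumes "linear S" "\<And>x. 0 \<le> x \<Longrightarrow> 0 \<le> S x"
  shows "\<bar>S x\<bar> \<le> S \<bar>x\<bar>"
proof (rule abs_leI)
  show "S x \<le> S \<bar>x\<bar>" by (rule positive_linear_mono[OF assms abs_ge_self])
  have "S (- x) \<le> S \<bar>x\<bar>" by (rule positive_linear_mono[OF assms abs_ge_minus_self])
  then show "- S x \<le> S \<bar>x\<bar>" by (simp add: linear_neg[OF assms(1)])
qed

lemma positive_linear_norm_le:
  fixes S :: "'a::banach_lattice \<Rightarrow> 'b::banach_lattice"
  assumes "linear S" "\<And>x. 0 \<le> x \<Longrightarrow> 0 \<le> S x"
  shows "norm (S x) \<le> norm (S \<bar>x\<bar>)"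
  using norm_mono_nonneg[OF abs_ge_zero positive_linear_abs_le[OF assms]]
  by (simp add: norm_abs_lattice)

text \<open>Automatic continuity. If \<open>S\<close> were unbounded, vectors amplified by more than
  \<open>4 ^ n\<close> could be made positive and scaled to norm \<open>(1/2) ^ n\<close>; their sum
  dominates each of them, so its image would have norm at least \<open>2 ^ n\<close> for every
  \<open>n\<close>. This yields continuity of operators given only as linear and positive.\<close>

lemma positive_linear_bounded:
  fixes S :: "'a::banach_lattice \<Rightarrow> 'b::banach_lattice"
  assumes lin: "linear S" and pos: "\<And>x. 0 \<le> x \<Longrightarrow> 0 \<le> S x"
  shows "bounded_linear S"
proof (rule ccontr)
  assume "\<not> bounded_linear S"
  then have "\<not> (\<exists>K. \<forall>x. norm (S x) \<le> norm x * K)"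
    using lin by (auto simp: bounded_linear_def bounded_linear_axioms_def)
  then have "\<forall>n. \<exists>x. norm x * 4 ^ n < norm (S x)" for n :: nat
    by (meson not_le)
  then obtain x where x: "\<And>n. norm (x n) * 4 ^ n < norm (S (x n))" for n :: nat
    by metis
  have nz: "norm (x n) > 0" for n
    using x[of n] by (cases "x n = 0") (simp_all add: linear_0[OF lin])
  define y where "y n = (1 / (2 ^ n * norm (x n))) *\<^sub>R \<bar>x n\<bar>" for n
  have y0: "0 \<le> y n" for n
    unfolding y_def by (intro scaleR_nonneg_nonneg) simp_all
  have ny: "norm (y n) = (1/2) ^ n" for n
    using nz[of n] by (simp add: y_def norm_abs_lattice power_divide)
  have "summable y"
    by (rule summable_norm_cancel) (simp add: ny)
  then have lim: "(\<lambda>n. sum y {..<n}) \<longlonglongrightarrow> suminf y"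
    by (rule summable_LIMSEQ)
  have yle: "y n \<le> suminf y" for n
  proof -
    have "(\<lambda>k. sum y {..<k + Suc n} - y n) \<longlonglongrightarrow> suminf y - y n"
      by (intro tendsto_intros LIMSEQ_ignore_initial_segment[OF lim])
    moreover have "0 \<le> sum y {..<k + Suc n} - y n" for k
      using sum.remove[of "{..<k + Suc n}" n y] by (simp add: sum_nonneg y0)
    ultimately have "0 \<le> suminf y - y n" by (rule LIMSEQ_nonneg_lattice)
    then show ?thesis by simp
  qed
  have big: "2 ^ n \<le> norm (S (suminf y))" for n
  proof -
    have "2 ^ n = (1 / (2 ^ n * norm (x n))) * (norm (x n) * 4 ^ n)"
      using nz[of n] by (simp add: field_simps flip: power_mult_distrib)
    also have "\<dots> \<le> (1 / (2 ^ n * norm (x n))) * norm (S \<bar>x n\<bar>)"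
      using x[of n] positive_linear_norm_le[OF lin pos, of "x n"] nz[of n]
      by (intro mult_left_mono) simp_all
    also have "\<dots> = norm (S (y n))"
      using nz[of n] by (simp add: y_def linear_scale[OF lin])
    also have "\<dots> \<le> norm (S (suminf y))"
      by (intro norm_mono_nonneg pos y0 positive_linear_mono[OF lin pos yle])
    finally show ?thesis .
  qed
  obtain n where "norm (S (suminf y)) < 2 ^ n"
    using real_arch_pow[of 2 "norm (S (suminf y))"] by auto
  with big[of n] show False by simp
qed

section \<open>Positive operators with spectral radius below one\<close>

text \<open>The positivity of \<open>(s - d)\<^sup>-\<^sup>1\<close> is transported from large \<open>s\<close> down to \<open>s = 1\<close>,
  using only that \<open>s - d\<close> stays boundedly invertible on the way; this replaces the Neumann
  series at \<open>s = 1\<close> and Gelfand's formula.\<close>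

lemma positive_inverse_step:
  fixes d :: "'a::banach_lattice \<Rightarrow> 'a"
  assumes sol: "\<And>y. \<exists>z. s *\<^sub>R z - d z = y"
    and K: "\<And>z. norm z \<le> K * norm (s *\<^sub>R z - d z)"
    and E: "\<And>z. 0 \<le> s *\<^sub>R z - d z \<Longrightarrow> 0 \<le> z"
    and lin: "linear d"
    and s': "s' \<le> s" "(s - s') * K < 1" and z: "0 \<le> s' *\<^sub>R z - d z"
  shows "0 \<le> z"
proof -
  define n where "n = pprt (- z)"
  have n0: "0 \<le> n" and nz: "- z \<le> n" by (simp_all add: n_def pprt_def)
  \<comment> \<open>Passing from \<open>s'\<close> to \<open>s\<close> adds the term
    \<open>(s - s') *\<^sub>R z\<close>, which may fail to be positive. Adding
    \<open>(s - s') *\<^sub>R w\<close> to \<open>z\<close> changes it into a multiple of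
    \<open>z + n \<ge> 0\<close>. Hence the negative part \<open>n\<close> is at most
    \<open>(s - s') *\<^sub>R w\<close>, whose norm is at most \<open>(s - s') * K < 1\<close> times
    that of \<open>n\<close>.\<close>
  obtain w where w: "s *\<^sub>R w - d w = n" using sol by blast
  have w0: "0 \<le> w" by (rule E) (simp add: w n0)
  have "s *\<^sub>R (z + (s - s') *\<^sub>R w) - d (z + (s - s') *\<^sub>R w)
      = (s' *\<^sub>R z - d z) + (s - s') *\<^sub>R (z + (s *\<^sub>R w - d w))"
    by (simp add: linear_add[OF lin] linear_diff[OF lin] linear_scale[OF lin] algebra_simps)
  also have "0 \<le> \<dots>"
  proof -
    have "0 \<le> z + n" using add_left_mono[OF nz, of z] by simp
    then have "0 \<le> (s - s') *\<^sub>R (z + n)"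
      using s' by (intro scaleR_nonneg_nonneg) simp_all
    then show ?thesis unfolding w by (rule add_nonneg_nonneg[OF z])
  qed
  finally have "0 \<le> z + (s - s') *\<^sub>R w" by (rule E)
  then have "- z \<le> (s - s') *\<^sub>R w" using add_left_mono[of 0 _ "- z"] by fastforce
  moreover have "0 \<le> (s - s') *\<^sub>R w" using s' w0 by (intro scaleR_nonneg_nonneg) simp_all
  ultimately have "n \<le> (s - s') *\<^sub>R w" by (simp add: n_def pprt_def)
  then have "norm n \<le> norm ((s - s') *\<^sub>R w)" by (rule norm_mono_nonneg[OF n0])
  also have "\<dots> = (s - s') * norm w" using s' by simp
  also have "\<dots> \<le> (s - s') * (K * norm n)"
    using K[of w] s' by (intro mult_left_mono) (simp_all add: w)
  finally have "(1 - (s - s') * K) * norm n \<le> 0" by (simp add: algebra_simps)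
  then have "norm n \<le> 0" using s' by (simp add: mult_le_0_iff)
  then show ?thesis by (simp add: n_def pprt_uminus_eq_0_iff)
qed

lemma positive_inverse:
  fixes d :: "'a::banach_lattice \<Rightarrow> 'a"
  assumes lin: "linear d" and pos: "\<And>x. 0 \<le> x \<Longrightarrow> 0 \<le> d x"
    and sol: "\<And>s y. 1 \<le> s \<Longrightarrow> \<exists>z. s *\<^sub>R z - d z = y"
    and bd: "\<And>s. 1 \<le> s \<Longrightarrow> \<exists>K. \<forall>z. norm z \<le> K * norm (s *\<^sub>R z - d z)"
    and z: "0 \<le> z - d z"
  shows "0 \<le> z"
proof -
  define E where "E = {s. 1 \<le> s \<and> (\<forall>z. 0 \<le> s *\<^sub>R z - d z \<longrightarrow> 0 \<le> z)}"
  obtain B where B: "\<And>x. norm (d x) \<le> norm x * B" "B > 0"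
    using bounded_linear.pos_bounded[OF positive_linear_bounded[OF lin pos]] by metis
  \<comment> \<open>Starting point: above the norm bound \<open>B\<close> of \<open>d\<close>, the
    inequality \<open>(1 + B) *\<^sub>R n \<le> d n\<close> for the negative part \<open>n\<close>
    forces \<open>n = 0\<close>.\<close>
  have "1 + B \<in> E"
  proof -
    have "0 \<le> z" if z: "0 \<le> (1 + B) *\<^sub>R z - d z" for z
    proof -
      define n where "n = pprt (- z)"
      have n0: "0 \<le> n" and nz: "- z \<le> n" by (simp_all add: n_def pprt_def)
      have "d (- z) \<le> d n" by (rule positive_linear_mono[OF lin pos nz])
      then have "(1 + B) *\<^sub>R (- z) \<le> d n"
        using z unfolding linear_neg[OF lin] scaleR_minus_right
        by (meson diff_ge_0_iff_ge neg_le_iff_le order_trans)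
      then have "- z \<le> (1 / (1 + B)) *\<^sub>R d n"
        using scaleR_left_mono[of "(1 + B) *\<^sub>R (- z)" "d n" "1 / (1 + B)"] B(2) by simp
      moreover have "0 \<le> (1 / (1 + B)) *\<^sub>R d n"
        using B(2) n0 by (intro scaleR_nonneg_nonneg pos) simp_all
      ultimately have "n \<le> (1 / (1 + B)) *\<^sub>R d n" by (simp add: n_def pprt_def)
      then have "norm n \<le> norm ((1 / (1 + B)) *\<^sub>R d n)" by (rule norm_mono_nonneg[OF n0])
      also have "\<dots> = norm (d n) / (1 + B)" using B(2) by simp
      finally have "norm n * (1 + B) \<le> norm (d n)" using B(2) by (simp add: field_simps)
      also have "\<dots> \<le> norm n * B" by (rule B)
      finally have "norm n \<le> 0" by (simp add: algebra_simps)
      then show ?thesis by (simp add: n_def pprt_uminus_eq_0_iff)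
    qed
    then show ?thesis using B(2) by (simp add: E_def)
  qed
  then have ne: "E \<noteq> {}" by auto
  have bdd: "bdd_below E" unfolding E_def by (rule bdd_belowI[of _ 1]) auto
  \<comment> \<open>The infimum must be 1: otherwise a step from a point just above \<open>m\<close>
    would end in \<open>E\<close> strictly below \<open>m\<close>. The resolvent bound is taken at
    \<open>m\<close> itself, since a bound at the point \<open>s\<close> chosen later could depend
    on the choice.\<close>
  define m where "m = Inf E"
  have m1: "1 \<le> m" unfolding m_def by (rule cInf_greatest[OF ne]) (simp add: E_def)
  obtain K0 where K0: "\<And>z. norm z \<le> K0 * norm (m *\<^sub>R z - d z)" using bd[OF m1] by blast
  define K where "K = max K0 1"
  have K1: "K \<ge> 1" by (simp add: K_def)
  have K: "norm z \<le> K * norm (m *\<^sub>R z - d z)" for z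
    using K0[of z] by (rule order_trans) (simp add: K_def mult_right_mono)
  \<comment> \<open>From \<open>s < m + e\<close> down to \<open>m - e\<close> the step has length
    at most \<open>2 * e\<close>. Moving from \<open>m\<close> to \<open>s\<close> worsens the bound
    \<open>K\<close> to at most \<open>2 * K\<close>, and \<open>(2 * e) * (2 * K) = 1 / 2\<close>
    is admissible for \<open>positive_inverse_step\<close>.\<close>
  define e where "e = 1 / (8 * K)"
  have e: "e > 0" "e * K = 1 / 8" using K1 by (simp_all add: e_def)
  obtain s where s: "s \<in> E" "s < m + e"
    using cInf_lessD[OF ne, of "m + e"] e by (auto simp: m_def)
  have ms: "m \<le> s" unfolding m_def by (rule cInf_lower[OF s(1) bdd])
  have s1: "1 \<le> s" using ms m1 by simp
  have Ks: "norm z \<le> 2 * K * norm (s *\<^sub>R z - d z)" for z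
  proof -
    have "norm (m *\<^sub>R z - d z) = norm ((s *\<^sub>R z - d z) - (s - m) *\<^sub>R z)"
      by (simp add: algebra_simps)
    also have "\<dots> \<le> norm (s *\<^sub>R z - d z) + norm ((s - m) *\<^sub>R z)"
      by (rule norm_triangle_ineq4)
    also have "norm ((s - m) *\<^sub>R z) \<le> e * norm z"
      using ms s(2) by (simp add: mult_right_mono)
    finally have "K * norm (m *\<^sub>R z - d z) \<le> K * (norm (s *\<^sub>R z - d z) + e * norm z)"
      using K1 by (intro mult_left_mono) simp_all
    also have "\<dots> = K * norm (s *\<^sub>R z - d z) + (e * K) * norm z" by (simp add: algebra_simps)
    finally have "norm z \<le> K * norm (s *\<^sub>R z - d z) + 1 / 8 * norm z"
      using K[of z] unfolding e(2) by linarith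
    moreover have "0 \<le> K * norm (s *\<^sub>R z - d z)" using K1 by simp
    ultimately show ?thesis using norm_ge_zero[of z] by linarith
  qed
  have step: "s' \<in> E" if "1 \<le> s'" "s' \<le> s" "m - e \<le> s'" for s'
  proof -
    have "(s - s') * (2 * K) \<le> (2 * e) * (2 * K)"
      using that s(2) K1 by (intro mult_right_mono) simp_all
    also have "\<dots> = 4 * (e * K)" by simp
    also have "\<dots> < 1" by (simp only: e(2))
    finally have "(s - s') * (2 * K) < 1" .
    then show ?thesis
      using positive_inverse_step[of s d "2 * K" s', OF sol[OF s1] Ks _ lin] s(1) that
      by (auto simp: E_def)
  qed
  have "1 \<in> E"
  proof (cases "m - e \<le> 1")
    case True
    then show ?thesis using step[of 1] s1 by simp
  next
    case False
    then have "m - e \<in> E" using step[of "m - e"] ms e by simp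
    then have "m \<le> m - e" unfolding m_def using bdd by (rule cInf_lower)
    then show ?thesis using e by simp
  qed
  then show ?thesis using z by (simp add: E_def)
qed

text \<open>Solve \<open>w - d w = v\<close>; then \<open>w - u\<close> has a nonnegative image
  under \<open>1 - d\<close>, so \<open>0 \<le> u \<le> w\<close>, and the norm of \<open>w\<close>
  is controlled by that of \<open>v\<close>. The order form is chosen because it passes, with the
  same constant, to every positive operator dominated by \<open>d\<close>.\<close>

lemma subinvariant_norm_bound:
  fixes d :: "'a::banach_lattice \<Rightarrow> 'a"
  assumes lin: "linear d" and pos: "\<And>x. 0 \<le> x \<Longrightarrow> 0 \<le> d x"
    and sol: "\<And>s y. 1 \<le> s \<Longrightarrow> \<exists>z. s *\<^sub>R z - d z = y"
    and bd: "\<And>s. 1 \<le> s \<Longrightarrow> \<exists>K. \<forall>z. norm z \<le> K * norm (s *\<^sub>R z - d z)"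
  shows "\<exists>K>0. \<forall>u v. 0 \<le> u \<longrightarrow> u \<le> d u + v \<longrightarrow> norm u \<le> K * norm v"
proof -
  obtain K0 where K0: "\<And>z. norm z \<le> K0 * norm (z - d z)" using bd[of 1] by auto
  have "norm u \<le> max K0 1 * norm v" if u: "0 \<le> u" "u \<le> d u + v" for u v
  proof -
    obtain w where w: "w - d w = v" using sol[of 1 v] by auto
    have *: "0 \<le> (w - u) - d (w - u)"
      using u(2) by (simp add: linear_diff[OF lin] algebra_simps flip: w)
    have "0 \<le> w - u"
      by (rule positive_inverse[OF lin]) (use pos sol bd * in auto)
    then have "norm u \<le> norm w" by (intro norm_mono_nonneg u(1)) simp
    also have "\<dots> \<le> K0 * norm v" using K0[of w] by (simp add: w)
    also have "\<dots> \<le> max K0 1 * norm v" by (rule mult_right_mono) simp_all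
    finally show ?thesis .
  qed
  then show ?thesis by (intro exI[of _ "max K0 1"]) auto
qed

text \<open>Since the a priori bound is uniform in \<theta>, solvability at \<theta> implies
  solvability at \<open>\<theta> + 1 / N\<close> by Banach's fixed point theorem as soon as
  \<open>N > C' * k\<close>. Finitely many steps lead from the identity to \<open>1 - K\<close>,
  with no smallness of \<open>K\<close>.\<close>

lemma continuity_method:
  fixes K :: "'a::banach \<Rightarrow> 'a"
  assumes K: "bounded_linear K"
    and C: "\<And>\<theta> w. 0 \<le> \<theta> \<Longrightarrow> \<theta> \<le> 1 \<Longrightarrow> norm w \<le> C * norm (w - \<theta> *\<^sub>R K w)"
  shows "\<exists>w. w - K w = v"
proof -
  interpret K: bounded_linear K by (rule K)
  obtain k where k: "\<And>x. norm (K x) \<le> norm x * k" "k > 0" using K.pos_bounded by metis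
  define C' where "C' = max C 1"
  have C'1: "C' \<ge> 1" by (simp add: C'_def)
  have C': "norm w \<le> C' * norm (w - \<theta> *\<^sub>R K w)" if "0 \<le> \<theta>" "\<theta> \<le> 1" for \<theta> w
    using C[OF that] by (rule order_trans) (simp add: C'_def mult_right_mono)
  obtain N where N: "C' * k < real N" using reals_Archimedean2 by blast
  have N0: "real N > 0" using N k(2) C'1 by (smt (verit) mult_pos_pos)
  have "n \<le> N \<Longrightarrow> \<forall>v. \<exists>w. w - (real n / real N) *\<^sub>R K w = v" for n
  proof (induction n)
    case 0
    then show ?case by simp
  next
    case (Suc n)
    define \<theta> where "\<theta> = real n / real N"
    have th: "0 \<le> \<theta>" "\<theta> \<le> 1" using Suc.prems by (simp_all add: \<theta>_def)
    obtain R where R: "\<And>v. R v - \<theta> *\<^sub>R K (R v) = v"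
      using Suc by (metis Suc_leD \<theta>_def)
    \<comment> \<open>\<open>R\<close> merely selects solutions; the a priori bound at \<theta>,
      applied to a difference of two of them, makes it Lipschitz.\<close>
    have Rlip: "norm (R v - R v') \<le> C' * norm (v - v')" for v v'
    proof -
      have "(R v - R v') - \<theta> *\<^sub>R K (R v - R v') = (R v - \<theta> *\<^sub>R K (R v)) - (R v' - \<theta> *\<^sub>R K (R v'))"
        by (simp add: K.diff algebra_simps)
      then show ?thesis using C'[OF th, of "R v - R v'"] by (simp add: R)
    qed
    show ?case
    proof
      fix v
      \<comment> \<open>A fixed point of \<open>f\<close> solves the equation with parameter
        \<open>\<theta> + 1 / N\<close> and right-hand side \<open>v\<close>.\<close>
      define f where "f w = R (v + (1 / real N) *\<^sub>R K w)" for w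
      have "dist (f x) (f y) \<le> (C' * k / real N) * dist x y" for x y
      proof -
        have "dist (f x) (f y) \<le> C' * norm ((1 / real N) *\<^sub>R K (x - y))"
          using Rlip[of "v + (1 / real N) *\<^sub>R K x" "v + (1 / real N) *\<^sub>R K y"]
          by (simp add: f_def dist_norm K.diff scaleR_diff_right)
        also have "\<dots> = C' * (norm (K (x - y)) / real N)" using N0 by simp
        also have "\<dots> \<le> C' * (norm (x - y) * k / real N)"
          using k(1) C'1 N0 by (intro mult_left_mono divide_right_mono) simp_all
        finally show ?thesis by (simp add: dist_norm algebra_simps)
      qed
      moreover have "0 \<le> C' * k / real N" "C' * k / real N < 1"
        using N N0 k(2) C'1 by simp_all
      ultimately have "\<exists>!w. f w = w" by (intro banach_fix_type) auto
      then obtain w where "f w = w" by blast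
      then have "w - \<theta> *\<^sub>R K w = v + (1 / real N) *\<^sub>R K w"
        using R[of "v + (1 / real N) *\<^sub>R K w"] by (simp add: f_def)
      moreover have "real (Suc n) / real N = \<theta> + 1 / real N"
        by (simp add: \<theta>_def add_divide_distrib)
      ultimately show "\<exists>w. w - (real (Suc n) / real N) *\<^sub>R K w = v"
        by (intro exI[of _ w]) (simp add: algebra_simps)
    qed
  qed
  from this[of N] show ?thesis using N0 by simp
qed

section \<open>Coupled systems of positive operators\<close>

lemma block_system_bound:
  fixes x f :: "'x::banach_lattice" and u g :: "'u::banach_lattice"
  assumes C: "\<And>u v. 0 \<le> u \<Longrightarrow> u \<le> d u + v \<Longrightarrow> norm u \<le> C * norm (v::'u)" "0 < C"
    and B: "\<And>u. norm (b u) \<le> B * norm u" "0 \<le> B"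
    and a: "\<And>x. norm (a x) \<le> \<alpha> * norm x" and c: "\<And>x. norm (c x) \<le> \<gamma> * norm x"
    and small: "\<alpha> + B * C * \<gamma> \<le> 1 / 2"
    and x: "0 \<le> x" "x \<le> a x + b u + f" and u: "0 \<le> u" "u \<le> c x + d u + g"
  shows "norm x \<le> 2 * (B * C * norm g + norm f)"
    and "norm u \<le> C * (\<gamma> * norm x + norm g)"
proof -
  have "norm u \<le> C * norm (c x + g)" by (rule C(1)) (use u in \<open>simp_all add: algebra_simps\<close>)
  also have "\<dots> \<le> C * (\<gamma> * norm x + norm g)"
    using C(2) norm_triangle_ineq[of "c x" g] c[of x] by (intro mult_left_mono) simp_all
  finally show *: "norm u \<le> C * (\<gamma> * norm x + norm g)" .
  have "norm x \<le> norm (a x + b u + f)" by (rule norm_mono_nonneg[OF x])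
  also have "\<dots> \<le> norm (a x) + norm (b u) + norm f"
    by (intro norm_triangle_le add_right_mono norm_triangle_ineq)
  also have "\<dots> \<le> \<alpha> * norm x + B * norm u + norm f"
    using a[of x] B(1)[of u] by simp
  \<comment> \<open>The detour from \<open>x\<close> to \<open>u\<close> and back costs the factor
    \<open>B * C * \<gamma>\<close>. Together with \<alpha> it is at most one half and can be
    absorbed on the left, which produces the factor 2 in the conclusion.\<close>
  also have "\<dots> \<le> \<alpha> * norm x + B * (C * (\<gamma> * norm x + norm g)) + norm f"
    using mult_left_mono[OF * B(2)] by simp
  also have "\<dots> = (\<alpha> + B * C * \<gamma>) * norm x + (B * C * norm g + norm f)"
    by (simp add: algebra_simps)
  also have "\<dots> \<le> (1 / 2) * norm x + (B * C * norm g + norm f)"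
    by (intro add_right_mono mult_right_mono small) simp
  finally show "norm x \<le> 2 * (B * C * norm g + norm f)" by simp
qed

text \<open>Both claims reduce to \<open>block_system_bound\<close>. For positivity, the negative
  parts of \<open>x\<close> and \<open>u\<close> satisfy its inequalities with zero data. For
  solvability, the absolute values of a solution satisfy them with the absolute values of the data,
  uniformly along the homotopy. Comparing \<open>d\<close> with \<open>d0\<close> keeps the
  constants the same for the whole family of systems to which this is applied.\<close>

lemma block_system:
  fixes a :: "'x::banach_lattice \<Rightarrow> 'x" and b :: "'u::banach_lattice \<Rightarrow> 'x"
    and c :: "'x \<Rightarrow> 'u" and d d0 :: "'u \<Rightarrow> 'u"
  assumes lin: "linear a" "linear b" "linear c" "linear d"
    and pos: "\<And>x. 0 \<le> x \<Longrightarrow> 0 \<le> a x" "\<And>u. 0 \<le> u \<Longrightarrow> 0 \<le> b u"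
      "\<And>x. 0 \<le> x \<Longrightarrow> 0 \<le> c x" "\<And>u. 0 \<le> u \<Longrightarrow> 0 \<le> d u"
    and dom: "\<And>u. 0 \<le> u \<Longrightarrow> d u \<le> d0 u"
    and C: "\<And>u v. 0 \<le> u \<Longrightarrow> u \<le> d0 u + v \<Longrightarrow> norm u \<le> C * norm v" "0 < C"
    and B: "\<And>u. norm (b u) \<le> B * norm u" "0 \<le> B"
    and a: "\<And>x. norm (a x) \<le> \<alpha> * norm x" and c: "\<And>x. norm (c x) \<le> \<gamma> * norm x" "0 \<le> \<gamma>"
    and small: "\<alpha> + B * C * \<gamma> \<le> 1 / 2"
  shows block_system_nonneg: "\<And>x u. 0 \<le> x - (a x + b u) \<Longrightarrow> 0 \<le> u - (c x + d u) \<Longrightarrow> 0 \<le> x \<and> 0 \<le> u"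
    and block_system_solvable: "\<exists>x u. x - (a x + b u) = f \<and> u - (c x + d u) = g"
proof -
  have C': "norm u \<le> C * norm v" if "0 \<le> u" "u \<le> d u + v" for u v
  proof (rule C(1)[OF that(1)])
    show "u \<le> d0 u + v" using that(2) dom[OF that(1)] by (meson add_right_mono order_trans)
  qed
  have bound: "norm x \<le> 2 * (B * C * norm g + norm f)" "norm u \<le> C * (\<gamma> * norm x + norm g)"
    if "0 \<le> x" "x \<le> a x + b u + f" "0 \<le> u" "u \<le> c x + d u + g" for x f u g
    by (rule block_system_bound[of d C b B a \<alpha> c \<gamma> x u f g];
        fact C' C(2) B a c(1) small that)+
  show "0 \<le> x \<and> 0 \<le> u" if x: "0 \<le> x - (a x + b u)" and u: "0 \<le> u - (c x + d u)" for x u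
  proof -
    define m where "m = pprt (- x)"
    define n where "n = pprt (- u)"
    have m: "0 \<le> m" "- x \<le> m" and n: "0 \<le> n" "- u \<le> n" by (simp_all add: m_def n_def pprt_def)
    have "a (- x) \<le> a m" "c (- x) \<le> c m" "b (- u) \<le> b n" "d (- u) \<le> d n"
      by (rule positive_linear_mono[OF lin(1) pos(1) m(2)] positive_linear_mono[OF lin(3) pos(3) m(2)]
          positive_linear_mono[OF lin(2) pos(2) n(2)] positive_linear_mono[OF lin(4) pos(4) n(2)];
          assumption)+
    then have "a (- x) + b (- u) \<le> a m + b n" "c (- x) + d (- u) \<le> c m + d n"
      by (simp_all add: add_mono)
    moreover have "- x \<le> a (- x) + b (- u)"
      using x by (simp add: linear_neg[OF lin(1)] linear_neg[OF lin(2)] le_diff_eq diff_le_eq add.commute)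
    moreover have "- u \<le> c (- x) + d (- u)"
      using u by (simp add: linear_neg[OF lin(3)] linear_neg[OF lin(4)] le_diff_eq diff_le_eq add.commute)
    ultimately have "- x \<le> a m + b n" "- u \<le> c m + d n"
      by (blast intro: order_trans)+
    moreover have "0 \<le> a m + b n" "0 \<le> c m + d n"
      using m n by (simp_all add: pos)
    ultimately have "m \<le> a m + b n + 0" "n \<le> c m + d n + 0"
      by (simp_all add: m_def n_def pprt_def)
    from bound[OF m(1) this(1) n(1) this(2)] have "norm m = 0" "norm n \<le> 0" by simp_all
    then show ?thesis by (simp add: m_def n_def pprt_uminus_eq_0_iff)
  qed
  define K where "K = (\<lambda>(x, u). (a x + b u, c x + d u))"
  have bl: "bounded_linear a" "bounded_linear b" "bounded_linear c" "bounded_linear d"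
    by (rule positive_linear_bounded[OF lin(1) pos(1)] positive_linear_bounded[OF lin(2) pos(2)]
        positive_linear_bounded[OF lin(3) pos(3)] positive_linear_bounded[OF lin(4) pos(4)]; assumption)+
  have blK: "bounded_linear K"
  proof -
    have "bounded_linear (\<lambda>w. (a (fst w) + b (snd w), c (fst w) + d (snd w)))"
      by (intro bounded_linear_Pair bounded_linear_add
          bounded_linear_compose[OF bl(1)] bounded_linear_compose[OF bl(2)]
          bounded_linear_compose[OF bl(3)] bounded_linear_compose[OF bl(4)]
          bounded_linear_fst bounded_linear_snd)
    then show ?thesis by (simp add: K_def case_prod_beta')
  qed
  \<comment> \<open>With both data bounded by \<open>r\<close>, the first component is at most
    \<open>C1 * r\<close>; inserting this in the estimate for the second component gives the
    remaining summand of \<open>C2\<close>.\<close>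
  define C1 where "C1 = 2 * (B * C + 1)"
  have C1: "C1 \<ge> 0" using B(2) C(2) by (simp add: C1_def)
  define C2 where "C2 = C1 + C * (\<gamma> * C1 + 1)"
  have "norm w \<le> C2 * norm (w - \<theta> *\<^sub>R K w)" if th: "0 \<le> \<theta>" "\<theta> \<le> 1" for \<theta> w
  proof -
    obtain x u where w: "w = (x, u)" by fastforce
    define f where "f = x - \<theta> *\<^sub>R (a x + b u)"
    define g where "g = u - \<theta> *\<^sub>R (c x + d u)"
    have fg: "w - \<theta> *\<^sub>R K w = (f, g)" by (simp add: w K_def f_def g_def)
    \<comment> \<open>A factor in the unit interval preserves an upper bound of the absolute value,
      so \<theta> disappears from the inequalities below.\<close>
    have abs1: "\<bar>\<theta> *\<^sub>R v\<bar> \<le> v'" if "\<bar>v\<bar> \<le> v'" for v v' :: "'y::banach_lattice"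
    proof -
      have v': "0 \<le> v'" using that abs_ge_zero order_trans by blast
      have "\<theta> *\<^sub>R v' \<le> v'" using scaleR_right_mono[OF th(2) v'] by simp
      moreover have "\<theta> *\<^sub>R v \<le> \<theta> *\<^sub>R v'" "- (\<theta> *\<^sub>R v) \<le> \<theta> *\<^sub>R v'"
        using scaleR_left_mono[OF abs_le_D1[OF that] th(1)] scaleR_left_mono[OF abs_le_D2[OF that] th(1)]
        by simp_all
      ultimately show ?thesis by (intro abs_leI) (auto intro: order_trans)
    qed
    note abs_le = positive_linear_abs_le[OF lin(1) pos(1)] positive_linear_abs_le[OF lin(2) pos(2)]
      positive_linear_abs_le[OF lin(3) pos(3)] positive_linear_abs_le[OF lin(4) pos(4)]
    have "\<bar>x\<bar> = \<bar>\<theta> *\<^sub>R (a x + b u) + f\<bar>" by (simp add: f_def)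
    also have "\<dots> \<le> \<bar>\<theta> *\<^sub>R (a x + b u)\<bar> + \<bar>f\<bar>" by (rule abs_triangle_ineq)
    also have "\<dots> \<le> a \<bar>x\<bar> + b \<bar>u\<bar> + \<bar>f\<bar>"
      by (intro add_right_mono abs1 order_trans[OF abs_triangle_ineq] add_mono
          abs_le)
    finally have 1: "\<bar>x\<bar> \<le> a \<bar>x\<bar> + b \<bar>u\<bar> + \<bar>f\<bar>" .
    have "\<bar>u\<bar> = \<bar>\<theta> *\<^sub>R (c x + d u) + g\<bar>" by (simp add: g_def)
    also have "\<dots> \<le> \<bar>\<theta> *\<^sub>R (c x + d u)\<bar> + \<bar>g\<bar>" by (rule abs_triangle_ineq)
    also have "\<dots> \<le> c \<bar>x\<bar> + d \<bar>u\<bar> + \<bar>g\<bar>"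
      by (intro add_right_mono abs1 order_trans[OF abs_triangle_ineq] add_mono
          abs_le)
    finally have 2: "\<bar>u\<bar> \<le> c \<bar>x\<bar> + d \<bar>u\<bar> + \<bar>g\<bar>" .
    define r where "r = norm (f, g)"
    have r: "norm f \<le> r" "norm g \<le> r"
      unfolding r_def by (rule norm_fst_le norm_snd_le)+
    have "norm x \<le> 2 * (B * C * norm g + norm f)"
      using bound(1)[OF abs_ge_zero 1 abs_ge_zero 2] by (simp add: norm_abs_lattice)
    also have "\<dots> \<le> 2 * (B * C * r + r)"
      using r B(2) C(2) by (intro mult_left_mono add_mono) simp_all
    finally have x: "norm x \<le> C1 * r" by (simp add: C1_def algebra_simps)
    have "norm u \<le> C * (\<gamma> * norm x + norm g)"
      using bound(2)[OF abs_ge_zero 1 abs_ge_zero 2] by (simp add: norm_abs_lattice)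
    also have "\<dots> \<le> C * (\<gamma> * (C1 * r) + r)"
      using r x c(2) C(2) by (intro mult_left_mono add_mono) simp_all
    finally have u: "norm u \<le> C * (\<gamma> * C1 + 1) * r" by (simp add: algebra_simps)
    have "norm w \<le> norm x + norm u" unfolding w by (rule norm_Pair_le)
    also have "\<dots> \<le> C2 * r" using x u by (simp add: C2_def algebra_simps)
    finally show ?thesis by (simp add: fg r_def)
  qed
  from continuity_method[OF blK this, of "(f, g)"]
  obtain w where "w - K w = (f, g)" by blast
  then show "\<exists>x u. x - (a x + b u) = f \<and> u - (c x + d u) = g"
    by (intro exI[of _ "fst w"] exI[of _ "snd w"]) (auto simp: K_def case_prod_beta prod_eq_iff)
qed

section \<open>Riemann--Stieltjes integrals\<close>

lemma division_of_extend_right: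
  fixes a s t :: real
  assumes D: "D division_of {a..s}" and "a \<le> s" "s < t"
  shows "insert {s..t} D division_of {a..t}" "{s..t} \<notin> D"
proof -
  have "{{s..t}} \<union> D division_of {s..t} \<union> {a..s}"
  proof (rule division_disjoint_union[OF _ D])
    show "{{s..t}} division_of {s..t}" using division_of_self[of s t] assms by simp
  qed auto
  moreover have "{s..t} \<union> {a..s} = {a..t}" using assms by auto
  ultimately show "insert {s..t} D division_of {a..t}" by simp
  show "{s..t} \<notin> D" using division_ofD(2)[OF D, of "{s..t}"] assms by auto
qed

text \<open>\<open>v t\<close> is the total variation over \<open>{a..t}\<close>: a division of
  \<open>{a..s}\<close> is enlarged by the single interval \<open>{s..t}\<close>. Dominating the
  increments of \<open>m\<close> by those of a real function lets the estimates telescope over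
  divisions.\<close>

lemma bounded_variation_majorant:
  fixes m :: "real \<Rightarrow> 'v::real_normed_vector"
  assumes "bounded_variation a b m"
  obtains v :: "real \<Rightarrow> real"
  where "\<And>s t. a \<le> s \<Longrightarrow> s \<le> t \<Longrightarrow> t \<le> b \<Longrightarrow> norm (m t - m s) \<le> v t - v s"
proof -
  define W where "W D = (\<Sum>K\<in>D. norm (m (Sup K) - m (Inf K)))" for D
  define v where "v t = Sup {W D | D. D division_of {a..t}}" for t
  obtain V where V: "\<And>D. D division_of {a..b} \<Longrightarrow> W D \<le> V"
    using assms unfolding bounded_variation_def W_def by blast
  have W_ext: "insert {s..t} D division_of {a..t} \<and> W (insert {s..t} D) = W D + norm (m t - m s)"
    if "D division_of {a..s}" "a \<le> s" "s < t" for D s t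
    using division_of_extend_right[OF that] division_ofD(1)[OF that(1)] that by (simp add: W_def)
  have le_V: "W D \<le> V" if "D division_of {a..t}" "a \<le> t" "t \<le> b" for D t
  proof (cases "t = b")
    case False
    then show ?thesis
      using W_ext[OF that(1,2), of b] V[of "insert {t..b} D"] that norm_ge_zero[of "m b - m t"] by linarith
  qed (use V that in auto)
  have "norm (m t - m s) \<le> v t - v s" if st: "a \<le> s" "s \<le> t" "t \<le> b" for s t
  proof (cases "s = t")
    case False
    have bdd: "bdd_above {W D | D. D division_of {a..t}}"
      using le_V st by (intro bdd_aboveI[of _ V]) auto
    have "v s \<le> v t - norm (m t - m s)"
      unfolding v_def[of s]
    proof (rule cSup_least)
      show "{W D | D. D division_of {a..s}} \<noteq> {}"
        using division_of_self[of a s] st by auto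
      fix r assume "r \<in> {W D | D. D division_of {a..s}}"
      then obtain D where D: "D division_of {a..s}" "r = W D" by blast
      have "s < t" using False st by simp
      from W_ext[OF D(1) st(1) this] have "W D + norm (m t - m s) \<in> {W D | D. D division_of {a..t}}"
        by (metis (mono_tags, lifting) mem_Collect_eq)
      from cSup_upper[OF this bdd] show "r \<le> v t - norm (m t - m s)"
        unfolding v_def D(2) by simp
    qed
    then show ?thesis by simp
  qed simp
  then show ?thesis by (rule that)
qed

text \<open>Both sides are the increment of \<open>m\<close> over the intersection of
  \<open>{k1..k2}\<close> and \<open>{l1..l2}\<close>, and both vanish if the intervals do not
  overlap.\<close>

lemma clamp_swap:
  fixes k1 k2 l1 l2 :: real and m :: "real \<Rightarrow> 'v::ab_group_add"
  assumes "k1 \<le> k2" "l1 \<le> l2"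
  shows "m (max k1 (min k2 l2)) - m (max k1 (min k2 l1))
       = m (max l1 (min l2 k2)) - m (max l1 (min l2 k1))"
proof -
  consider "l2 \<le> k1" | "k2 \<le> l1" | "l1 < k2" "k1 < l2" by linarith
  then show ?thesis
  proof cases
    case 1
    then have "max k1 (min k2 l2) = k1" "max k1 (min k2 l1) = k1"
      "max l1 (min l2 k2) = l2" "max l1 (min l2 k1) = l2" using assms by (simp_all add: max_def min_def)
    then show ?thesis by simp
  next
    case 2
    then have "max k1 (min k2 l2) = k2" "max k1 (min k2 l1) = k2"
      "max l1 (min l2 k2) = l1" "max l1 (min l2 k1) = l1" using assms by (simp_all add: max_def min_def)
    then show ?thesis by simp
  next
    case 3
    then have "max k1 (min k2 l2) = max l1 (min l2 k2)" "max k1 (min k2 l1) = max l1 (min l2 k1)"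
      using assms by (simp_all add: max_def min_def)
    then show ?thesis by (simp only:)
  qed
qed

text \<open>Clamping the endpoints of \<open>L\<close> to \<open>K\<close> yields the increment of \<open>m\<close> over \<open>K \<inter> L\<close>, also when the
  intersection is empty. Two Riemann--Stieltjes sums can thus be compared on a common refinement
  without forming it.\<close>

lemma stieltjes_sums_close:
  fixes m :: "real \<Rightarrow> 'x::real_normed_vector \<Rightarrow>\<^sub>L 'y::real_normed_vector"
  assumes v: "\<And>s t. a \<le> s \<Longrightarrow> s \<le> t \<Longrightarrow> t \<le> b \<Longrightarrow> norm (m t - m s) \<le> v t - v s"
    and ab: "a \<le> b"
    and p: "p tagged_division_of {a..b}" "(\<lambda>x. ball x d) fine p"
    and q: "q tagged_division_of {a..b}" "(\<lambda>x. ball x d) fine q"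
    and f: "\<And>s t. s \<in> {a..b} \<Longrightarrow> t \<in> {a..b} \<Longrightarrow> \<bar>s - t\<bar> < 2 * d \<Longrightarrow> norm (f s - f t) \<le> e"
    and e: "0 \<le> e"
  shows "norm ((\<Sum>(x, K)\<in>p. blinfun_apply (m (Sup K) - m (Inf K)) (f x))
      - (\<Sum>(x, K)\<in>q. blinfun_apply (m (Sup K) - m (Inf K)) (f x))) \<le> e * (v b - v a)"
proof -
  define cl :: "real set \<Rightarrow> real \<Rightarrow> real" where "cl K t = max (Inf K) (min (Sup K) t)" for K t
  define w where "w K L = m (cl K (Sup L)) - m (cl K (Inf L))" for K L
  define vv where "vv K L = v (cl K (Sup L)) - v (cl K (Inf L))" for K L
  have interval: "Inf K \<le> Sup K \<and> a \<le> Inf K \<and> Sup K \<le> b \<and> {Inf K..Sup K} \<subseteq> ball x d \<and> x \<in> {a..b}"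
    if r: "r tagged_division_of {a..b}" "(\<lambda>x. ball x d) fine r" and xK: "(x, K) \<in> r" for r x K
  proof -
    obtain c c' where K: "K = {c..c'}" using tagged_division_ofD(4)[OF r(1) xK] by auto
    have x: "x \<in> K" and sub: "K \<subseteq> {a..b}" using tagged_division_ofD(2,3)[OF r(1) xK] .
    have "c \<le> c'" using x K by auto
    then show ?thesis using x sub r(2) xK K by (auto simp: fine_def)
  qed
  \<comment> \<open>Clamping to \<open>K\<close> sends \<open>a\<close> to \<open>Inf K\<close> and
    \<open>b\<close> to \<open>Sup K\<close>, so the clamped increments along any division add up to
    the whole increment over \<open>K\<close>.\<close>
  have tele: "(\<Sum>(y, L)\<in>r. g (cl K (Sup L)) - g (cl K (Inf L))) = g (Sup K) - g (Inf K)"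
    if "r tagged_division_of {a..b}" "a \<le> Inf K" "Inf K \<le> Sup K" "Sup K \<le> b"
    for r K and g :: "real \<Rightarrow> 'v::real_normed_vector"
  proof -
    have "cl K a = Inf K" "cl K b = Sup K" using that ab by (auto simp: cl_def)
    then show ?thesis
      using additive_tagged_division_1[OF ab that(1), of "\<lambda>t. g (cl K t)"] by simp
  qed
  have sum_eq: "(\<Sum>(x, K)\<in>r. blinfun_apply (m (Sup K) - m (Inf K)) (f x))
      = (\<Sum>(x, K)\<in>r. \<Sum>(y, L)\<in>s. blinfun_apply (w K L) (f x))"
    if r: "r tagged_division_of {a..b}" "(\<lambda>x. ball x d) fine r"
      and s: "s tagged_division_of {a..b}" for r s
  proof (rule sum.cong[OF refl], safe)
    fix x K assume xK: "(x, K) \<in> r"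
    have "m (Sup K) - m (Inf K) = (\<Sum>(y, L)\<in>s. w K L)"
      unfolding w_def using interval[OF r xK] by (intro tele[OF s, symmetric]) auto
    then show "blinfun_apply (m (Sup K) - m (Inf K)) (f x) = (\<Sum>(y, L)\<in>s. blinfun_apply (w K L) (f x))"
      by (simp add: blinfun.sum_left case_prod_beta')
  qed
  have swap: "(\<Sum>(y, L)\<in>q. \<Sum>(x, K)\<in>p. blinfun_apply (w L K) (f y))
      = (\<Sum>(x, K)\<in>p. \<Sum>(y, L)\<in>q. blinfun_apply (w K L) (f y))"
    unfolding case_prod_beta'
  proof (subst sum.swap, intro sum.cong refl)
    fix i k assume "i \<in> p" "k \<in> q"
    then have "Inf (snd i) \<le> Sup (snd i)" "Inf (snd k) \<le> Sup (snd k)"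
      using interval[OF p, of "fst i" "snd i"] interval[OF q, of "fst k" "snd k"] by auto
    then show "blinfun_apply (w (snd k) (snd i)) (f (fst k)) = blinfun_apply (w (snd i) (snd k)) (f (fst k))"
      unfolding w_def cl_def
      by (subst clamp_swap[of "Inf (snd k)" "Sup (snd k)" "Inf (snd i)" "Sup (snd i)" m]) simp_all
  qed
  have summand: "norm (blinfun_apply (w K L) (f x - f y)) \<le> e * vv K L"
    if xK: "(x, K) \<in> p" and yL: "(y, L) \<in> q" for x K y L
  proof -
    note iK = interval[OF p xK] and iL = interval[OF q yL]
    have "norm (w K L) \<le> vv K L"
      unfolding w_def vv_def using iK iL by (intro v) (auto simp: cl_def)
    \<comment> \<open>Only overlapping intervals contribute. A common point lies within
      \<open>d\<close> of both tags, so the tags are less than \<open>2 * d\<close> apart.\<close>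
    moreover have "norm (f x - f y) \<le> e" if "w K L \<noteq> 0"
    proof -
      have "\<not> Sup L < Inf K" "\<not> Sup K < Inf L"
        using that iK iL by (auto simp: w_def cl_def max_def min_def)
      then have in_K: "max (Inf K) (Inf L) \<in> {Inf K..Sup K}"
        and in_L: "max (Inf K) (Inf L) \<in> {Inf L..Sup L}"
        using iK iL by auto
      have "max (Inf K) (Inf L) \<in> ball x d" using in_K iK by blast
      moreover have "max (Inf K) (Inf L) \<in> ball y d" using in_L iL by blast
      ultimately have "\<bar>x - y\<bar> < 2 * d" by (simp add: dist_real_def abs_if split: if_splits)
      moreover have "x \<in> {a..b}" "y \<in> {a..b}"
        using iK iL by blast+
      ultimately show ?thesis by (intro f)
    qed
    moreover have "0 \<le> vv K L" using \<open>norm (w K L) \<le> vv K L\<close> norm_ge_zero order_trans by blast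
    ultimately have "norm (w K L) * norm (f x - f y) \<le> vv K L * e"
      by (cases "w K L = 0") (use e in \<open>simp_all add: mult_mono\<close>)
    then show ?thesis using norm_blinfun[of "w K L" "f x - f y"] by (simp add: mult.commute)
  qed
  have "(\<Sum>(x, K)\<in>p. blinfun_apply (m (Sup K) - m (Inf K)) (f x))
      - (\<Sum>(x, K)\<in>q. blinfun_apply (m (Sup K) - m (Inf K)) (f x))
      = (\<Sum>(x, K)\<in>p. \<Sum>(y, L)\<in>q. blinfun_apply (w K L) (f x - f y))"
    unfolding sum_eq[OF p q(1)] sum_eq[OF q p(1)] swap
    by (simp add: case_prod_beta' sum_subtractf blinfun.diff_right)
  also have "norm \<dots> \<le> (\<Sum>(x, K)\<in>p. \<Sum>(y, L)\<in>q. e * vv K L)"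
    unfolding case_prod_beta' by (intro sum_norm_le) (use summand in auto)
  also have "\<dots> = e * (\<Sum>(x, K)\<in>p. \<Sum>(y, L)\<in>q. vv K L)"
    by (simp add: sum_distrib_left case_prod_beta')
  also have "(\<Sum>(x, K)\<in>p. \<Sum>(y, L)\<in>q. vv K L) = (\<Sum>(x, K)\<in>p. v (Sup K) - v (Inf K))"
  proof (rule sum.cong[OF refl], safe)
    fix x K assume "(x, K) \<in> p"
    from interval[OF p this] show "(\<Sum>(y, L)\<in>q. vv K L) = v (Sup K) - v (Inf K)"
      unfolding vv_def using tele[OF q(1), of K v] by simp
  qed
  also have "\<dots> = v b - v a" by (rule additive_tagged_division_1[OF ab p(1)])
  finally show ?thesis .
qed

lemma fine_ball_mono: "(\<lambda>x. ball x d) fine p \<Longrightarrow> d \<le> d' \<Longrightarrow> (\<lambda>x. ball x d') fine p"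
  unfolding fine_def using subset_ball by blast

lemma has_stieltjes_integralE:
  assumes "has_stieltjes_integral m f a b I" "0 < e"
  obtains d where "0 < d" "\<And>p. p tagged_division_of {a..b} \<Longrightarrow> (\<lambda>x. ball x d) fine p \<Longrightarrow>
      norm ((\<Sum>(x, K)\<in>p. blinfun_apply (m (Sup K) - m (Inf K)) (f x)) - I) < e"
proof -
  obtain d where "0 < d" and d: "\<forall>p. p tagged_division_of {a..b} \<and> (\<lambda>x. ball x d) fine p \<longrightarrow>
      norm ((\<Sum>(x, K)\<in>p. blinfun_apply (m (Sup K) - m (Inf K)) (f x)) - I) < e"
    using assms(1)[unfolded has_stieltjes_integral_def, rule_format, OF assms(2)] by (elim exE conjE)
  show thesis by (rule that[OF \<open>0 < d\<close>]) (rule d[rule_format, OF conjI])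
qed

lemma has_stieltjes_integral_exists:
  fixes m :: "real \<Rightarrow> 'x::real_normed_vector \<Rightarrow>\<^sub>L 'y::banach"
  assumes bv: "bounded_variation a b m" and f: "continuous_on {a..b} f" and ab: "a \<le> b"
  shows "\<exists>I. has_stieltjes_integral m f a b I"
proof -
  obtain v where v: "\<And>s t. a \<le> s \<Longrightarrow> s \<le> t \<Longrightarrow> t \<le> b \<Longrightarrow> norm (m t - m s) \<le> v t - v s"
    using bounded_variation_majorant[OF bv] by blast
  have vab: "0 \<le> v b - v a" using v[of a b] ab norm_ge_zero[of "m b - m a"] by linarith
  define S where "S p = (\<Sum>(x, K)\<in>p. blinfun_apply (m (Sup K) - m (Inf K)) (f x))" for p
  have cauchy: "\<exists>d>0. \<forall>p q. p tagged_division_of {a..b} \<and> (\<lambda>x. ball x d) fine p \<and>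
      q tagged_division_of {a..b} \<and> (\<lambda>x. ball x d) fine q \<longrightarrow> norm (S p - S q) < e" if "e > 0" for e
  proof -
    \<comment> \<open>The summand 1 keeps the denominator of \<open>e'\<close> positive when
      \<open>m\<close> has no variation.\<close>
    define W where "W = v b - v a + 1"
    have W: "W > 0" using vab by (simp add: W_def)
    define e' where "e' = e / (2 * W)"
    have e': "e' > 0" using that W by (simp add: e'_def)
    have "uniformly_continuous_on {a..b} f"
      by (rule compact_uniformly_continuous[OF f]) simp
    then obtain d where d: "d > 0" "\<And>s t. s \<in> {a..b} \<Longrightarrow> t \<in> {a..b} \<Longrightarrow> dist t s < d \<Longrightarrow> dist (f t) (f s) < e'"
      using e' unfolding uniformly_continuous_on_def by metis
    have "norm (S p - S q) < e" if pq: "p tagged_division_of {a..b}" "(\<lambda>x. ball x (d / 2)) fine p"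
      "q tagged_division_of {a..b}" "(\<lambda>x. ball x (d / 2)) fine q" for p q
    proof -
      have "norm (S p - S q) \<le> e' * (v b - v a)"
        unfolding S_def
      proof (rule stieltjes_sums_close[OF v ab pq])
        show "norm (f s - f t) \<le> e'" if "s \<in> {a..b}" "t \<in> {a..b}" "\<bar>s - t\<bar> < 2 * (d / 2)" for s t
          using d(2)[of t s] that by (simp add: dist_norm)
      qed (use e' in auto)
      also have "\<dots> \<le> e' * W" using e' by (simp add: W_def)
      also have "\<dots> = e / 2" using W by (simp add: e'_def)
      also have "\<dots> < e" using \<open>e > 0\<close> by simp
      finally show ?thesis .
    qed
    then show ?thesis using d(1) by (intro exI[of _ "d / 2"]) auto
  qed
  have "\<exists>p. p tagged_division_of {a..b} \<and> (\<lambda>x. ball x (1 / real (Suc n))) fine p" for n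
  proof -
    have "gauge (\<lambda>x::real. ball x (1 / real (Suc n)))" by (rule gauge_ball) simp
    from fine_division_exists_real[OF this] show ?thesis by metis
  qed
  then obtain p where p: "\<And>n. p n tagged_division_of {a..b}"
      "\<And>n. (\<lambda>x. ball x (1 / real (Suc n))) fine p n" by metis
  have fine: "(\<lambda>x. ball x d) fine p n" if "1 / real (Suc n) \<le> d" for n d
    using p(2) that by (rule fine_ball_mono)
  have large: "\<exists>N. \<forall>n\<ge>N. 1 / real (Suc n) \<le> d" if d: "d > 0" for d
  proof -
    obtain N where "1 / real (Suc N) < d" by (rule nat_approx_posE[OF d])
    moreover have "1 / real (Suc n) \<le> 1 / real (Suc N)" if "N \<le> n" for n
      using that by (simp add: frac_le)
    ultimately show ?thesis by (meson less_imp_le order_trans)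
  qed
  have "Cauchy (\<lambda>n. S (p n))"
  proof (rule metric_CauchyI)
    fix e :: real assume "e > 0"
    from cauchy[OF this] obtain d where d: "d > 0" "\<And>p q. p tagged_division_of {a..b} \<Longrightarrow>
      (\<lambda>x. ball x d) fine p \<Longrightarrow> q tagged_division_of {a..b} \<Longrightarrow> (\<lambda>x. ball x d) fine q \<Longrightarrow>
      norm (S p - S q) < e" by metis
    obtain N where "\<forall>n\<ge>N. 1 / real (Suc n) \<le> d" using large[OF d(1)] by blast
    then show "\<exists>M. \<forall>m\<ge>M. \<forall>n\<ge>M. dist (S (p m)) (S (p n)) < e"
      using d(2) p(1) fine by (intro exI[of _ N]) (auto simp: dist_norm)
  qed
  then obtain I where I: "(\<lambda>n. S (p n)) \<longlonglongrightarrow> I" using Cauchy_convergent convergent_def by blast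
  have "has_stieltjes_integral m f a b I"
    unfolding has_stieltjes_integral_def S_def[symmetric]
  proof (intro allI impI)
    fix e :: real assume e: "e > 0"
    then have "e / 2 > 0" by simp
    from cauchy[OF this] obtain d where d: "d > 0" "\<And>p q. p tagged_division_of {a..b} \<Longrightarrow>
      (\<lambda>x. ball x d) fine p \<Longrightarrow> q tagged_division_of {a..b} \<Longrightarrow> (\<lambda>x. ball x d) fine q \<Longrightarrow>
      norm (S p - S q) < e / 2" by metis
    obtain N where N: "\<forall>n\<ge>N. 1 / real (Suc n) \<le> d" using large[OF d(1)] by blast
    have "norm (S q - I) < e" if q: "q tagged_division_of {a..b}" "(\<lambda>x. ball x d) fine q" for q
    proof -
      have "(\<lambda>n. norm (S q - S (p n))) \<longlonglongrightarrow> norm (S q - I)" by (intro tendsto_intros I)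
      moreover have "\<forall>n\<ge>N. norm (S q - S (p n)) \<le> e / 2"
        using N d(2)[OF q p(1) fine] by (auto intro: less_imp_le)
      ultimately have "norm (S q - I) \<le> e / 2" by (meson LIMSEQ_le_const2)
      then show ?thesis using e by simp
    qed
    then show "\<exists>d>0. \<forall>\<D>. \<D> tagged_division_of {a..b} \<and> (\<lambda>x. ball x d) fine \<D> \<longrightarrow> norm (S \<D> - I) < e"
      using d(1) by blast
  qed
  then show ?thesis ..
qed

lemma has_stieltjes_integral_unique:
  assumes I: "has_stieltjes_integral m f a b I" and J: "has_stieltjes_integral m f a b J"
  shows "I = J"
proof (rule ccontr)
  assume "I \<noteq> J"
  then have e: "norm (I - J) / 2 > 0" by simp
  obtain d where d: "d > 0" "\<And>p. p tagged_division_of {a..b} \<Longrightarrow> (\<lambda>x. ball x d) fine p \<Longrightarrow>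
      norm ((\<Sum>(x, K)\<in>p. blinfun_apply (m (Sup K) - m (Inf K)) (f x)) - I) < norm (I - J) / 2"
    by (rule has_stieltjes_integralE[OF I e]) blast
  obtain d' where d': "d' > 0" "\<And>p. p tagged_division_of {a..b} \<Longrightarrow> (\<lambda>x. ball x d') fine p \<Longrightarrow>
      norm ((\<Sum>(x, K)\<in>p. blinfun_apply (m (Sup K) - m (Inf K)) (f x)) - J) < norm (I - J) / 2"
    by (rule has_stieltjes_integralE[OF J e]) blast
  have "gauge (\<lambda>x. ball x d \<inter> ball x d')" using d(1) d'(1) by (intro gauge_Int gauge_ball)
  then obtain p where p: "p tagged_division_of {a..b}" "(\<lambda>x. ball x d \<inter> ball x d') fine p"
    by (rule fine_division_exists_real[of _ a b])
  then have "(\<lambda>x. ball x d) fine p" "(\<lambda>x. ball x d') fine p" by (auto simp: fine_def)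
  from d(2)[OF p(1) this(1)] d'(2)[OF p(1) this(2)] show False
    using norm_triangle_ineq4 [of "(\<Sum>(x, K)\<in>p. blinfun_apply (m (Sup K) - m (Inf K)) (f x)) - J"
        "(\<Sum>(x, K)\<in>p. blinfun_apply (m (Sup K) - m (Inf K)) (f x)) - I"] by simp
qed

lemma has_stieltjes_integral_add:
  assumes I: "has_stieltjes_integral m f a b I" and J: "has_stieltjes_integral m g a b J"
  shows "has_stieltjes_integral m (\<lambda>t. f t + g t) a b (I + J)"
  unfolding has_stieltjes_integral_def
proof (intro allI impI)
  fix e :: real assume "e > 0"
  then have e: "e / 2 > 0" by simp
  obtain d where d: "d > 0" "\<And>p. p tagged_division_of {a..b} \<Longrightarrow> (\<lambda>x. ball x d) fine p \<Longrightarrow>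
      norm ((\<Sum>(x, K)\<in>p. blinfun_apply (m (Sup K) - m (Inf K)) (f x)) - I) < e / 2"
    by (rule has_stieltjes_integralE[OF I e]) blast
  obtain d' where d': "d' > 0" "\<And>p. p tagged_division_of {a..b} \<Longrightarrow> (\<lambda>x. ball x d') fine p \<Longrightarrow>
      norm ((\<Sum>(x, K)\<in>p. blinfun_apply (m (Sup K) - m (Inf K)) (g x)) - J) < e / 2"
    by (rule has_stieltjes_integralE[OF J e]) blast
  have "norm ((\<Sum>(x, K)\<in>p. blinfun_apply (m (Sup K) - m (Inf K)) (f x + g x)) - (I + J)) < e"
    if p: "p tagged_division_of {a..b}" "(\<lambda>x. ball x (min d d')) fine p" for p
  proof -
    have "(\<lambda>x. ball x d) fine p" "(\<lambda>x. ball x d') fine p" by (rule fine_ball_mono[OF p(2)]; simp)+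
    note * = d(2)[OF p(1) this(1)] d'(2)[OF p(1) this(2)]
    have eq: "(\<Sum>(x, K)\<in>p. blinfun_apply (m (Sup K) - m (Inf K)) (f x + g x)) - (I + J)
       = ((\<Sum>(x, K)\<in>p. blinfun_apply (m (Sup K) - m (Inf K)) (f x)) - I)
       + ((\<Sum>(x, K)\<in>p. blinfun_apply (m (Sup K) - m (Inf K)) (g x)) - J)"
      by (simp add: blinfun.add_right sum.distrib case_prod_beta')
    show ?thesis using norm_add_less[OF *] unfolding eq by (simp only: field_sum_of_halves)
  qed
  then show "\<exists>d>0. \<forall>\<D>. \<D> tagged_division_of {a..b} \<and> (\<lambda>x. ball x d) fine \<D> \<longrightarrow>
      norm ((\<Sum>(x, K)\<in>\<D>. blinfun_apply (m (Sup K) - m (Inf K)) (f x + g x)) - (I + J)) < e"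
    using d(1) d'(1) by (intro exI[of _ "min d d'"]) auto
qed

lemma has_stieltjes_integral_scaleR:
  assumes I: "has_stieltjes_integral m f a b I"
  shows "has_stieltjes_integral m (\<lambda>t. c *\<^sub>R f t) a b (c *\<^sub>R I)"
  unfolding has_stieltjes_integral_def
proof (intro allI impI)
  fix e :: real assume "e > 0"
  define e' where "e' = e / (\<bar>c\<bar> + 1)"
  have e: "e' > 0" using \<open>e > 0\<close> by (simp add: e'_def add_nonneg_pos)
  obtain d where d: "d > 0" "\<And>p. p tagged_division_of {a..b} \<Longrightarrow> (\<lambda>x. ball x d) fine p \<Longrightarrow>
      norm ((\<Sum>(x, K)\<in>p. blinfun_apply (m (Sup K) - m (Inf K)) (f x)) - I) < e'"
    by (rule has_stieltjes_integralE[OF I e]) blast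
  have "norm ((\<Sum>(x, K)\<in>p. blinfun_apply (m (Sup K) - m (Inf K)) (c *\<^sub>R f x)) - c *\<^sub>R I) < e"
    if p: "p tagged_division_of {a..b}" "(\<lambda>x. ball x d) fine p" for p
  proof -
    define s where "s = norm ((\<Sum>(x, K)\<in>p. blinfun_apply (m (Sup K) - m (Inf K)) (f x)) - I)"
    have "(\<Sum>(x, K)\<in>p. blinfun_apply (m (Sup K) - m (Inf K)) (c *\<^sub>R f x)) - c *\<^sub>R I
       = c *\<^sub>R ((\<Sum>(x, K)\<in>p. blinfun_apply (m (Sup K) - m (Inf K)) (f x)) - I)"
      by (simp add: blinfun.scaleR_right scaleR_sum_right case_prod_beta' scaleR_diff_right)
    then have "norm ((\<Sum>(x, K)\<in>p. blinfun_apply (m (Sup K) - m (Inf K)) (c *\<^sub>R f x)) - c *\<^sub>R I) = \<bar>c\<bar> * s"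
      by (simp add: s_def)
    also have "\<dots> \<le> (\<bar>c\<bar> + 1) * s" by (intro mult_right_mono) (simp_all add: s_def)
    also have "\<dots> < (\<bar>c\<bar> + 1) * e'"
      using d(2)[OF p] by (intro mult_strict_left_mono) (simp_all add: s_def add_nonneg_pos)
    also have "\<dots> = e" by (simp add: e'_def add_nonneg_eq_0_iff)
    finally show ?thesis .
  qed
  then show "\<exists>d>0. \<forall>\<D>. \<D> tagged_division_of {a..b} \<and> (\<lambda>x. ball x d) fine \<D> \<longrightarrow>
      norm ((\<Sum>(x, K)\<in>\<D>. blinfun_apply (m (Sup K) - m (Inf K)) (c *\<^sub>R f x)) - c *\<^sub>R I) < e"
    using d(1) by blast
qed

lemma has_stieltjes_integral_cong:
  assumes "\<And>t. t \<in> {a..b} \<Longrightarrow> f t = g t"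
  shows "has_stieltjes_integral m f a b I \<longleftrightarrow> has_stieltjes_integral m g a b I"
proof -
  have "(\<Sum>(x, K)\<in>p. blinfun_apply (m (Sup K) - m (Inf K)) (f x))
      = (\<Sum>(x, K)\<in>p. blinfun_apply (m (Sup K) - m (Inf K)) (g x))" if "p tagged_division_of {a..b}" for p
  proof (rule sum.cong[OF refl], safe)
    fix x K assume "(x, K) \<in> p"
    then have "x \<in> {a..b}" using tagged_division_ofD(2,3)[OF that] by blast
    then show "blinfun_apply (m (Sup K) - m (Inf K)) (f x) = blinfun_apply (m (Sup K) - m (Inf K)) (g x)"
      by (simp add: assms)
  qed
  then have "(p tagged_division_of {a..b} \<and> F p \<longrightarrow>
      norm ((\<Sum>(x, K)\<in>p. blinfun_apply (m (Sup K) - m (Inf K)) (f x)) - I) < e) \<longleftrightarrow>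
      (p tagged_division_of {a..b} \<and> F p \<longrightarrow>
      norm ((\<Sum>(x, K)\<in>p. blinfun_apply (m (Sup K) - m (Inf K)) (g x)) - I) < e)" for p F e
    by (cases "p tagged_division_of {a..b}") simp_all
  then show ?thesis unfolding has_stieltjes_integral_def by (simp only:)
qed

section \<open>Delay operators on continuous functions\<close>

lemma delay_op_cong: "(\<And>t. t \<in> {-1..0} \<Longrightarrow> f t = g t) \<Longrightarrow> delay_op m f = delay_op m g"
  using has_stieltjes_integral_cong[of "-1" 0 f g m] by (simp add: delay_op_def)

lemma delay_op_integral:
  fixes m :: "real \<Rightarrow> 'x::real_normed_vector \<Rightarrow>\<^sub>L 'y::banach"
  assumes "delay_kernel m" "continuous_on {-1..0} f"
  shows "has_stieltjes_integral m f (-1) 0 (delay_op m f)"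
proof -
  obtain I where I: "has_stieltjes_integral m f (-1) 0 I"
    using has_stieltjes_integral_exists[of "-1" 0 m f] assms by (auto simp: delay_kernel_def)
  show ?thesis
    using theI[of "\<lambda>I. has_stieltjes_integral m f (-1) 0 I", OF I] has_stieltjes_integral_unique[OF _ I]
    unfolding delay_op_def by blast
qed

lemma delay_op_eqI: "has_stieltjes_integral m f (-1) 0 I \<Longrightarrow> delay_op m f = I"
  unfolding delay_op_def using has_stieltjes_integral_unique by (intro the_equality)

lemma delay_op_add:
  fixes m :: "real \<Rightarrow> 'x::real_normed_vector \<Rightarrow>\<^sub>L 'y::banach"
  assumes "delay_kernel m" "continuous_on {-1..0} f" "continuous_on {-1..0} g"
  shows "delay_op m (\<lambda>t. f t + g t) = delay_op m f + delay_op m g"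
  by (intro delay_op_eqI has_stieltjes_integral_add delay_op_integral assms)

lemma delay_op_scaleR:
  fixes m :: "real \<Rightarrow> 'x::real_normed_vector \<Rightarrow>\<^sub>L 'y::banach"
  assumes "delay_kernel m" "continuous_on {-1..0} f"
  shows "delay_op m (\<lambda>t. c *\<^sub>R f t) = c *\<^sub>R delay_op m f"
  by (intro delay_op_eqI has_stieltjes_integral_scaleR delay_op_integral assms)

text \<open>The Stieltjes integral is a limit over all choices of tags, so right end points may be
  prescribed; moving the tags at most doubles the mesh. Summation by parts requires these
  tags.\<close>

lemma tagged_division_retag_Sup:
  fixes p :: "(real \<times> real set) set"
  assumes p: "p tagged_division_of {a..b}" "(\<lambda>x. ball x d) fine p"
  shows "(\<lambda>(x, K). (Sup K, K)) ` p tagged_division_of {a..b}"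
    and "(\<lambda>x. ball x (2 * d)) fine (\<lambda>(x, K). (Sup K, K)) ` p"
proof -
  have Sup: "Sup K \<in> K" if "(x, K) \<in> p" for x K
    using tagged_division_ofD(2,4)[OF p(1) that] by force
  let ?q = "(\<lambda>(x, K). (Sup K, K)) ` p"
  show "?q tagged_division_of {a..b}"
    unfolding tagged_division_of
  proof (intro conjI allI impI)
    show "finite ?q" using p(1) by (intro finite_imageI tagged_division_of_finite)
    fix x K assume "(x, K) \<in> ?q"
    then obtain y where y: "(y, K) \<in> p" "x = Sup K" by auto
    show "x \<in> K" using Sup[OF y(1)] y(2) by simp
    show "K \<subseteq> {a..b}" "\<exists>a b. K = cbox a b" using tagged_division_ofD(3,4)[OF p(1) y(1)] .
  next
    fix x1 K1 x2 K2 assume *: "(x1, K1) \<in> ?q \<and> (x2, K2) \<in> ?q \<and> (x1, K1) \<noteq> (x2, K2)"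
    then obtain y1 y2 where "(y1, K1) \<in> p" "(y2, K2) \<in> p" "K1 \<noteq> K2" by auto
    then show "interior K1 \<inter> interior K2 = {}" using tagged_division_ofD(5)[OF p(1)] by blast
  next
    have "{K. \<exists>x. (x, K) \<in> ?q} = {K. \<exists>x. (x, K) \<in> p}" by force
    then show "\<Union>{K. \<exists>x. (x, K) \<in> ?q} = {a..b}" using tagged_division_ofD(6)[OF p(1)] by simp
  qed
  show "(\<lambda>x. ball x (2 * d)) fine ?q"
    unfolding fine_def
  proof safe
    fix x K z assume xK: "(x, K) \<in> p" and z: "z \<in> K"
    have "K \<subseteq> ball x d" using p(2) xK by (auto simp: fine_def)
    then have "dist x z < d" "dist x (Sup K) < d" using z Sup[OF xK] by auto
    then show "z \<in> ball (Sup K) (2 * d)"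
      using dist_triangle2[of "Sup K" z x] by (simp add: dist_commute)
  qed
qed

text \<open>Summation by parts: with right end points as tags, the sum over the intervals \<open>[k, k']\<close> of
  \<open>(m k' - m k) g k'\<close> differs from a telescoping sum by the sum of \<open>m k (g k' - g k)\<close>, and for
  \<open>g t = exp (l * t)\<close> the increments of \<open>g\<close> away from \<open>0\<close>, where \<open>m\<close> is not small, are negligible.\<close>

lemma delay_op_exp_small:
  fixes m :: "real \<Rightarrow> 'x::real_normed_vector \<Rightarrow>\<^sub>L 'y::banach"
  assumes m: "delay_kernel m" and \<eta>: "0 < \<eta>"
  shows "\<exists>l1. \<forall>l\<ge>l1. \<forall>x. norm (delay_op m (\<lambda>t. exp (l * t) *\<^sub>R x)) \<le> \<eta> * norm x"
proof -
  have bv: "bounded_variation (-1) 0 m" and m0: "m 0 = 0" and cont: "continuous (at 0 within {-1..0}) m"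
    using m by (auto simp: delay_kernel_def)
  obtain v where v: "\<And>s t. -1 \<le> s \<Longrightarrow> s \<le> t \<Longrightarrow> t \<le> 0 \<Longrightarrow> norm (m t - m s) \<le> v t - v s"
    using bounded_variation_majorant[OF bv] by blast
  define V where "V = v 0 - v (-1)"
  have mV: "norm (m t) \<le> V" if "-1 \<le> t" "t \<le> 0" for t
  proof -
    have "norm (m t) \<le> v 0 - v t" using v[of t 0] that by (simp add: m0)
    moreover have "0 \<le> v t - v (-1)" by (rule order_trans[OF norm_ge_zero v]) (use that in auto)
    ultimately show ?thesis by (simp add: V_def)
  qed
  have V0: "0 \<le> V" unfolding V_def by (rule order_trans[OF norm_ge_zero v]) auto
  have "\<eta> / 2 > 0" using \<eta> by simp
  with cont obtain \<epsilon>0 where \<epsilon>0: "\<epsilon>0 > 0" "\<And>t. t \<in> {-1..0} \<Longrightarrow> dist t 0 < \<epsilon>0 \<Longrightarrow> dist (m t) (m 0) < \<eta> / 2"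
    unfolding continuous_within_eps_delta by metis
  define \<epsilon> where "\<epsilon> = min \<epsilon>0 1"
  have \<epsilon>: "\<epsilon> > 0" "\<epsilon> \<le> 1" using \<epsilon>0(1) by (simp_all add: \<epsilon>_def)
  have m\<eta>: "norm (m t) \<le> \<eta> / 2" if "- \<epsilon> < t" "t \<le> 0" for t
  proof -
    have "-1 \<le> t" "- t < \<epsilon>0" using that by (auto simp: \<epsilon>_def)
    then show ?thesis using \<epsilon>0(2)[of t] that by (simp add: m0 dist_norm)
  qed
  \<comment> \<open>Left of \<open>c\<close> the exponential weight is small for large
    \<open>l\<close>; right of \<open>- \<epsilon>\<close> the kernel \<open>m\<close> is small. The
    two regions overlap by \<open>\<epsilon> / 2\<close>, so an interval shorter than
    \<open>\<epsilon> / 4\<close> lies entirely in one of them.\<close>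
  define c where "c = - \<epsilon> / 2"
  have c: "-1 \<le> c" "c \<le> 0" using \<epsilon> by (simp_all add: c_def)
  \<comment> \<open>For \<open>l \<ge> l1\<close> the estimate \<open>y \<le> exp y\<close> with
    \<open>y = l * (\<epsilon> / 2)\<close> gives
    \<open>exp (l * c) * V \<le> \<eta> / 4\<close>.\<close>
  define l1 where "l1 = max 0 (4 * V / \<eta> * (2 / \<epsilon>))"
  have main: "norm (delay_op m (\<lambda>t. exp (l * t) *\<^sub>R x)) \<le> \<eta> * norm x" if l: "l1 \<le> l" for l x
  proof -
    define g where "g t = exp (l * t)" for t
    have l0: "0 \<le> l" using l by (simp add: l1_def)
    have gmono: "g s \<le> g t" if "s \<le> t" for s t
      using that l0 by (simp add: g_def mult_left_mono)
    have gpos: "0 \<le> g t" for t by (simp add: g_def)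
    have gc: "g c * V \<le> \<eta> / 4"
    proof -
      have "4 * V / \<eta> * (2 / \<epsilon>) \<le> l" using l by (simp add: l1_def)
      from mult_right_mono[OF this, of "\<epsilon> / 2"] have "4 * V / \<eta> \<le> l * (\<epsilon> / 2)"
        using \<epsilon>(1) by simp
      also have "\<dots> \<le> exp (l * (\<epsilon> / 2))"
        using exp_ge_add_one_self[of "l * (\<epsilon> / 2)"] by linarith
      finally have "4 * V \<le> \<eta> * exp (l * (\<epsilon> / 2))" using \<eta> by (simp add: field_simps)
      then have "4 * V * exp (- (l * (\<epsilon> / 2))) \<le> \<eta>" by (simp add: exp_minus field_simps)
      then show ?thesis by (simp add: g_def c_def algebra_simps)
    qed
    have gt: "g (-1) * V \<le> g c * V" by (rule mult_right_mono[OF gmono V0]) (use c in simp)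
    have contg: "continuous_on {-1..0} (\<lambda>t. g t *\<^sub>R x)" unfolding g_def by (intro continuous_intros)
    define I where "I = delay_op m (\<lambda>t. g t *\<^sub>R x)"
    have I: "has_stieltjes_integral m (\<lambda>t. g t *\<^sub>R x) (-1) 0 I"
      unfolding I_def by (rule delay_op_integral[OF m contg])
    have "norm I \<le> \<eta> * norm x + e" if e: "e > 0" for e
    proof -
      obtain d where d: "d > 0" "\<And>p. p tagged_division_of {-1..0} \<Longrightarrow> (\<lambda>x. ball x d) fine p \<Longrightarrow>
        norm ((\<Sum>(t, K)\<in>p. blinfun_apply (m (Sup K) - m (Inf K)) (g t *\<^sub>R x)) - I) < e"
        by (rule has_stieltjes_integralE[OF I e]) blast
      \<comment> \<open>Half of \<open>d\<close> compensates for the retagging, and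
        \<open>\<epsilon> / 8\<close> makes each interval shorter than
        \<open>\<epsilon> / 4\<close>.\<close>
      define d' where "d' = min (d / 2) (\<epsilon> / 8)"
      have d': "d' > 0" "2 * d' \<le> d" "2 * d' \<le> \<epsilon> / 4" using d(1) \<epsilon>(1) by (simp_all add: d'_def)
      have "gauge (\<lambda>x::real. ball x d')" by (rule gauge_ball[OF d'(1)])
      then obtain p0 where p0: "p0 tagged_division_of {-1..0::real}" "(\<lambda>x. ball x d') fine p0"
        by (rule fine_division_exists_real)
      define p where "p = (\<lambda>(x, K). (Sup K, K)) ` p0"
      have p: "p tagged_division_of {-1..0}" "(\<lambda>x. ball x (2 * d')) fine p"
        unfolding p_def by (rule tagged_division_retag_Sup[OF p0])+
      have pfine: "(\<lambda>x. ball x d) fine p"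
        by (rule fine_ball_mono[OF p(2) d'(2)])
      have K: "t = Sup K \<and> -1 \<le> Inf K \<and> Inf K \<le> Sup K \<and> Sup K \<le> 0 \<and> Sup K - Inf K < \<epsilon> / 4"
        if tK: "(t, K) \<in> p" for t K
      proof -
        obtain k1 k2 where K: "K = {k1..k2}" using tagged_division_ofD(4)[OF p(1) tK] by auto
        have t: "t \<in> K" and sub: "K \<subseteq> {-1..0}" using tagged_division_ofD(2,3)[OF p(1) tK] .
        have k: "k1 \<le> k2" using t K by auto
        have tS: "t = Sup K" using tK by (auto simp: p_def)
        have "K \<subseteq> ball t (2 * d')" using p(2) tK by (auto simp: fine_def)
        then have "k1 \<in> ball t (2 * d')" using k K by auto
        then have "dist (Sup K) k1 < \<epsilon> / 4" using d'(3) tS by simp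
        then show ?thesis using K k sub tS by (auto simp: dist_real_def)
      qed
      have split: "blinfun_apply (m (Sup K) - m (Inf K)) (g (Sup K) *\<^sub>R x)
        = blinfun_apply (g (Sup K) *\<^sub>R m (Sup K) - g (Inf K) *\<^sub>R m (Inf K)) x
          - blinfun_apply (m (Inf K)) ((g (Sup K) - g (Inf K)) *\<^sub>R x)" for K
        by (simp add: blinfun.diff_left blinfun.scaleR_left blinfun.scaleR_right blinfun.diff_right algebra_simps)
      define S where "S = (\<Sum>(t, K)\<in>p. blinfun_apply (m (Sup K) - m (Inf K)) (g t *\<^sub>R x))"
      define E where "E = (\<Sum>(t, K)\<in>p. blinfun_apply (m (Inf K)) ((g (Sup K) - g (Inf K)) *\<^sub>R x))"
      have "S = (\<Sum>(t, K)\<in>p. blinfun_apply (g (Sup K) *\<^sub>R m (Sup K) - g (Inf K) *\<^sub>R m (Inf K)) x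
          - blinfun_apply (m (Inf K)) ((g (Sup K) - g (Inf K)) *\<^sub>R x))"
        unfolding S_def split[symmetric] by (rule sum.cong[OF refl]) (use K in auto)
      also have "\<dots> = (\<Sum>(t, K)\<in>p. blinfun_apply (g (Sup K) *\<^sub>R m (Sup K) - g (Inf K) *\<^sub>R m (Inf K)) x) - E"
        unfolding E_def by (simp add: case_prod_beta' sum_subtractf)
      also have "(\<Sum>(t, K)\<in>p. blinfun_apply (g (Sup K) *\<^sub>R m (Sup K) - g (Inf K) *\<^sub>R m (Inf K)) x)
          = blinfun_apply (g 0 *\<^sub>R m 0 - g (-1) *\<^sub>R m (-1)) x"
        using additive_tagged_division_1[OF _ p(1), of "\<lambda>t. blinfun_apply (g t *\<^sub>R m t) x"]
        by (simp add: blinfun.diff_left)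
      \<comment> \<open>The boundary term at the right end vanishes by \<open>m 0 = 0\<close>; the
        one at the left end carries the small weight \<open>g (-1)\<close>.\<close>
      finally have S: "S = - (g (-1) *\<^sub>R blinfun_apply (m (-1)) x) - E"
        by (simp add: m0 blinfun.minus_left blinfun.scaleR_left)
      have n1: "norm (g (-1) *\<^sub>R blinfun_apply (m (-1)) x) \<le> (\<eta> / 4) * norm x"
      proof -
        have "norm (g (-1) *\<^sub>R blinfun_apply (m (-1)) x) \<le> g (-1) * (norm (m (-1)) * norm x)"
          using gpos[of "-1"] by (auto intro!: mult_left_mono norm_blinfun)
        also have "\<dots> \<le> g (-1) * (V * norm x)"
          by (intro mult_left_mono mult_right_mono mV gpos) simp_all
        also have "\<dots> = (g (-1) * V) * norm x" by simp
        also have "\<dots> \<le> (\<eta> / 4) * norm x" using gc gt by (intro mult_right_mono) simp_all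
        finally show ?thesis .
      qed
      \<comment> \<open>Two telescoping majorants: all increments of \<open>g\<close> with the
        weight \<open>\<eta> / 2\<close>, and the increments of \<open>g\<close> stopped at
        \<open>c\<close> with the weight \<open>V\<close>. They contribute at most
        \<open>\<eta> / 2\<close> and \<open>\<eta> / 4\<close>; the boundary term uses the
        remaining \<open>\<eta> / 4\<close>.\<close>
      have "norm E \<le> (\<Sum>(t, K)\<in>p. ((\<eta> / 2) * (g (Sup K) - g (Inf K))
          + V * (g (min (Sup K) c) - g (min (Inf K) c))) * norm x)"
        unfolding E_def case_prod_beta'
      proof (rule sum_norm_le)
        fix i assume "i \<in> p"
        then have i: "-1 \<le> Inf (snd i)" "Inf (snd i) \<le> Sup (snd i)" "Sup (snd i) \<le> 0"
          "Sup (snd i) - Inf (snd i) < \<epsilon> / 4"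
          using K[of "fst i" "snd i"] by auto
        let ?a = "Inf (snd i)" and ?b = "Sup (snd i)"
        have inc: "0 \<le> g ?b - g ?a" "0 \<le> g (min ?b c) - g (min ?a c)"
          using gmono[OF i(2)] gmono[of "min ?a c" "min ?b c"] i(2) by auto
        have "norm (m ?a) * (g ?b - g ?a) \<le> (\<eta> / 2) * (g ?b - g ?a) + V * (g (min ?b c) - g (min ?a c))"
        proof (cases "- \<epsilon> < ?a")
          case True
          have "norm (m ?a) \<le> \<eta> / 2" using i by (intro m\<eta> True) simp
          then have "norm (m ?a) * (g ?b - g ?a) \<le> (\<eta> / 2) * (g ?b - g ?a)"
            using inc(1) by (rule mult_right_mono)
          moreover have "0 \<le> V * (g (min ?b c) - g (min ?a c))" using V0 inc(2) by simp
          ultimately show ?thesis by linarith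
        next
          case False
          then have "min ?b c = ?b" "min ?a c = ?a" using i by (auto simp: c_def)
          moreover have "norm (m ?a) * (g ?b - g ?a) \<le> V * (g ?b - g ?a)"
            using i by (intro mult_right_mono mV inc) simp_all
          moreover have "0 \<le> (\<eta> / 2) * (g ?b - g ?a)" using \<eta> inc(1) by simp
          ultimately show ?thesis by simp
        qed
        then have "norm (m ?a) * (g ?b - g ?a) * norm x
            \<le> ((\<eta> / 2) * (g ?b - g ?a) + V * (g (min ?b c) - g (min ?a c))) * norm x"
          by (rule mult_right_mono) simp
        moreover have "norm (blinfun_apply (m ?a) ((g ?b - g ?a) *\<^sub>R x)) \<le> norm (m ?a) * ((g ?b - g ?a) * norm x)"
          using norm_blinfun[of "m ?a" "(g ?b - g ?a) *\<^sub>R x"] inc(1) by simp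
        ultimately show "norm (blinfun_apply (m ?a) ((g ?b - g ?a) *\<^sub>R x))
          \<le> ((\<eta> / 2) * (g ?b - g ?a) + V * (g (min ?b c) - g (min ?a c))) * norm x"
          by (simp add: mult.assoc)
      qed
      also have "\<dots> = ((\<eta> / 2) * (\<Sum>(t, K)\<in>p. g (Sup K) - g (Inf K))
          + V * (\<Sum>(t, K)\<in>p. g (min (Sup K) c) - g (min (Inf K) c))) * norm x"
        by (simp only: case_prod_beta' sum.distrib sum_distrib_left sum_distrib_right distrib_right)
      also have "(\<Sum>(t, K)\<in>p. g (Sup K) - g (Inf K)) = g 0 - g (-1)"
        by (rule additive_tagged_division_1[OF _ p(1)]) simp
      also have "(\<Sum>(t, K)\<in>p. g (min (Sup K) c) - g (min (Inf K) c)) = g (min 0 c) - g (min (-1) c)"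
        by (rule additive_tagged_division_1[OF _ p(1)]) simp
      also have "((\<eta> / 2) * (g 0 - g (-1)) + V * (g (min 0 c) - g (min (-1) c))) * norm x
          \<le> (\<eta> / 2 + \<eta> / 4) * norm x"
      proof (intro mult_right_mono add_mono)
        show "(\<eta> / 2) * (g 0 - g (-1)) \<le> \<eta> / 2"
          using mult_left_mono[of "g 0 - g (-1)" 1 "\<eta> / 2"] \<eta> gpos[of "-1"] by (simp add: g_def)
        have "V * (g (min 0 c) - g (min (-1) c)) \<le> V * g c"
          using V0 gpos[of "-1"] c by (intro mult_left_mono) simp_all
        then show "V * (g (min 0 c) - g (min (-1) c)) \<le> \<eta> / 4" using gc by (simp add: mult.commute)
      qed simp
      finally have "norm E \<le> (\<eta> / 2 + \<eta> / 4) * norm x" .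
      then have "norm S \<le> \<eta> * norm x"
        using n1 norm_triangle_ineq4[of "- (g (-1) *\<^sub>R blinfun_apply (m (-1)) x)" E]
        unfolding S by (simp add: algebra_simps)
      moreover have "norm (S - I) < e" unfolding S_def by (rule d(2)[OF p(1) pfine])
      ultimately show ?thesis using norm_triangle_ineq2[of I S] by (simp add: norm_minus_commute)
    qed
    then have "norm I \<le> \<eta> * norm x" by (rule field_le_epsilon)
    then show ?thesis by (simp add: I_def g_def)
  qed
  then show ?thesis by blast
qed

section \<open>Strongly continuous semigroups on a complete normed subspace\<close>

text \<open>Completeness is recorded for series dominated by the powers of one third, the form in
  which the gliding hump argument in \<open>locally_bounded\<close> uses it.\<close>

locale normed_subspace =
  fixes V :: "'v::real_vector set" and N :: "'v \<Rightarrow> real"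
  assumes zero_in [simp]: "0 \<in> V"
    and add_in [intro, simp]: "x \<in> V \<Longrightarrow> y \<in> V \<Longrightarrow> x + y \<in> V"
    and scale_in [intro, simp]: "x \<in> V \<Longrightarrow> c *\<^sub>R x \<in> V"
    and N_nonneg [simp]: "0 \<le> N x"
    and N_triangle: "x \<in> V \<Longrightarrow> y \<in> V \<Longrightarrow> N (x + y) \<le> N x + N y"
    and N_scale: "x \<in> V \<Longrightarrow> N (c *\<^sub>R x) = \<bar>c\<bar> * N x"
    and N_eq_0: "x \<in> V \<Longrightarrow> N x = 0 \<Longrightarrow> x = 0"
    and N_complete: "(\<And>n. f n \<in> V) \<Longrightarrow> (\<And>n. N (f n) \<le> (1 / 3) ^ n) \<Longrightarrow>
      \<exists>s\<in>V. (\<lambda>n. N ((\<Sum>i<n. f i) - s)) \<longlonglongrightarrow> 0"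
begin

lemma minus_in [intro, simp]: "x \<in> V \<Longrightarrow> - x \<in> V"
  using scale_in[of x "-1"] by simp

lemma diff_in [intro, simp]: "x \<in> V \<Longrightarrow> y \<in> V \<Longrightarrow> x - y \<in> V"
  using add_in[of x "- y"] by auto

lemma sum_in: "(\<And>i. i \<in> I \<Longrightarrow> f i \<in> V) \<Longrightarrow> sum f I \<in> V"
  by (induction I rule: infinite_finite_induct) auto

lemma N_zero [simp]: "N 0 = 0"
  using N_scale[of 0 0] by simp

lemma N_minus [simp]: "x \<in> V \<Longrightarrow> N (- x) = N x"
  using N_scale[of x "-1"] by simp

lemma N_commute: "x \<in> V \<Longrightarrow> y \<in> V \<Longrightarrow> N (x - y) = N (y - x)"
  using N_minus[of "x - y"] by (simp add: diff_in)

lemma N_triangle_diff: "x \<in> V \<Longrightarrow> y \<in> V \<Longrightarrow> N (x - y) \<le> N x + N y"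
  using N_triangle[of x "- y"] by simp

lemma N_le_add_diff: "x \<in> V \<Longrightarrow> y \<in> V \<Longrightarrow> N x \<le> N y + N (x - y)"
  using N_triangle[of y "x - y"] by simp

lemma N_diff_triangle: "x \<in> V \<Longrightarrow> y \<in> V \<Longrightarrow> z \<in> V \<Longrightarrow> N (x - z) \<le> N (x - y) + N (y - z)"
  using N_triangle[of "x - y" "y - z"] by auto

end

lemma bounded_op_onD:
  assumes "bounded_op_on V N S"
  shows "\<And>x. x \<in> V \<Longrightarrow> S x \<in> V"
    and "\<And>x y. x \<in> V \<Longrightarrow> y \<in> V \<Longrightarrow> S (x + y) = S x + S y"
    and "\<And>x c. x \<in> V \<Longrightarrow> S (c *\<^sub>R x) = c *\<^sub>R S x"
    and "\<exists>K. \<forall>x\<in>V. N (S x) \<le> K * N x"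
  using assms unfolding bounded_op_on_def by blast+

section \<open>Semigroup laws and exponential growth\<close>

locale semigroup_on = normed_subspace V N
  for V :: "'v::real_vector set" and N +
  fixes T :: "real \<Rightarrow> 'v \<Rightarrow> 'v"
  assumes C0: "C0_semigroup V N T"
begin

lemma T_op: "0 \<le> t \<Longrightarrow> bounded_op_on V N (T t)"
  using C0 by (simp add: C0_semigroup_def)

lemma T_in [intro, simp]: "0 \<le> t \<Longrightarrow> x \<in> V \<Longrightarrow> T t x \<in> V"
  using bounded_op_onD(1)[OF T_op] .

lemma T_add: "0 \<le> t \<Longrightarrow> x \<in> V \<Longrightarrow> y \<in> V \<Longrightarrow> T t (x + y) = T t x + T t y"
  using bounded_op_onD(2)[OF T_op] .

lemma T_scale: "0 \<le> t \<Longrightarrow> x \<in> V \<Longrightarrow> T t (c *\<^sub>R x) = c *\<^sub>R T t x"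
  using bounded_op_onD(3)[OF T_op] .

lemma T_diff: "0 \<le> t \<Longrightarrow> x \<in> V \<Longrightarrow> y \<in> V \<Longrightarrow> T t (x - y) = T t x - T t y"
  using T_add[of t x "- y"] T_scale[of t y "-1"] by auto

lemma T_zero: "0 \<le> t \<Longrightarrow> T t 0 = 0"
  using T_scale[of t 0 0] by simp

lemma T_0 [simp]: "x \<in> V \<Longrightarrow> T 0 x = x"
  using C0 by (simp add: C0_semigroup_def)

lemma T_T: "0 \<le> s \<Longrightarrow> 0 \<le> t \<Longrightarrow> x \<in> V \<Longrightarrow> T (s + t) x = T s (T t x)"
  using C0 by (simp add: C0_semigroup_def)

lemma T_cont:
  assumes "x \<in> V" "0 < e"
  shows "\<exists>d>0. \<forall>h. 0 \<le> h \<longrightarrow> h < d \<longrightarrow> N (T h x - x) < e"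
proof -
  have "((\<lambda>t. N (T t x - x)) \<longlongrightarrow> 0) (at_right 0)"
    using C0 assms(1) by (simp add: C0_semigroup_def)
  from order_tendstoD(2)[OF this assms(2)]
  obtain d where d: "d > 0" "\<And>h. 0 < h \<Longrightarrow> h < d \<Longrightarrow> N (T h x - x) < e"
    unfolding eventually_at_right_field by auto
  have "N (T h x - x) < e" if "0 \<le> h" "h < d" for h
    using that d(2)[of h] assms by (cases "h = 0") auto
  then show ?thesis using d(1) by blast
qed

text \<open>Uniform boundedness by a gliding hump argument; only the completeness of \<open>V\<close> is used.\<close>

lemma almost_norming:
  assumes "0 \<le> t" "0 < M" "x0 \<in> V" "M * N x0 < N (T t x0)"
    and r: "0 < r"
  shows "\<exists>B\<ge>M. (\<forall>x\<in>V. N (T t x) \<le> B * N x) \<and> (\<exists>y\<in>V. N y = r \<and> 3 / 4 * B * r \<le> N (T t y))"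
proof -
  define bd where "bd B \<longleftrightarrow> (\<forall>x\<in>V. N (T t x) \<le> B * N x)" for B
  obtain K where K: "bd K" using bounded_op_onD(4)[OF T_op[OF assms(1)]] unfolding bd_def by blast
  have mono: "bd B'" if "bd B" "B \<le> B'" for B B'
    using that unfolding bd_def by (meson N_nonneg mult_right_mono order_trans)
  have nM: "\<not> bd M" using assms unfolding bd_def by force
  have KM: "M \<le> K" using K mono nM by (meson linear)
  \<comment> \<open>Substitute for the operator norm: a bound is shrunk by the factor
    \<open>3 / 4\<close> until it fails. The last valid bound \<open>B\<close> is then attained up
    to that factor, and \<open>B \<ge> M\<close> because \<open>M\<close> itself is not a
    bound.\<close>
  have "\<exists>n. K * (3 / 4) ^ n < M"
  proof -
    have "(\<lambda>n. K * (3 / 4) ^ n) \<longlonglongrightarrow> K * 0" by (intro tendsto_intros LIMSEQ_power_zero) simp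
    then have "\<forall>\<^sub>F n in sequentially. K * (3 / 4) ^ n < M" using assms(2) by (intro order_tendstoD(2)) simp_all
    then show ?thesis by (rule eventually_happens'[OF sequentially_bot])
  qed
  then obtain n where n: "K * (3 / 4) ^ n < M" by blast
  have "\<not> bd (K * (3 / 4) ^ n)" using mono nM n by (meson less_imp_le)
  moreover have "\<not> \<not> bd (K * (3 / 4) ^ 0)" using K by simp
  ultimately have "\<exists>k<n. (\<forall>i\<le>k. \<not> \<not> bd (K * (3 / 4) ^ i)) \<and> \<not> bd (K * (3 / 4) ^ Suc k)"
    by (rule ex_least_nat_less)
  then obtain k where "\<forall>i\<le>k. \<not> \<not> bd (K * (3 / 4) ^ i)" and k2: "\<not> bd (K * (3 / 4) ^ Suc k)"
    by (elim exE conjE)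
  then have k: "bd (K * (3 / 4) ^ k)" "\<not> bd (K * (3 / 4) ^ Suc k)"
    by simp_all
  define B where "B = K * (3 / 4) ^ k"
  have BM: "M \<le> B" using k(1) mono nM unfolding B_def by (meson linear)
  have "\<not> bd (3 / 4 * B)" using k(2) by (simp add: B_def mult.commute mult.left_commute)
  then obtain y where y: "y \<in> V" "3 / 4 * B * N y < N (T t y)" unfolding bd_def by (auto simp: not_le)
  have Ny: "N y > 0"
  proof -
    have "N y \<noteq> 0" using y N_eq_0[OF y(1)] T_zero[OF assms(1)] by auto
    then show ?thesis using N_nonneg[of y] by linarith
  qed
  define y' where "y' = (r / N y) *\<^sub>R y"
  have "y' \<in> V" "N y' = r" using y(1) Ny r by (auto simp: y'_def N_scale)
  moreover have "3 / 4 * B * r \<le> N (T t y')"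
  proof -
    have "(r / N y) * (3 / 4 * B * N y) \<le> (r / N y) * N (T t y)"
      using y(2) Ny r by (intro mult_left_mono) simp_all
    moreover have "(r / N y) * (3 / 4 * B * N y) = 3 / 4 * B * r" using Ny by simp
    moreover have "N (T t y') = (r / N y) * N (T t y)"
      using Ny r y(1) assms(1) by (simp add: y'_def T_scale N_scale)
    ultimately show ?thesis by simp
  qed
  ultimately show ?thesis using BM k(1) unfolding bd_def B_def[symmetric] by blast
qed

text \<open>Otherwise there are times \<open>t n\<close> tending to 0 and nearly norming vectors
  \<open>y n\<close> of norm \<open>(1 / 3) ^ n\<close>. With suitable signs their series has a sum
  \<open>z\<close> for which \<open>T (t n) z\<close> keeps at least \<open>3 / 4 - 1 / 2\<close> of
  \<open>B n * (1 / 3) ^ n\<close>: the first fraction is the hump, the second bounds the tail. The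
  lower bound on \<open>B n\<close> makes this at least \<open>Suc n\<close>, against strong
  continuity at 0.\<close>

lemma locally_bounded: "\<exists>d>0. \<exists>M. \<forall>t x. 0 \<le> t \<longrightarrow> t \<le> d \<longrightarrow> x \<in> V \<longrightarrow> N (T t x) \<le> M * N x"
proof (rule ccontr)
  assume "\<not> ?thesis"
  then have unb: "\<exists>t x. 0 \<le> t \<and> t \<le> d \<and> x \<in> V \<and> M * N x < N (T t x)" if "d > 0" for d M
    using that by (meson not_le)
  have "\<exists>t B y. 0 \<le> t \<and> t \<le> 1 / real (Suc n) \<and> 4 * 3 ^ n * real (Suc n) \<le> B \<and>
      (\<forall>x\<in>V. N (T t x) \<le> B * N x) \<and> y \<in> V \<and> N y = (1 / 3) ^ n \<and> 3 / 4 * B * (1 / 3) ^ n \<le> N (T t y)" for n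
  proof -
    obtain t x where tx: "0 \<le> t" "t \<le> 1 / real (Suc n)" "x \<in> V"
        "4 * 3 ^ n * real (Suc n) * N x < N (T t x)"
      using unb[of "1 / real (Suc n)" "4 * 3 ^ n * real (Suc n)"] by auto
    from almost_norming[OF tx(1) _ tx(3,4), of "(1 / 3) ^ n"] show ?thesis using tx(1,2) by auto
  qed
  then obtain t B y where t: "\<And>n. 0 \<le> t n" "\<And>n. t n \<le> 1 / real (Suc n)"
    and B: "\<And>n. 4 * 3 ^ n * real (Suc n) \<le> B n" "\<And>n x. x \<in> V \<Longrightarrow> N (T (t n) x) \<le> B n * N x"
    and y: "\<And>n. y n \<in> V" "\<And>n. N (y n) = (1 / 3) ^ n" "\<And>n. 3 / 4 * B n * (1 / 3) ^ n \<le> N (T (t n) (y n))"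
    by metis
  \<comment> \<open>With \<open>p\<close> and \<open>q\<close> the images of \<open>s n\<close> and
    \<open>y n\<close>, the identity \<open>2 q = (p + q) - (p - q)\<close> shows that one of the
    two signs gives an image at least as large as \<open>q\<close>; that sign is taken.\<close>
  define s where "s = rec_nat 0 (\<lambda>n s. if N (T (t n) (y n)) \<le> N (T (t n) (s + y n)) then s + y n else s - y n)"
  have s0: "s 0 = 0" by (simp add: s_def)
  have sS: "s (Suc n) = (if N (T (t n) (y n)) \<le> N (T (t n) (s n + y n)) then s n + y n else s n - y n)" for n
    by (simp add: s_def)
  have sV: "s n \<in> V" for n by (induction n) (auto simp: s0 sS y(1))
  have hump: "N (T (t n) (y n)) \<le> N (T (t n) (s (Suc n)))" for n
  proof (cases "N (T (t n) (y n)) \<le> N (T (t n) (s n + y n))")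
    case False
    let ?p = "T (t n) (s n)" and ?q = "T (t n) (y n)"
    have pq: "?p \<in> V" "?q \<in> V" using sV y(1) t(1) by auto
    have "2 * N ?q = N ((?p + ?q) - (?p - ?q))" using N_scale[OF pq(2), of 2] by (simp add: scaleR_2)
    also have "\<dots> \<le> N (?p + ?q) + N (?p - ?q)"
      using pq by (intro N_triangle_diff) simp_all
    finally have "N ?q \<le> N (?p - ?q)" using False by (simp add: T_add sV y(1) t(1))
    then show ?thesis using False by (simp add: sS T_diff sV y(1) t(1))
  qed (simp add: sS)
  define f where "f n = s (Suc n) - s n" for n
  have fV: "f n \<in> V" for n using sV by (auto simp: f_def)
  have Nf: "N (f n) = (1 / 3) ^ n" for n using y(1,2) by (auto simp: f_def sS)
  have sum_f: "(\<Sum>i<n. f i) = s n" for n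
    using sum_lessThan_telescope[of s n] by (simp add: f_def s0)
  have "\<exists>z\<in>V. (\<lambda>n. N ((\<Sum>i<n. f i) - z)) \<longlonglongrightarrow> 0"
    by (rule N_complete[OF fV]) (simp add: Nf)
  then obtain z where z: "z \<in> V" "(\<lambda>n. N (s n - z)) \<longlonglongrightarrow> 0"
    unfolding sum_f by blast
  \<comment> \<open>One half is the sum of the powers of one third from exponent 1 on: the terms
    after index \<open>n\<close> add up to half of the term at \<open>n\<close>.\<close>
  have tail: "N (s (Suc n) - z) \<le> 1 / 2 * (1 / 3) ^ n" for n
  proof -
    have "N (s (Suc n) - s (Suc n + k)) \<le> 1 / 2 * (1 / 3) ^ n - 1 / 2 * (1 / 3) ^ (n + k)" for k
    proof (induction k)
      case (Suc k)
      have "N (s (Suc n) - s (Suc n + Suc k))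
          \<le> N (s (Suc n) - s (Suc n + k)) + N (s (Suc n + k) - s (Suc (Suc n + k)))"
        using N_diff_triangle[of "s (Suc n)" "s (Suc n + k)"] sV by simp
      also have "N (s (Suc n + k) - s (Suc (Suc n + k))) = (1 / 3) ^ (Suc n + k)"
        using Nf[of "Suc n + k"] N_commute sV by (simp add: f_def)
      finally show ?case using Suc by (simp add: power_add)
    qed simp
    then have le: "N (s (Suc n) - s (Suc n + k)) \<le> 1 / 2 * (1 / 3) ^ n" for k
      by (smt (verit) zero_le_power zero_le_divide_1_iff mult_nonneg_nonneg)
    have "(\<lambda>k. 1 / 2 * (1 / 3) ^ n + N (s (k + Suc n) - z)) \<longlonglongrightarrow> 1 / 2 * (1 / 3) ^ n + 0"
      by (intro tendsto_intros LIMSEQ_ignore_initial_segment[OF z(2)])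
    moreover have "N (s (Suc n) - z) \<le> 1 / 2 * (1 / 3) ^ n + N (s (k + Suc n) - z)" for k
      using N_diff_triangle[of "s (Suc n)" "s (Suc n + k)" z] sV z(1) le[of k] by (simp add: add.commute)
    ultimately show ?thesis using LIMSEQ_le_const by fastforce
  qed
  have big: "real (Suc n) \<le> N (T (t n) z)" for n
  proof -
    define b where "b = B n * (1 / 3) ^ n"
    have B0: "0 \<le> B n" using B(1)[of n] by (smt (verit) mult_nonneg_nonneg of_nat_0_le_iff zero_le_power)
    have "N (T (t n) (s (Suc n))) \<le> N (T (t n) z) + N (T (t n) (s (Suc n) - z))"
      using N_triangle[of "T (t n) z" "T (t n) (s (Suc n) - z)"] T_add[of "t n" z "s (Suc n) - z"] sV z(1) t(1)
      by simp
    also have "N (T (t n) (s (Suc n) - z)) \<le> B n * (1 / 2 * (1 / 3) ^ n)"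
      using B(2)[of "s (Suc n) - z" n] tail[of n] B0 sV z(1)
      by (meson diff_in mult_left_mono order_trans)
    finally have "N (T (t n) (y n)) \<le> N (T (t n) z) + 1 / 2 * b" using hump[of n] by (simp add: b_def)
    moreover have "3 / 4 * b \<le> N (T (t n) (y n))" using y(3)[of n] by (simp add: b_def)
    moreover have "4 * real (Suc n) \<le> b"
    proof -
      have "4 * 3 ^ n * real (Suc n) * (1 / 3) ^ n \<le> b"
        unfolding b_def by (intro mult_right_mono B) simp
      then show ?thesis by (simp add: power_one_over)
    qed
    ultimately have "b / 4 \<le> N (T (t n) z)" "real (Suc n) \<le> b / 4" by simp_all
    then show ?thesis by (rule order_trans[rotated])
  qed
  obtain d where d: "d > 0" "\<And>h. 0 \<le> h \<Longrightarrow> h < d \<Longrightarrow> N (T h z - z) < 1"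
    using T_cont[OF z(1), of 1] by auto
  obtain n0 where n0: "1 / real (Suc n0) < d" by (rule nat_approx_posE[OF d(1)])
  obtain n1 :: nat where n1: "N z + 1 < real n1" using reals_Archimedean2 by blast
  define n where "n = max n0 n1"
  have "1 / real (Suc n) \<le> 1 / real (Suc n0)" by (simp add: n_def frac_le)
  then have "N (T (t n) z - z) < 1" using t[of n] n0 by (intro d(2)) simp_all
  then have "N (T (t n) z) < N z + 1"
    using N_le_add_diff[of "T (t n) z" z] z(1) t(1) by simp
  moreover have "real n1 \<le> real (Suc n)" by (simp add: n_def)
  ultimately show False using big[of n] n1 by simp
qed

lemma exponentially_bounded:
  "\<exists>w M. 0 < w \<and> 1 \<le> M \<and> (\<forall>t x. 0 \<le> t \<longrightarrow> x \<in> V \<longrightarrow> N (T t x) \<le> M * exp (w * t) * N x)"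
proof -
  obtain d M0 where d: "d > 0" and M0: "\<And>t x. 0 \<le> t \<Longrightarrow> t \<le> d \<Longrightarrow> x \<in> V \<Longrightarrow> N (T t x) \<le> M0 * N x"
    using locally_bounded by blast
  \<comment> \<open>The lower bound \<open>exp 1\<close> guarantees \<open>M > 1\<close>, so that
    the rate \<open>w = ln M / d\<close> is positive.\<close>
  define M where "M = max M0 (exp 1)"
  have M: "N (T t x) \<le> M * N x" if "0 \<le> t" "t \<le> d" "x \<in> V" for t x
    using M0[OF that] by (rule order_trans) (simp add: M_def mult_right_mono)
  have M1: "1 < M" by (simp add: M_def less_max_iff_disj)
  define w where "w = ln M / d"
  have w: "0 < w" using d M1 by (simp add: w_def)
  have wd: "exp (w * d) = M" using d M1 by (simp add: w_def)
  have step: "N (T (real k * d) x) \<le> M ^ k * N x" if "x \<in> V" for k x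
  proof (induction k)
    case (Suc k)
    have "T (real (Suc k) * d) x = T d (T (real k * d) x)"
      using T_T[of d "real k * d" x] d that by (simp add: algebra_simps)
    then have "N (T (real (Suc k) * d) x) \<le> M * N (T (real k * d) x)"
      using M[of d "T (real k * d) x"] d that by simp
    also have "\<dots> \<le> M * (M ^ k * N x)" using Suc M1 by (intro mult_left_mono) simp_all
    finally show ?case by simp
  qed (simp add: that)
  have "N (T t x) \<le> M * exp (w * t) * N x" if t: "0 \<le> t" and x: "x \<in> V" for t x
  proof -
    define k where "k = nat \<lfloor>t / d\<rfloor>"
    have "real k \<le> t / d" "t / d < real k + 1"
      using t d unfolding k_def by (simp_all add: of_nat_nat) 
    then have k: "real k * d \<le> t" "t - real k * d \<le> d"
      using d by (simp_all add: field_simps)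
    have "T t x = T (t - real k * d) (T (real k * d) x)"
      using T_T[of "t - real k * d" "real k * d" x] k d x by simp
    then have "N (T t x) \<le> M * N (T (real k * d) x)"
      using M[of "t - real k * d" "T (real k * d) x"] k d x by simp
    also have "\<dots> \<le> M * (M ^ k * N x)" using step[OF x] M1 by (intro mult_left_mono) simp_all
    also have "M ^ k = exp (w * (real k * d))"
      unfolding wd[symmetric] by (simp add: exp_of_nat_mult[symmetric] algebra_simps)
    also have "M * (exp (w * (real k * d)) * N x) \<le> M * (exp (w * t) * N x)"
      using k w M1 by (intro mult_left_mono mult_right_mono) simp_all
    finally show ?thesis by simp
  qed
  then show ?thesis using w M1 by (intro exI[of _ w] exI[of _ M]) auto
qed


section \<open>Elementary properties of the generator\<close>

abbreviation A where "A \<equiv> generator V N T"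

lemma gen_in: "(x, y) \<in> A \<Longrightarrow> x \<in> V \<and> y \<in> V"
  by (simp add: generator_def)

lemma gen_approx:
  assumes "(x, y) \<in> A" "0 < e"
  shows "\<exists>d>0. \<forall>h. 0 < h \<longrightarrow> h < d \<longrightarrow> N ((1 / h) *\<^sub>R (T h x - x) - y) < e"
proof -
  have "((\<lambda>t. N ((1 / t) *\<^sub>R (T t x - x) - y)) \<longlongrightarrow> 0) (at_right 0)"
    using assms(1) by (simp add: generator_def)
  from order_tendstoD(2)[OF this assms(2)] show ?thesis
    unfolding eventually_at_right_field by auto
qed

lemma gen_intro:
  assumes "x \<in> V" "y \<in> V"
    and "\<And>e. 0 < e \<Longrightarrow> \<exists>d>0. \<forall>h. 0 < h \<longrightarrow> h < d \<longrightarrow> N ((1 / h) *\<^sub>R (T h x - x) - y) < e"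
  shows "(x, y) \<in> A"
proof -
  have "((\<lambda>t. N ((1 / t) *\<^sub>R (T t x - x) - y)) \<longlongrightarrow> 0) (at_right 0)"
  proof (rule order_tendstoI)
    show "\<forall>\<^sub>F t in at_right 0. a < N ((1 / t) *\<^sub>R (T t x - x) - y)" if "a < 0" for a
      using that N_nonneg by (intro always_eventually allI) (meson less_le_trans)
    show "\<forall>\<^sub>F t in at_right 0. N ((1 / t) *\<^sub>R (T t x - x) - y) < a" if "0 < a" for a
      using assms(3)[OF that] unfolding eventually_at_right_field by auto
  qed
  then show ?thesis using assms(1,2) by (simp add: generator_def)
qed

lemma diff_quotient_in: "0 < h \<Longrightarrow> x \<in> V \<Longrightarrow> (1 / h) *\<^sub>R (T h x - x) \<in> V"
  by (intro scale_in diff_in T_in) simp_all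

lemma gen_diff:
  assumes "(x, y) \<in> A" "(x', y') \<in> A"
  shows "(x - x', y - y') \<in> A"
proof (rule gen_intro)
  have V: "x \<in> V" "y \<in> V" "x' \<in> V" "y' \<in> V" using assms gen_in by auto
  then show "x - x' \<in> V" "y - y' \<in> V" by auto
  fix e :: real assume "0 < e"
  then have e: "0 < e / 2" by simp
  obtain d where d: "d > 0" "\<And>h. 0 < h \<Longrightarrow> h < d \<Longrightarrow> N ((1 / h) *\<^sub>R (T h x - x) - y) < e / 2"
    using gen_approx[OF assms(1) e] by blast
  obtain d' where d': "d' > 0" "\<And>h. 0 < h \<Longrightarrow> h < d' \<Longrightarrow> N ((1 / h) *\<^sub>R (T h x' - x') - y') < e / 2"
    using gen_approx[OF assms(2) e] by blast
  have "N ((1 / h) *\<^sub>R (T h (x - x') - (x - x')) - (y - y')) < e" if h: "0 < h" "h < min d d'" for h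
  proof -
    let ?p = "(1 / h) *\<^sub>R (T h x - x) - y" and ?q = "(1 / h) *\<^sub>R (T h x' - x') - y'"
    have pq: "?p \<in> V" "?q \<in> V" using diff_quotient_in h V by auto
    have "(1 / h) *\<^sub>R (T h (x - x') - (x - x')) - (y - y') = ?p - ?q"
      using h V by (simp add: T_diff scaleR_diff_right)
    also have "N (?p - ?q) \<le> N ?p + N ?q"
      using pq by (intro N_triangle_diff)
    also have "\<dots> < e" using d(2)[of h] d'(2)[of h] h by simp
    finally show ?thesis .
  qed
  then show "\<exists>d>0. \<forall>h. 0 < h \<longrightarrow> h < d \<longrightarrow> N ((1 / h) *\<^sub>R (T h (x - x') - (x - x')) - (y - y')) < e"
    using d(1) d'(1) by (intro exI[of _ "min d d'"]) auto
qed

lemma gen_scale: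
  assumes "(x, y) \<in> A"
  shows "(c *\<^sub>R x, c *\<^sub>R y) \<in> A"
proof (rule gen_intro)
  have V: "x \<in> V" "y \<in> V" using gen_in[OF assms] by auto
  then show "c *\<^sub>R x \<in> V" "c *\<^sub>R y \<in> V" by auto
  fix e :: real assume e: "0 < e"
  then have e': "0 < e / (\<bar>c\<bar> + 1)" by (simp add: add_nonneg_pos)
  obtain d where d: "d > 0" "\<And>h. 0 < h \<Longrightarrow> h < d \<Longrightarrow> N ((1 / h) *\<^sub>R (T h x - x) - y) < e / (\<bar>c\<bar> + 1)"
    using gen_approx[OF assms e'] by blast
  have "N ((1 / h) *\<^sub>R (T h (c *\<^sub>R x) - c *\<^sub>R x) - c *\<^sub>R y) < e" if h: "0 < h" "h < d" for h
  proof -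
    let ?p = "(1 / h) *\<^sub>R (T h x - x) - y"
    have p: "?p \<in> V" using diff_quotient_in h V by auto
    have "(1 / h) *\<^sub>R (T h (c *\<^sub>R x) - c *\<^sub>R x) - c *\<^sub>R y = c *\<^sub>R ?p"
      using h V by (simp add: T_scale scaleR_diff_right)
    then have "N ((1 / h) *\<^sub>R (T h (c *\<^sub>R x) - c *\<^sub>R x) - c *\<^sub>R y) = \<bar>c\<bar> * N ?p"
      by (simp only: N_scale[OF p])
    also have "\<dots> \<le> (\<bar>c\<bar> + 1) * N ?p" by (intro mult_right_mono) simp_all
    also have "\<dots> < (\<bar>c\<bar> + 1) * (e / (\<bar>c\<bar> + 1))"
      using d(2)[OF h] by (intro mult_strict_left_mono) (simp_all add: add_nonneg_pos)
    also have "\<dots> = e" by (simp add: add_nonneg_eq_0_iff)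
    finally show ?thesis .
  qed
  then show "\<exists>d>0. \<forall>h. 0 < h \<longrightarrow> h < d \<longrightarrow> N ((1 / h) *\<^sub>R (T h (c *\<^sub>R x) - c *\<^sub>R x) - c *\<^sub>R y) < e"
    using d(1) by blast
qed

end

section \<open>An equivalent norm and dissipativity\<close>

locale growth_semigroup = semigroup_on V N T
  for V :: "'v::real_vector set" and N and T +
  fixes w M :: real
  assumes w: "0 < w" and M: "1 \<le> M"
    and growth: "0 \<le> t \<Longrightarrow> x \<in> V \<Longrightarrow> N (T t x) \<le> M * exp (w * t) * N x"
begin

text \<open>For the equivalent norm \<open>Q\<close> the semigroup is quasi-contractive, which yields the bounds on powers of
  the resolvent needed in Euler's formula.\<close>

definition Q where "Q x = (SUP t\<in>{0..}. exp (- w * t) * N (T t x))"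

lemma Q_bound: "0 \<le> t \<Longrightarrow> x \<in> V \<Longrightarrow> exp (- w * t) * N (T t x) \<le> M * N x"
  using mult_left_mono[OF growth, of t x "exp (- w * t)"] by (simp add: exp_minus field_simps)

lemma Q_upper: "0 \<le> t \<Longrightarrow> x \<in> V \<Longrightarrow> exp (- w * t) * N (T t x) \<le> Q x"
  unfolding Q_def using Q_bound[of _ x]
  by (intro cSUP_upper) (auto intro!: bdd_aboveI[of _ "M * N x"])

lemma Q_least: "(\<And>t. 0 \<le> t \<Longrightarrow> exp (- w * t) * N (T t x) \<le> c) \<Longrightarrow> Q x \<le> c"
  unfolding Q_def by (intro cSUP_least) auto

lemma N_le_Q: "x \<in> V \<Longrightarrow> N x \<le> Q x"
  using Q_upper[of 0 x] by simp

lemma Q_le_N: "x \<in> V \<Longrightarrow> Q x \<le> M * N x"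
  using Q_bound by (intro Q_least) auto

lemma Q_nonneg: "x \<in> V \<Longrightarrow> 0 \<le> Q x"
  using N_le_Q[of x] N_nonneg[of x] by linarith

lemma Q_triangle: "x \<in> V \<Longrightarrow> y \<in> V \<Longrightarrow> Q (x + y) \<le> Q x + Q y"
proof (rule Q_least)
  fix t :: real assume V: "x \<in> V" "y \<in> V" and t: "0 \<le> t"
  have "exp (- w * t) * N (T t (x + y)) \<le> exp (- w * t) * (N (T t x) + N (T t y))"
    using V t by (intro mult_left_mono) (simp_all add: T_add N_triangle)
  also have "\<dots> \<le> Q x + Q y" using Q_upper[OF t V(1)] Q_upper[OF t V(2)] by (simp add: algebra_simps)
  finally show "exp (- w * t) * N (T t (x + y)) \<le> Q x + Q y" .
qed

lemma Q_scale_le: "x \<in> V \<Longrightarrow> Q (c *\<^sub>R x) \<le> \<bar>c\<bar> * Q x"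
proof (rule Q_least)
  fix t :: real assume V: "x \<in> V" and t: "0 \<le> t"
  have "exp (- w * t) * N (T t (c *\<^sub>R x)) = \<bar>c\<bar> * (exp (- w * t) * N (T t x))"
    using V t by (simp add: T_scale N_scale)
  also have "\<dots> \<le> \<bar>c\<bar> * Q x" by (intro mult_left_mono Q_upper V t) simp
  finally show "exp (- w * t) * N (T t (c *\<^sub>R x)) \<le> \<bar>c\<bar> * Q x" .
qed

lemma Q_scale: "x \<in> V \<Longrightarrow> Q (c *\<^sub>R x) = \<bar>c\<bar> * Q x"
proof (cases "c = 0")
  case False
  assume x: "x \<in> V"
  have "Q x = Q ((1 / c) *\<^sub>R (c *\<^sub>R x))" using False by simp
  also have "\<dots> \<le> \<bar>1 / c\<bar> * Q (c *\<^sub>R x)" using x by (intro Q_scale_le) auto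
  finally have "\<bar>c\<bar> * Q x \<le> Q (c *\<^sub>R x)" using False by (simp add: field_simps)
  then show ?thesis using Q_scale_le[OF x, of c] by simp
next
  case True
  assume x: "x \<in> V"
  show ?thesis using True Q_scale_le[OF x, of 0] Q_nonneg[of 0] by simp
qed

lemma Q_minus: "x \<in> V \<Longrightarrow> Q (- x) = Q x"
  using Q_scale[of x "-1"] by simp

lemma Q_diff_triangle: "x \<in> V \<Longrightarrow> y \<in> V \<Longrightarrow> z \<in> V \<Longrightarrow> Q (x - z) \<le> Q (x - y) + Q (y - z)"
  using Q_triangle[of "x - y" "y - z"] by auto

lemma Q_triangle_diff: "x \<in> V \<Longrightarrow> y \<in> V \<Longrightarrow> Q (x - y) \<le> Q x + Q y"
  using Q_triangle[of x "- y"] Q_minus[of y] by auto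

lemma Q_T: "0 \<le> s \<Longrightarrow> x \<in> V \<Longrightarrow> Q (T s x) \<le> exp (w * s) * Q x"
proof (rule Q_least)
  fix t :: real assume V: "x \<in> V" and t: "0 \<le> t" and s: "0 \<le> s"
  have "exp (- w * t) * N (T t (T s x)) = exp (w * s) * (exp (- w * (t + s)) * N (T (t + s) x))"
    using T_T[OF t s V] by (simp add: algebra_simps flip: exp_add)
  also have "\<dots> \<le> exp (w * s) * Q x" using s t V by (intro mult_left_mono Q_upper) simp_all
  finally show "exp (- w * t) * N (T t (T s x)) \<le> exp (w * s) * Q x" .
qed

lemma Q_sum_T:
  fixes \<delta> :: real
  assumes "y \<in> V" "0 \<le> \<delta>" "real n * \<delta> \<le> h"
  shows "Q (\<Sum>k<n. T (real k * \<delta>) y) \<le> real n * exp (w * h) * Q y"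
  using assms(3)
proof (induction n)
  case 0
  then show ?case using Q_scale[of 0 0] by simp
next
  case (Suc n)
  have *: "real n * \<delta> \<le> h" using Suc.prems assms(2) by (simp add: algebra_simps)
  have "Q (\<Sum>k<Suc n. T (real k * \<delta>) y) \<le> Q (\<Sum>k<n. T (real k * \<delta>) y) + Q (T (real n * \<delta>) y)"
    using assms(1,2) by (simp, intro Q_triangle sum_in T_in) simp_all
  also have "Q (T (real n * \<delta>) y) \<le> exp (w * (real n * \<delta>)) * Q y"
    using assms(1,2) by (intro Q_T) simp_all
  also have "\<dots> \<le> exp (w * h) * Q y"
    using w * by (intro mult_right_mono Q_nonneg assms(1)) simp
  finally show ?case using Suc.IH[OF *] by (simp add: algebra_simps)
qed

text \<open>Split \<open>(l + 1 / h) *\<^sub>R x\<close> into \<open>l *\<^sub>R x - y\<close>, the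
  term \<open>(1 / h) *\<^sub>R T h x\<close> and the error of the difference quotient. As
  \<open>Q (T h x) \<le> exp (w * h) * Q x\<close>, and \<open>(exp (w * h) - 1) / h\<close> tends
  to \<open>w\<close>, the limit \<open>h \<rightarrow> 0\<close> leaves the factor
  \<open>l - w\<close>.\<close>

lemma dissipative:
  assumes xy: "(x, y) \<in> A" and l: "0 \<le> l"
  shows "(l - w) * Q x \<le> Q (l *\<^sub>R x - y)"
proof -
  have V: "x \<in> V" "y \<in> V" using gen_in[OF xy] by auto
  have "(l - w) * Q x \<le> Q (l *\<^sub>R x - y) + e" if e: "0 < e" for e
  proof -
    have e2: "e / (2 * M) > 0" using e M by simp
    obtain d where d: "d > 0" "\<And>h. 0 < h \<Longrightarrow> h < d \<Longrightarrow> N ((1 / h) *\<^sub>R (T h x - x) - y) < e / (2 * M)"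
      using gen_approx[OF xy e2] by blast
    have "((\<lambda>h. exp (w * h)) has_real_derivative w) (at 0)"
      by (auto intro!: derivative_eq_intros)
    then have "((\<lambda>h. (exp (w * h) - 1) / h) \<longlongrightarrow> w) (at 0)"
      by (simp add: has_field_derivative_iff)
    then have "((\<lambda>h. (exp (w * h) - 1) / h) \<longlongrightarrow> w) (at_right 0)"
      by (simp add: filterlim_at_split)
    then have "((\<lambda>h. (exp (w * h) - 1) / h * Q x) \<longlongrightarrow> w * Q x) (at_right 0)"
      by (rule tendsto_mult_right)
    from order_tendstoD(2)[OF this, of "w * Q x + e / 2"]
    have "\<forall>\<^sub>F h in at_right 0. (exp (w * h) - 1) / h * Q x < w * Q x + e / 2"
      using e by simp
    then obtain d' where d': "d' > 0" "\<And>h. 0 < h \<Longrightarrow> h < d' \<Longrightarrow> (exp (w * h) - 1) / h * Q x < w * Q x + e / 2"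
      unfolding eventually_at_right_field by auto
    define h where "h = min d d' / 2"
    have h: "0 < h" "h < d" "h < d'" using d(1) d'(1) by (auto simp: h_def min_def)
    let ?q = "(1 / h) *\<^sub>R (T h x - x)"
    have qV: "?q \<in> V" by (rule diff_quotient_in[OF h(1) V(1)])
    have Th: "T h x \<in> V" using h V by simp
    have "(l + 1 / h) * Q x = Q ((l + 1 / h) *\<^sub>R x)" using Q_scale[OF V(1)] l h by simp
    also have "(l + 1 / h) *\<^sub>R x = (l *\<^sub>R x - y) + ((1 / h) *\<^sub>R T h x - (?q - y))"
      by (simp add: algebra_simps)
    also have "Q \<dots> \<le> Q (l *\<^sub>R x - y) + Q ((1 / h) *\<^sub>R T h x - (?q - y))"
      using V qV Th by (intro Q_triangle) auto
    also have "Q ((1 / h) *\<^sub>R T h x - (?q - y)) \<le> Q ((1 / h) *\<^sub>R T h x) + Q (?q - y)"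
      using V qV Th by (intro Q_triangle_diff) auto
    also have "Q (?q - y) \<le> M * N (?q - y)" using V qV by (intro Q_le_N) auto
    also have "\<dots> \<le> M * (e / (2 * M))" using d(2)[OF h(1,2)] M by (intro mult_left_mono) simp_all
    also have "M * (e / (2 * M)) = e / 2" using M by simp
    also have "Q ((1 / h) *\<^sub>R T h x) \<le> exp (w * h) * Q x / h"
      using Q_scale[OF Th, of "1 / h"] Q_T[of h x] h V by (simp add: divide_right_mono)
    finally have "(l + 1 / h) * Q x \<le> Q (l *\<^sub>R x - y) + (exp (w * h) * Q x / h + e / 2)" by simp
    moreover have "exp (w * h) * Q x / h - (1 / h) * Q x = (exp (w * h) - 1) / h * Q x"
      by (simp add: diff_divide_distrib left_diff_distrib)
    ultimately show ?thesis using d'(2)[OF h(1,3)] by (simp add: distrib_right left_diff_distrib)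
  qed
  then show ?thesis by (rule field_le_epsilon)
qed

lemma gen_T:
  assumes xy: "(x, y) \<in> A" and s: "0 \<le> s"
  shows "(T s x, T s y) \<in> A"
proof (rule gen_intro)
  have V: "x \<in> V" "y \<in> V" using gen_in[OF xy] by auto
  then show "T s x \<in> V" "T s y \<in> V" using s by auto
  fix e :: real assume e: "0 < e"
  have c: "0 < M * exp (w * s)" using M by simp
  then have e': "0 < e / (M * exp (w * s))" using e by simp
  obtain d where d: "d > 0" "\<And>h. 0 < h \<Longrightarrow> h < d \<Longrightarrow> N ((1 / h) *\<^sub>R (T h x - x) - y) < e / (M * exp (w * s))"
    using gen_approx[OF xy e'] by blast
  have "N ((1 / h) *\<^sub>R (T h (T s x) - T s x) - T s y) < e" if h: "0 < h" "h < d" for h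
  proof -
    have qV: "(1 / h) *\<^sub>R (T h x - x) \<in> V" by (rule diff_quotient_in[OF h(1) V(1)])
    have "T h (T s x) = T s (T h x)"
      using T_T[of h s x] T_T[of s h x] h s V by (simp add: add.commute)
    then have "(1 / h) *\<^sub>R (T h (T s x) - T s x) - T s y = T s ((1 / h) *\<^sub>R (T h x - x) - y)"
      using qV V s h by (simp add: T_diff T_scale diff_in)
    also have "N \<dots> \<le> M * exp (w * s) * N ((1 / h) *\<^sub>R (T h x - x) - y)"
      using qV V s by (intro growth) auto
    also have "\<dots> < M * exp (w * s) * (e / (M * exp (w * s)))"
      using d(2)[OF h] c by (intro mult_strict_left_mono)
    also have "\<dots> = e" using M by simp
    finally show ?thesis .
  qed
  then show "\<exists>d>0. \<forall>h. 0 < h \<longrightarrow> h < d \<longrightarrow> N ((1 / h) *\<^sub>R (T h (T s x) - T s x) - T s y) < e"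
    using d(1) by blast
qed

end

section \<open>The resolvent and Euler's formula\<close>

locale resolvent_semigroup = growth_semigroup V N T w M
  for V :: "'v::real_vector set" and N and T and w M +
  fixes l1 :: real
  assumes l1: "2 * w \<le> l1"
    and surj: "l1 \<le> l \<Longrightarrow> y \<in> V \<Longrightarrow> \<exists>z. (z, l *\<^sub>R z - y) \<in> generator V N T"
begin

definition R where "R l y = (SOME z. (z, l *\<^sub>R z - y) \<in> A)"

lemma R_gen: "l1 \<le> l \<Longrightarrow> y \<in> V \<Longrightarrow> (R l y, l *\<^sub>R R l y - y) \<in> A"
  unfolding R_def by (rule someI_ex) (rule surj)

lemma R_in: "l1 \<le> l \<Longrightarrow> y \<in> V \<Longrightarrow> R l y \<in> V"
  using R_gen gen_in by blast

lemma l_gt_w: "l1 \<le> l \<Longrightarrow> w < l \<and> 0 < l - w \<and> 0 \<le> l"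
  using l1 w by simp

text \<open>The difference of two solutions solves the homogeneous equation, and
  \<open>dissipative\<close> with \<open>l > w\<close> forces it to vanish.\<close>

lemma R_unique:
  assumes "l1 \<le> l" "y \<in> V" "(z, l *\<^sub>R z - y) \<in> A"
  shows "R l y = z"
proof -
  have z: "z \<in> V" using gen_in[OF assms(3)] by simp
  have "(R l y - z, l *\<^sub>R R l y - y - (l *\<^sub>R z - y)) \<in> A"
    by (rule gen_diff[OF R_gen[OF assms(1,2)] assms(3)])
  from dissipative[OF this, of l] have "(l - w) * Q (R l y - z) \<le> Q 0"
    using l_gt_w[OF assms(1)] by (simp add: algebra_simps)
  moreover have "Q 0 = 0" using Q_scale[of 0 0] by simp
  ultimately have "Q (R l y - z) \<le> 0"
    using l_gt_w[OF assms(1)] by (simp add: mult_le_0_iff)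
  moreover have D: "R l y - z \<in> V" using R_in[OF assms(1,2)] z by auto
  ultimately have "N (R l y - z) = 0" using N_le_Q[OF D] N_nonneg[of "R l y - z"] by linarith
  then show ?thesis using N_eq_0[OF D] by simp
qed

lemma Q_R: "l1 \<le> l \<Longrightarrow> y \<in> V \<Longrightarrow> (l - w) * Q (R l y) \<le> Q y"
  using dissipative[OF R_gen, of l y l] l_gt_w[of l] by simp

lemma R_diff: "l1 \<le> l \<Longrightarrow> x \<in> V \<Longrightarrow> y \<in> V \<Longrightarrow> R l (x - y) = R l x - R l y"
  using gen_diff[OF R_gen R_gen, of l x l y]
  by (intro R_unique) (auto simp: algebra_simps)

lemma R_T: "l1 \<le> l \<Longrightarrow> 0 \<le> s \<Longrightarrow> x \<in> V \<Longrightarrow> R l (T s x) = T s (R l x)"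
  using gen_T[OF R_gen, of l x s] R_in[of l x]
  by (intro R_unique) (auto simp: T_diff T_scale scale_in)

text \<open>The resolvent commutes with the generator: the difference quotients of
  \<open>R l x\<close> and \<open>x\<close> combine to show that
  \<open>l *\<^sub>R R l x - x\<close> solves the resolvent equation with right-hand side
  \<open>y\<close>, and solutions are unique.\<close>

lemma R_of_gen: "l1 \<le> l \<Longrightarrow> (x, y) \<in> A \<Longrightarrow> l *\<^sub>R R l x - x = R l y"
proof -
  assume l: "l1 \<le> l" and xy: "(x, y) \<in> A"
  have V: "x \<in> V" "y \<in> V" using gen_in[OF xy] by auto
  have "(l *\<^sub>R R l x - x, l *\<^sub>R (l *\<^sub>R R l x - x) - y) \<in> A"
  proof (rule gen_intro)
    show "l *\<^sub>R R l x - x \<in> V" "l *\<^sub>R (l *\<^sub>R R l x - x) - y \<in> V" using R_in[OF l V(1)] V by auto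
    fix e :: real assume e: "0 < e"
    define z where "z = R l x"
    have z: "(z, l *\<^sub>R z - x) \<in> A" "z \<in> V" using R_gen[OF l V(1)] R_in[OF l V(1)] by (simp_all add: z_def)
    have l0: "0 \<le> l" using l_gt_w[OF l] by simp
    have e2: "0 < e / 2" "0 < e / 2 / (l + 1)" using e l0 by simp_all
    obtain d where d: "d > 0" "\<And>h. 0 < h \<Longrightarrow> h < d \<Longrightarrow> N ((1 / h) *\<^sub>R (T h x - x) - y) < e / 2"
      using gen_approx[OF xy e2(1)] by blast
    obtain d' where d': "d' > 0" "\<And>h. 0 < h \<Longrightarrow> h < d' \<Longrightarrow>
        N ((1 / h) *\<^sub>R (T h z - z) - (l *\<^sub>R z - x)) < e / 2 / (l + 1)"
      using gen_approx[OF z(1) e2(2)] by blast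
    have "N ((1 / h) *\<^sub>R (T h (l *\<^sub>R z - x) - (l *\<^sub>R z - x)) - (l *\<^sub>R (l *\<^sub>R z - x) - y)) < e"
      if h: "0 < h" "h < min d d'" for h
    proof -
      let ?p = "(1 / h) *\<^sub>R (T h z - z) - (l *\<^sub>R z - x)" and ?q = "(1 / h) *\<^sub>R (T h x - x) - y"
      have pq: "?p \<in> V" "?q \<in> V" using diff_quotient_in h V z(2) by auto
      have "(1 / h) *\<^sub>R (T h (l *\<^sub>R z - x) - (l *\<^sub>R z - x)) - (l *\<^sub>R (l *\<^sub>R z - x) - y) = l *\<^sub>R ?p - ?q"
        using h V z(2) by (simp add: T_diff T_scale scale_in algebra_simps)
      also have "N (l *\<^sub>R ?p - ?q) \<le> l * N ?p + N ?q"
        using N_triangle_diff[of "l *\<^sub>R ?p" ?q] pq N_scale[OF pq(1), of l] l0 by simp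
      also have "\<dots> < e"
      proof -
        have "l * N ?p \<le> (l + 1) * N ?p" by (intro mult_right_mono) simp_all
        also have "\<dots> < (l + 1) * (e / 2 / (l + 1))"
          using d'(2)[of h] h l0 by (intro mult_strict_left_mono) simp_all
        also have "\<dots> = e / 2"
          using l0 by (intro trans[OF times_divide_eq_right nonzero_mult_div_cancel_left]) simp
        finally show ?thesis using d(2)[of h] h by simp
      qed
      finally show ?thesis .
    qed
    then show "\<exists>d>0. \<forall>h. 0 < h \<longrightarrow> h < d \<longrightarrow> N ((1 / h) *\<^sub>R (T h (l *\<^sub>R R l x - x) - (l *\<^sub>R R l x - x))
        - (l *\<^sub>R (l *\<^sub>R R l x - x) - y)) < e"
      unfolding z_def[symmetric] using d(1) d'(1) by (intro exI[of _ "min d d'"]) auto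
  qed
  then show ?thesis using R_unique[OF l V(2)] by simp
qed

lemma Q_lR:
  assumes "l1 \<le> l" "y \<in> V"
  shows "Q (l *\<^sub>R R l y) \<le> l / (l - w) * Q y"
proof -
  have lw: "0 < l - w" "0 \<le> l" using l_gt_w[OF assms(1)] by auto
  have "Q (R l y) \<le> Q y / (l - w)"
    using Q_R[OF assms] lw by (simp add: pos_le_divide_eq mult.commute)
  from mult_left_mono[OF this lw(2)] show ?thesis
    using lw Q_scale[OF R_in[OF assms], of l] by simp
qed

text \<open>Density of the domain is proved with averages of \<open>T (k * \<delta>) y\<close> over a finite grid, which
  replace the integral means of the usual argument.\<close>

lemma domain_dense:
  assumes y: "y \<in> V" and e: "0 < e"
  shows "\<exists>x v. (x, v) \<in> A \<and> Q (x - y) < e"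
proof -
  have e4: "0 < e / (4 * M)" using e M by simp
  obtain d where d: "d > 0" "\<And>h. 0 \<le> h \<Longrightarrow> h < d \<Longrightarrow> N (T h y - y) < e / (4 * M)"
    using T_cont[OF y e4] by blast
  have Qd: "Q (T s y - y) \<le> e / 4" if "0 \<le> s" "s < d" for s
  proof -
    have "Q (T s y - y) \<le> M * N (T s y - y)" using y that by (intro Q_le_N) auto
    also have "\<dots> \<le> M * (e / (4 * M))" using d(2)[OF that] M by (intro mult_left_mono) simp_all
    also have "\<dots> = e / 4" using M by simp
    finally show ?thesis .
  qed
  define h where "h = d / 2"
  have h: "0 < h" "h < d" using d(1) by (simp_all add: h_def)
  \<comment> \<open>The term left over after telescoping is bounded by \<open>C / (l - w)\<close>,
    because \<open>Q (R l y) \<le> Q y / (l - w)\<close>; \<open>l\<close> is chosen to make it at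
    most \<open>e / 4\<close>.\<close>
  define C where "C = (exp (w * h) + 1) / h * Q y"
  have C: "0 \<le> C" using h Q_nonneg[OF y] by (simp add: C_def add_nonneg_nonneg)
  define l where "l = max l1 (w + 4 * C / e + 1)"
  have l: "l1 \<le> l" by (simp add: l_def)
  have lw: "4 * C / e < l - w" by (simp add: l_def less_max_iff_disj)
  have Cl: "C / (l - w) \<le> e / 4"
    using lw e l_gt_w[OF l] by (simp add: field_simps)
  define z where "z = R l y"
  define a where "a = l *\<^sub>R z - y"
  have za: "(z, a) \<in> A" using R_gen[OF l y] by (simp add: z_def a_def)
  have V: "z \<in> V" "a \<in> V" using gen_in[OF za] by auto
  define E where "E = e / (4 * M * exp (w * h))"
  have E: "0 < E" using e M by (simp add: E_def)
  obtain d' where d': "d' > 0" "\<And>h. 0 < h \<Longrightarrow> h < d' \<Longrightarrow> N ((1 / h) *\<^sub>R (T h z - z) - a) < E"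
    using gen_approx[OF za E] by blast
  obtain n0 where n0: "h / d' < real n0" using reals_Archimedean2 by blast
  define n where "n = Suc n0"
  define \<delta> where "\<delta> = h / real n"
  have \<delta>: "0 < \<delta>" "\<delta> < d'" "real n * \<delta> = h"
  proof -
    show "0 < \<delta>" "real n * \<delta> = h" using h by (simp_all add: \<delta>_def n_def)
    have "h / d' < real n" using n0 by (simp add: n_def)
    then show "\<delta> < d'" using d'(1) by (simp add: \<delta>_def n_def field_simps)
  qed
  have n: "0 < real n" by (simp add: n_def)
  define u where "u = (1 / real n) *\<^sub>R (\<Sum>k<n. T (real k * \<delta>) y)"
  have sumV: "(\<Sum>k<n. T (real k * \<delta>) b) \<in> V" if "b \<in> V" for b using that \<delta>(1) by (intro sum_in T_in) simp_all
  have uV: "u \<in> V" unfolding u_def using sumV[OF y] by auto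
  have kd: "real k * \<delta> < d" if "k < n" for k
  proof -
    have "real k * \<delta> \<le> real n * \<delta>" using that \<delta>(1) by (intro mult_right_mono) simp_all
    then show ?thesis using \<delta>(3) h by simp
  qed
  have Q_sum: "Q (\<Sum>k<m. f k) \<le> real m * c" if "\<And>k. k < m \<Longrightarrow> f k \<in> V \<and> Q (f k) \<le> c" for f m c
    using that
  proof (induction m)
    case 0
    then show ?case using Q_scale[of 0 0] by simp
  next
    case (Suc m)
    have "Q (\<Sum>k<Suc m. f k) \<le> Q (\<Sum>k<m. f k) + Q (f m)"
      using Suc.prems by (simp, intro Q_triangle sum_in) simp_all
    moreover have "Q (\<Sum>k<m. f k) \<le> real m * c" by (rule Suc.IH) (simp add: Suc.prems)
    moreover have "Q (f m) \<le> c" by (simp add: Suc.prems)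
    moreover have "real (Suc m) * c = real m * c + c" by (simp add: algebra_simps)
    ultimately show ?case by linarith
  qed
  have uy: "Q (u - y) \<le> e / 4"
  proof -
    have eq: "u - y = (1 / real n) *\<^sub>R (\<Sum>k<n. T (real k * \<delta>) y - y)"
      using n by (simp add: u_def sum_subtractf scaleR_diff_right sum_constant_scaleR)
    have "Q (\<Sum>k<n. T (real k * \<delta>) y - y) \<le> real n * (e / 4)"
    proof (rule Q_sum, rule conjI)
      show "T (real k * \<delta>) y - y \<in> V" for k using y \<delta>(1) by simp
      show "Q (T (real k * \<delta>) y - y) \<le> e / 4" if "k < n" for k
        using \<delta>(1) kd[OF that] by (intro Qd) simp_all
    qed
    then have "1 / real n * Q (\<Sum>k<n. T (real k * \<delta>) y - y) \<le> 1 / real n * (real n * (e / 4))"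
      using n by (intro mult_left_mono) simp_all
    moreover have "(\<Sum>k<n. T (real k * \<delta>) y - y) \<in> V" using y \<delta>(1) by (intro sum_in) auto
    ultimately show ?thesis unfolding eq using n by (simp add: Q_scale)
  qed
  have sum_T_diff: "(\<Sum>k<m. T (real k * \<delta>) (b - c)) = (\<Sum>k<m. T (real k * \<delta>) b) - (\<Sum>k<m. T (real k * \<delta>) c)"
    if "b \<in> V" "c \<in> V" for b c m
    using that \<delta>(1) by (simp add: T_diff sum_subtractf)
  have R_sum: "R l (\<Sum>k<m. T (real k * \<delta>) y) = (\<Sum>k<m. T (real k * \<delta>) z)" for m
  proof (induction m)
    case 0
    show ?case using R_diff[OF l, of 0 0] by simp
  next
    case (Suc m)
    have "R l ((\<Sum>k<m. T (real k * \<delta>) y) - (- T (real m * \<delta>) y))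
        = (\<Sum>k<m. T (real k * \<delta>) z) - R l (- T (real m * \<delta>) y)"
      using Suc \<delta>(1) y l by (subst R_diff) (auto intro!: sum_in)
    also have "R l (- T (real m * \<delta>) y) = - T (real m * \<delta>) z"
      using R_diff[OF l, of 0 "T (real m * \<delta>) y"] R_diff[OF l, of 0 0] R_T[OF l, of "real m * \<delta>" y] \<delta>(1) y
      by (simp add: z_def)
    finally show ?case by simp
  qed
  \<comment> \<open>This is \<open>l R(l) u\<close> written out along the grid. It lies in the
    domain, and \<open>x - u\<close> is the average over the grid of the orbit of \<open>a\<close>,
    the generator applied to \<open>z\<close>.\<close>
  define x where "x = (l / real n) *\<^sub>R (\<Sum>k<n. T (real k * \<delta>) z)"
  define s1 where "s1 = (\<Sum>k<n. T (real k * \<delta>) z)"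
  have s1V: "s1 \<in> V" unfolding s1_def by (rule sumV[OF V(1)])
  have s1_gen: "(s1, (\<Sum>k<n. T (real k * \<delta>) a)) \<in> A"
  proof -
    have "(s1, l *\<^sub>R s1 - (\<Sum>k<n. T (real k * \<delta>) y)) \<in> A"
      using R_gen[OF l sumV[OF y]] by (simp add: R_sum s1_def)
    moreover have "(\<Sum>k<n. T (real k * \<delta>) a) = l *\<^sub>R s1 - (\<Sum>k<n. T (real k * \<delta>) y)"
      unfolding a_def using V(1) y \<delta>(1)
      by (simp add: s1_def T_diff T_scale scale_in sum_subtractf scaleR_sum_right)
    ultimately show ?thesis by simp
  qed
  have tele: "(\<Sum>k<m. T (real k * \<delta>) (T \<delta> z - z)) = T (real m * \<delta>) z - z" for m
  proof (induction m)
    case (Suc m)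
    have "T (real m * \<delta>) (T \<delta> z - z) = T (real (Suc m) * \<delta>) z - T (real m * \<delta>) z"
      using T_T[of "real m * \<delta>" \<delta> z] V(1) \<delta>(1) by (simp add: T_diff algebra_simps)
    then show ?case using Suc by simp
  qed (simp add: V(1))
  have Qz: "Q z \<le> Q y / (l - w)"
    using Q_R[OF l y] l_gt_w[OF l] by (simp add: z_def field_simps)
  have x_u: "Q (x - u) \<le> e / 2"
  proof -
    \<comment> \<open>Because of \<open>\<delta> < d'\<close> the quotient \<open>q\<close> differs
      from \<open>a\<close> by less than \<open>E\<close>. Its orbit sum telescopes to
      \<open>T h z - z\<close>, and \<open>real n * \<delta> = h\<close> makes the averaged boundary
      term independent of the grid.\<close>
    define q where "q = (1 / \<delta>) *\<^sub>R (T \<delta> z - z)"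
    have qV: "q \<in> V" unfolding q_def by (rule diff_quotient_in[OF \<delta>(1) V(1)])
    have sq: "(\<Sum>k<n. T (real k * \<delta>) q) = (1 / \<delta>) *\<^sub>R (T h z - z)"
      unfolding q_def \<delta>(3)[symmetric] tele[symmetric] using V(1) \<delta>(1)
      by (simp add: T_scale diff_in scaleR_sum_right)
    have "x - u = (1 / real n) *\<^sub>R (\<Sum>k<n. T (real k * \<delta>) a)"
      unfolding x_def u_def a_def using V(1) y \<delta>(1)
      by (simp add: T_diff T_scale scale_in sum_subtractf scaleR_diff_right scaleR_sum_right)
    also have "\<dots> = (1 / real n) *\<^sub>R ((\<Sum>k<n. T (real k * \<delta>) (a - q)) + (1 / \<delta>) *\<^sub>R (T h z - z))"
      using sum_T_diff[OF V(2) qV, of n] by (simp add: sq)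
    also have "Q \<dots> = (1 / real n) * Q ((\<Sum>k<n. T (real k * \<delta>) (a - q)) + (1 / \<delta>) *\<^sub>R (T h z - z))"
      using V qV h by (subst Q_scale) (auto intro!: add_in sumV)
    also have "\<dots> \<le> (1 / real n) * (Q (\<Sum>k<n. T (real k * \<delta>) (a - q)) + Q ((1 / \<delta>) *\<^sub>R (T h z - z)))"
      using V qV h by (intro mult_left_mono Q_triangle) (auto intro!: sumV)
    also have "\<dots> \<le> (1 / real n) * (real n * exp (w * h) * (M * E) + (1 / \<delta>) * ((exp (w * h) + 1) * Q z))"
    proof (intro mult_left_mono add_mono)
      have "Q (a - q) \<le> M * N (a - q)" using V qV by (intro Q_le_N) auto
      also have "N (a - q) = N (q - a)" using V qV by (intro N_commute)
      also have "M * N (q - a) \<le> M * E"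
        using d'(2)[OF \<delta>(1,2)] M by (intro mult_left_mono) (simp_all add: q_def)
      finally have "real n * exp (w * h) * Q (a - q) \<le> real n * exp (w * h) * (M * E)"
        by (intro mult_left_mono) simp_all
      moreover have "Q (\<Sum>k<n. T (real k * \<delta>) (a - q)) \<le> real n * exp (w * h) * Q (a - q)"
        using V qV \<delta> by (intro Q_sum_T) auto
      ultimately show "Q (\<Sum>k<n. T (real k * \<delta>) (a - q)) \<le> real n * exp (w * h) * (M * E)" by linarith
      have "Q (T h z - z) \<le> Q (T h z) + Q z" using V h by (intro Q_triangle_diff) auto
      also have "\<dots> \<le> (exp (w * h) + 1) * Q z" using Q_T[of h z] V h by (simp add: algebra_simps)
      finally have "(1 / \<delta>) * Q (T h z - z) \<le> (1 / \<delta>) * ((exp (w * h) + 1) * Q z)"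
        using \<delta>(1) by (intro mult_left_mono) simp_all
      then show "Q ((1 / \<delta>) *\<^sub>R (T h z - z)) \<le> (1 / \<delta>) * ((exp (w * h) + 1) * Q z)"
        using Q_scale[of "T h z - z" "1 / \<delta>"] V h \<delta>(1) by simp
    qed (use n in simp)
    also have "\<dots> = exp (w * h) * M * E + (exp (w * h) + 1) / h * Q z"
      using n \<delta>(1) unfolding \<delta>(3)[symmetric] by (simp add: field_simps)
    also have "\<dots> \<le> e / 4 + C / (l - w)"
    proof (rule add_mono)
      show "exp (w * h) * M * E \<le> e / 4" using M by (simp add: E_def)
      have "(exp (w * h) + 1) / h * Q z \<le> (exp (w * h) + 1) / h * (Q y / (l - w))"
        using h by (intro mult_left_mono Qz) (simp add: add_nonneg_nonneg)
      then show "(exp (w * h) + 1) / h * Q z \<le> C / (l - w)" by (simp add: C_def)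
    qed
    finally show ?thesis using Cl by linarith
  qed
  have xA: "(x, (l / real n) *\<^sub>R (\<Sum>k<n. T (real k * \<delta>) a)) \<in> A"
    unfolding x_def s1_def[symmetric] by (rule gen_scale[OF s1_gen])
  have xV: "x \<in> V" unfolding x_def using sumV[OF V(1)] by auto
  have "Q (x - y) \<le> Q (x - u) + Q (u - y)" by (rule Q_diff_triangle[OF xV uV y])
  also have "\<dots> < e" using x_u uy e by simp
  finally show ?thesis using xA by blast
qed

text \<open>On the domain \<open>l *\<^sub>R R l x - x\<close> equals \<open>R l v\<close>, which
  tends to 0. Density of the domain extends this to all of \<open>V\<close>, since the operators
  \<open>l *\<^sub>R R l\<close> are bounded by 2 in the norm \<open>Q\<close>; that bound is where
  \<open>2 * w \<le> l1\<close> enters.\<close>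

lemma lR_tendsto:
  assumes y: "y \<in> V" and e: "0 < e"
  shows "\<exists>L\<ge>l1. \<forall>l\<ge>L. Q (l *\<^sub>R R l y - y) < e"
proof -
  have e8: "0 < e / 8" using e by simp
  obtain x v where xv: "(x, v) \<in> A" and x: "Q (x - y) < e / 8"
    using domain_dense[OF y e8] by blast
  have V: "x \<in> V" "v \<in> V" using gen_in[OF xv] by auto
  define L where "L = max l1 (w + 4 * Q v / e + 1)"
  have "Q (l *\<^sub>R R l y - y) < e" if lL: "L \<le> l" for l
  proof -
    have l: "l1 \<le> l" using lL by (simp add: L_def)
    have lw: "0 < l - w" "0 \<le> l" using l_gt_w[OF l] by auto
    have RV: "R l x \<in> V" "R l y \<in> V" "R l v \<in> V" using R_in[OF l] V y by auto
    have two: "l / (l - w) \<le> 2" using l l1 lw by (simp add: pos_divide_le_eq)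
    have "Q (l *\<^sub>R R l (y - x)) \<le> l / (l - w) * Q (y - x)" using V y by (intro Q_lR l) simp
    also have "\<dots> \<le> 2 * (e / 8)"
      using two x Q_minus[of "x - y"] Q_nonneg[of "y - x"] V y lw by (intro mult_mono) simp_all
    finally have 1: "Q (l *\<^sub>R R l (y - x)) \<le> e / 4" by simp
    have "4 * Q v / e \<le> l - w" using lL by (simp add: L_def)
    then have "Q v \<le> (l - w) * (e / 4)" using e by (simp add: field_simps)
    then have "(l - w) * Q (R l v) \<le> (l - w) * (e / 4)" using Q_R[OF l V(2)] by linarith
    then have 2: "Q (l *\<^sub>R R l x - x) \<le> e / 4"
      using lw by (simp add: R_of_gen[OF l xv])
    have "l *\<^sub>R R l y - y = l *\<^sub>R R l (y - x) + ((l *\<^sub>R R l x - x) + (x - y))"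
      using R_diff[OF l y V(1)] by (simp add: scaleR_diff_right)
    also have "Q \<dots> \<le> Q (l *\<^sub>R R l (y - x)) + (Q (l *\<^sub>R R l x - x) + Q (x - y))"
      using Q_triangle[of "l *\<^sub>R R l (y - x)" "(l *\<^sub>R R l x - x) + (x - y)"]
        Q_triangle[of "l *\<^sub>R R l x - x" "x - y"] RV V y R_in[OF l, of "y - x"] by simp
    finally show ?thesis using 1 2 x e by simp
  qed
  moreover have "l1 \<le> L" by (simp add: L_def)
  ultimately show ?thesis by blast
qed

text \<open>With \<open>S = (1 / h) R(1 / h)\<close>, the step error at \<open>n + 1\<close> splits
  into \<open>T (n * h)\<close> applied to the first one-step error and \<open>S\<close> applied to
  the error at \<open>n\<close>. As \<open>S\<close> commutes with the semigroup, every step refers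
  to the same defect \<open>T h x - S x\<close>, so the error is at most \<open>n\<close> such
  defects up to exponential factors.\<close>

lemma euler_error:
  assumes h: "0 < h" "l1 \<le> 1 / h" and x: "x \<in> V" and n: "real n * h \<le> t"
  shows "((\<lambda>z. (1 / h) *\<^sub>R R (1 / h) z) ^^ n) x \<in> V \<and>
    Q (T (real n * h) x - ((\<lambda>z. (1 / h) *\<^sub>R R (1 / h) z) ^^ n) x)
      \<le> real n * exp (2 * w * (real n * h)) * exp (w * t) * Q (T h x - (1 / h) *\<^sub>R R (1 / h) x)"
  using n
proof (induction n)
  case 0
  then show ?case using x Q_scale[of 0 0] by simp
next
  case (Suc n)
  define S where "S z = (1 / h) *\<^sub>R R (1 / h) z" for z
  define d where "d = Q (T h x - S x)"
  define q where "q = exp (2 * w * h)"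
  have nt: "real n * h \<le> t" using Suc.prems h by (simp add: algebra_simps)
  have IH: "(S ^^ n) x \<in> V" "Q (T (real n * h) x - (S ^^ n) x)
      \<le> real n * exp (2 * w * (real n * h)) * exp (w * t) * d"
    using Suc.IH[OF nt] by (simp_all add: S_def[abs_def] d_def)
  have SV: "S z \<in> V" if "z \<in> V" for z using R_in[OF h(2) that] by (simp add: S_def)
  have d0: "0 \<le> d" unfolding d_def using SV x h by (intro Q_nonneg) simp
  have "Q (S z) \<le> q * Q z" if z: "z \<in> V" for z
  proof -
    \<comment> \<open>The chain \<open>2 * w \<le> l1 \<le> 1 / h\<close> keeps \<open>w * h\<close>
      below one half, where \<open>1 / (1 - w * h) \<le> 1 + 2 * (w * h)\<close>. This is the source
      of the rate \<open>2 * w\<close> for the powers of \<open>S\<close>.\<close>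
    have hw: "2 * (w * h) \<le> 1"
    proof -
      have "2 * w \<le> 1 / h" using l1 h(2) by linarith
      then show ?thesis using h(1) by (simp add: field_simps)
    qed
    have "1 / h / (1 / h - w) = 1 / (1 - w * h)" using h(1) by (simp add: field_simps)
    also have "\<dots> \<le> 1 + 2 * (w * h)"
    proof -
      have "1 \<le> (1 + 2 * (w * h)) * (1 - w * h)"
      proof -
        have "(1 + 2 * (w * h)) * (1 - w * h) = 1 + w * h * (1 - 2 * (w * h))" by (simp add: algebra_simps)
        moreover have "0 \<le> w * h * (1 - 2 * (w * h))" using w h hw by (intro mult_nonneg_nonneg) simp_all
        ultimately show ?thesis by simp
      qed
      then show ?thesis using hw by (simp add: pos_divide_le_eq)
    qed
    also have "\<dots> \<le> q" using exp_ge_add_one_self[of "2 * (w * h)"] by (simp add: q_def mult.assoc)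
    finally have "1 / h / (1 / h - w) * Q z \<le> q * Q z" by (intro mult_right_mono Q_nonneg z)
    then show ?thesis using Q_lR[OF h(2) z] by (simp add: S_def)
  qed
  note QS = this
  have S_T: "S (T s z) = T s (S z)" if "0 \<le> s" "z \<in> V" for s z
    using R_T[OF h(2) that] T_scale[OF that(1) R_in[OF h(2) that(2)]] by (simp add: S_def)
  have S_diff: "S (a - b) = S a - S b" if "a \<in> V" "b \<in> V" for a b
    using R_diff[OF h(2) that] by (simp add: S_def scaleR_diff_right)
  have nh: "0 \<le> real n * h" using h by simp
  have "T (real (Suc n) * h) x = T (real n * h) (T h x)"
    using T_T[of "real n * h" h x] h x by (simp add: algebra_simps)
  then have "T (real (Suc n) * h) x - (S ^^ Suc n) x
      = T (real n * h) (T h x - S x) + S (T (real n * h) x - (S ^^ n) x)"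
    using S_T[OF nh x] S_diff[OF T_in[OF nh x] IH(1)] T_diff[OF nh, of "T h x" "S x"] SV[OF x] x h by simp
  also have "Q \<dots> \<le> Q (T (real n * h) (T h x - S x)) + Q (S (T (real n * h) x - (S ^^ n) x))"
    using nh h x SV IH(1) by (intro Q_triangle) simp_all
  also have "\<dots> \<le> exp (w * t) * d + q * (real n * exp (2 * w * (real n * h)) * exp (w * t) * d)"
  proof (rule add_mono)
    have "Q (T (real n * h) (T h x - S x)) \<le> exp (w * (real n * h)) * d"
      unfolding d_def using nh h x SV by (intro Q_T) simp_all
    also have "\<dots> \<le> exp (w * t) * d" using w nt d0 by (intro mult_right_mono) simp_all
    finally show "Q (T (real n * h) (T h x - S x)) \<le> exp (w * t) * d" .
    have "Q (S (T (real n * h) x - (S ^^ n) x)) \<le> q * Q (T (real n * h) x - (S ^^ n) x)"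
      using nh x IH(1) by (intro QS) simp
    also have "\<dots> \<le> q * (real n * exp (2 * w * (real n * h)) * exp (w * t) * d)"
      using IH(2) by (intro mult_left_mono) (simp_all add: q_def)
    finally show "Q (S (T (real n * h) x - (S ^^ n) x))
      \<le> q * (real n * exp (2 * w * (real n * h)) * exp (w * t) * d)" .
  qed
  also have "\<dots> \<le> real (Suc n) * exp (2 * w * (real (Suc n) * h)) * exp (w * t) * d"
  proof -
    have q: "exp (2 * w * (real (Suc n) * h)) = q * exp (2 * w * (real n * h))"
      by (simp add: q_def algebra_simps flip: exp_add)
    have "1 \<le> exp (2 * w * (real (Suc n) * h))" using w h by simp
    then have "1 * (exp (w * t) * d) \<le> exp (2 * w * (real (Suc n) * h)) * (exp (w * t) * d)"
      using d0 by (intro mult_right_mono) simp_all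
    then show ?thesis unfolding q by (simp add: algebra_simps)
  qed
  finally show ?case using SV[OF IH(1)] by (simp add: S_def[abs_def] d_def)
qed

text \<open>Euler iterates starting in \<open>C\<close> remain in \<open>C\<close>, and for starting
  points in the domain they converge to the orbit, as the one-step error is of smaller order than
  \<open>h\<close>. An arbitrary \<open>x\<close> in \<open>C\<close> is approximated by
  \<open>L R(L) x\<close>, which lies both in \<open>C\<close> and in the domain.\<close>

lemma invariant_set:
  assumes C: "C \<subseteq> V" and scale: "\<And>c x. x \<in> C \<Longrightarrow> 0 \<le> c \<Longrightarrow> c *\<^sub>R x \<in> C"
    and closed: "\<And>f x. (\<And>n. f n \<in> C) \<Longrightarrow> x \<in> V \<Longrightarrow> (\<lambda>n. N (f n - x)) \<longlonglongrightarrow> 0 \<Longrightarrow> x \<in> C"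
    and pos: "\<And>l x. l1 \<le> l \<Longrightarrow> x \<in> C \<Longrightarrow> R l x \<in> C"
    and t: "0 \<le> t" and x: "x \<in> C"
  shows "T t x \<in> C"
proof (cases "t = 0")
  case True
  then show ?thesis using x C by auto
next
  case False
  with t have t: "0 < t" by simp
  have approx: "z \<in> C" if z: "z \<in> V" and ex: "\<And>e. 0 < e \<Longrightarrow> \<exists>c\<in>C. Q (c - z) < e" for z
  proof -
    have "\<exists>c\<in>C. Q (c - z) < 1 / real (Suc n)" for n by (rule ex) simp
    then obtain f where f: "\<And>n. f n \<in> C" "\<And>n. Q (f n - z) < 1 / real (Suc n)" by metis
    have "norm (N (f n - z)) \<le> 1 / real (Suc n)" for n
      using N_le_Q[of "f n - z"] f(1)[of n] f(2)[of n] C z by (simp add: subset_iff)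
    then have "(\<lambda>n. N (f n - z)) \<longlonglongrightarrow> 0"
      by (intro Lim_null_comparison[OF _ LIMSEQ_Suc[OF lim_1_over_n]]) (simp add: always_eventually)
    then show ?thesis using closed f(1) z by blast
  qed
  have dom: "T t y \<in> C" if yv: "(y, v) \<in> A" and yC: "y \<in> C" for y v
  proof (rule approx)
    have V: "y \<in> V" "v \<in> V" using gen_in[OF yv] by auto
    show "T t y \<in> V" using V t by simp
    fix e :: real assume e: "0 < e"
    define K where "K = t * exp (2 * w * t) * exp (w * t)"
    have K: "0 < K" using t by (simp add: K_def)
    \<comment> \<open>A one-step error of \<open>h * (2 * E)\<close> accumulates over
      \<open>n\<close> steps with \<open>real n * h = t\<close> to at most
      \<open>K * (2 * E)\<close>, that is \<open>e / 2\<close>.\<close>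
    define E where "E = e / (4 * K)"
    have E: "0 < E" "K * (4 * E) = e" using e K by (simp_all add: E_def)
    have E': "0 < E / M" using E M by simp
    obtain L where L: "l1 \<le> L" "\<And>l. L \<le> l \<Longrightarrow> Q (l *\<^sub>R R l v - v) < E"
      using lR_tendsto[OF V(2) E(1)] by blast
    obtain d where d: "0 < d" "\<And>h. 0 < h \<Longrightarrow> h < d \<Longrightarrow> N ((1 / h) *\<^sub>R (T h y - y) - v) < E / M"
      using gen_approx[OF yv E'] by blast
    obtain n :: nat where n: "max (max 1 (t * L)) (t / d + 1) < real n" using reals_Archimedean2 by blast
    define h where "h = t / real n"
    have n0: "0 < real n" using n by simp
    have h: "0 < h" "L \<le> 1 / h" "h < d" "real n * h = t"
    proof -
      show "0 < h" "real n * h = t" using t n0 by (simp_all add: h_def)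
      show "L \<le> 1 / h" using n t n0 by (simp add: h_def field_simps)
      have "t / d < real n" using n by simp
      then show "h < d" using d(1) n0 by (simp add: h_def field_simps)
    qed
    have hl1: "l1 \<le> 1 / h" using h(2) L(1) by linarith
    define S where "S = (\<lambda>z. (1 / h) *\<^sub>R R (1 / h) z)"
    have SC: "(S ^^ k) y \<in> C" for k
    proof (induction k)
      case (Suc k)
      then show ?case unfolding S_def using h(1) by (simp add: scale pos hl1)
    qed (simp add: yC)
    have RV: "R (1 / h) y \<in> V" "R (1 / h) v \<in> V" using R_in[OF hl1] V by auto
    \<comment> \<open>Both \<open>T h y - y\<close> and \<open>S y - y = h *\<^sub>R S v\<close>
      equal \<open>h *\<^sub>R v\<close> up to an error of at most \<open>h * E\<close>.\<close>
    have "Q (T h y - S y) \<le> h * (2 * E)"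
    proof -
      let ?p = "(1 / h) *\<^sub>R (T h y - y) - v" and ?q = "S v - v"
      have p: "?p \<in> V" "?q \<in> V" using V RV h by (simp_all add: S_def)
      have "S y - y = R (1 / h) v" using R_of_gen[OF hl1 yv] by (simp add: S_def)
      also have "\<dots> = h *\<^sub>R S v" using h(1) by (simp add: S_def)
      finally have "T h y - S y = h *\<^sub>R (?p - ?q)" using h(1) by (simp add: algebra_simps)
      then have "Q (T h y - S y) = \<bar>h\<bar> * Q (?p - ?q)" by (simp only: Q_scale[OF diff_in[OF p]])
      also have "\<bar>h\<bar> = h" using h(1) by simp
      also have "Q (?p - ?q) \<le> Q ?p + Q ?q" by (rule Q_triangle_diff[OF p])
      also have "Q ?p \<le> M * N ?p" by (rule Q_le_N[OF p(1)])
      also have "M * N ?p \<le> E" using d(2)[OF h(1,3)] M by (simp add: field_simps)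
      also have "Q ?q \<le> E" using L(2)[OF h(2)] by (simp add: S_def)
      finally show ?thesis using h(1) by simp
    qed
    then have "real n * exp (2 * w * (real n * h)) * exp (w * t) * Q (T h y - S y)
      \<le> real n * exp (2 * w * (real n * h)) * exp (w * t) * (h * (2 * E))"
      by (intro mult_left_mono) simp_all
    also have "\<dots> = K * (2 * E)" unfolding K_def h(4)[symmetric] by simp
    finally have "Q (T t y - (S ^^ n) y) \<le> K * (2 * E)"
      using euler_error[OF h(1) hl1 V(1), of n t] h(4) by (simp add: S_def)
    moreover have "K * (2 * E) < K * (4 * E)" using E(1) K by simp
    ultimately have "Q (T t y - (S ^^ n) y) < e" unfolding E(2)[symmetric] by linarith
    moreover have "(S ^^ n) y \<in> V" using SC C by blast
    ultimately have "Q ((S ^^ n) y - T t y) < e"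
      using Q_minus[of "T t y - (S ^^ n) y"] V t by simp
    then show "\<exists>c\<in>C. Q (c - T t y) < e" using SC by blast
  qed
  show ?thesis
  proof (rule approx)
    have xV: "x \<in> V" using x C by auto
    show "T t x \<in> V" using xV t by simp
    fix e :: real assume e: "0 < e"
    then have e': "0 < e / exp (w * t)" by simp
    obtain L where L: "l1 \<le> L" "\<And>l. L \<le> l \<Longrightarrow> Q (l *\<^sub>R R l x - x) < e / exp (w * t)"
      using lR_tendsto[OF xV e'] by blast
    define y where "y = L *\<^sub>R R L x"
    have "y \<in> C" unfolding y_def using l_gt_w[OF L(1)] by (intro scale pos L(1) x) simp
    moreover have "(y, L *\<^sub>R (L *\<^sub>R R L x - x)) \<in> A"
      unfolding y_def by (intro gen_scale R_gen L(1) xV)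
    ultimately have "T t y \<in> C" using dom by blast
    moreover have "Q (T t y - T t x) < e"
    proof -
      have yV: "y \<in> V" using \<open>y \<in> C\<close> C by auto
      have "Q (T t y - T t x) \<le> exp (w * t) * Q (y - x)"
        using Q_T[of t "y - x"] t xV yV by (simp add: T_diff)
      also have "\<dots> < exp (w * t) * (e / exp (w * t))"
        using L(2)[of L] by (intro mult_strict_left_mono) (simp_all add: y_def)
      finally show ?thesis by simp
    qed
    ultimately show "\<exists>c\<in>C. Q (c - T t x) < e" by blast
  qed
qed

end

lemma (in normed_subspace) semigroup_invariant_set:
  assumes C0: "C0_semigroup V N T"
    and surj: "\<And>l y. l0 \<le> l \<Longrightarrow> y \<in> V \<Longrightarrow> \<exists>z. (z, l *\<^sub>R z - y) \<in> generator V N T"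
    and C: "C \<subseteq> V" and scale: "\<And>c x. x \<in> C \<Longrightarrow> 0 \<le> c \<Longrightarrow> c *\<^sub>R x \<in> C"
    and closed: "\<And>f x. (\<And>n. f n \<in> C) \<Longrightarrow> x \<in> V \<Longrightarrow> (\<lambda>n. N (f n - x)) \<longlonglongrightarrow> 0 \<Longrightarrow> x \<in> C"
    and pos: "\<And>l z y. l0 \<le> l \<Longrightarrow> (z, l *\<^sub>R z - y) \<in> generator V N T \<Longrightarrow> y \<in> C \<Longrightarrow> z \<in> C"
    and t: "0 \<le> t" and x: "x \<in> C"
  shows "T t x \<in> C"
proof -
  interpret semigroup_on V N T by unfold_locales (rule C0)
  obtain w M where wM: "0 < w" "1 \<le> M" "\<And>t x. 0 \<le> t \<Longrightarrow> x \<in> V \<Longrightarrow> N (T t x) \<le> M * exp (w * t) * N x"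
    using exponentially_bounded by blast
  interpret resolvent_semigroup V N T w M "max l0 (2 * w)"
    by unfold_locales (use wM surj in auto)
  show ?thesis
  proof (rule invariant_set[OF C scale closed _ t x])
    show "R l x \<in> C" if "max l0 (2 * w) \<le> l" "x \<in> C" for l x
      using pos[OF _ R_gen[OF that(1)]] that C by auto
  qed
qed

section \<open>Strong measurability and integrability\<close>

lemma simple_function_norm_measurable:
  "simple_function M s \<Longrightarrow> (\<lambda>t. norm (s t)) \<in> borel_measurable M"
  by (rule borel_measurable_simple_function) (rule simple_function_compose1)

lemma strongly_measurable_norm_UNIV:
  assumes "strongly_measurable UNIV f"
  shows "(\<lambda>t. norm (f t)) \<in> borel_measurable lebesgue"
proof -
  obtain s where s: "\<And>n::nat. simple_function lebesgue (s n)"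
    and lim: "AE t in lebesgue. (\<lambda>n. s n t) \<longlonglongrightarrow> f t"
    using assms unfolding strongly_measurable_def lebesgue_on_UNIV_eq by blast
  have "AE t in lebesgue. lim (\<lambda>n. norm (s n t)) = norm (f t)"
    using lim by eventually_elim (rule limI, rule tendsto_norm)
  then show ?thesis
    by (rule borel_measurable_AE[OF borel_measurable_lim_metric[OF simple_function_norm_measurable[OF s]]])
qed

lemma strongly_measurable_simple_function:
  "simple_function (lebesgue_on S) f \<Longrightarrow> strongly_measurable S f"
  unfolding strongly_measurable_def by (intro exI[of _ "\<lambda>_. f"]) simp

lemma strongly_measurable_restrict_iff:
  assumes "S \<in> sets lebesgue"
  shows "strongly_measurable UNIV (\<lambda>t. if t \<in> S then f t else 0) \<longleftrightarrow> strongly_measurable S f"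
proof
  have S: "S \<inter> space lebesgue \<in> sets lebesgue" using assms by simp
  assume "strongly_measurable UNIV (\<lambda>t. if t \<in> S then f t else 0)"
  then obtain s where s: "\<And>n::nat. simple_function lebesgue (s n)"
    and lim: "AE t in lebesgue. (\<lambda>n. s n t) \<longlonglongrightarrow> (if t \<in> S then f t else 0)"
    unfolding strongly_measurable_def lebesgue_on_UNIV_eq by blast
  have "simple_function (lebesgue_on S) (s n)" for n
    unfolding simple_function_restrict_space[OF S]
    by (intro simple_function_compose2[of _ "indicator S" "s n" scaleR] s simple_function_indicator assms)
  moreover have "AE t in lebesgue_on S. (\<lambda>n. s n t) \<longlonglongrightarrow> f t"
    unfolding AE_restrict_space_iff[OF S] using lim by eventually_elim auto
  ultimately show "strongly_measurable S f" unfolding strongly_measurable_def by blast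
next
  have S: "S \<inter> space lebesgue \<in> sets lebesgue" using assms by simp
  assume "strongly_measurable S f"
  then obtain s where s: "\<And>n::nat. simple_function (lebesgue_on S) (s n)"
    and lim: "AE t in lebesgue_on S. (\<lambda>n. s n t) \<longlonglongrightarrow> f t"
    unfolding strongly_measurable_def by blast
  have "simple_function (lebesgue_on UNIV) (\<lambda>t. indicator S t *\<^sub>R s n t)" for n
    using s[of n] unfolding simple_function_restrict_space[OF S] lebesgue_on_UNIV_eq .
  moreover have "AE t in lebesgue_on UNIV. (\<lambda>n. indicator S t *\<^sub>R s n t) \<longlonglongrightarrow> (if t \<in> S then f t else 0)"
    using lim unfolding AE_restrict_space_iff[OF S] lebesgue_on_UNIV_eq
    by eventually_elim (simp add: indicator_def)
  ultimately show "strongly_measurable UNIV (\<lambda>t. if t \<in> S then f t else 0)"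
    unfolding strongly_measurable_def by (intro exI[of _ "\<lambda>n t. indicator S t *\<^sub>R s n t"]) blast
qed

lemma strongly_measurable_norm:
  assumes "S \<in> sets lebesgue" "strongly_measurable S f"
  shows "(\<lambda>t. norm (f t)) \<in> borel_measurable (lebesgue_on S)"
proof -
  have S: "S \<inter> space lebesgue \<in> sets lebesgue" using assms(1) by simp
  have "(\<lambda>t. norm (if t \<in> S then f t else 0)) \<in> borel_measurable lebesgue"
    using assms by (intro strongly_measurable_norm_UNIV) (simp add: strongly_measurable_restrict_iff)
  moreover have "norm (if t \<in> S then f t else 0) = indicat_real S t *\<^sub>R norm (f t)" for t
    by (simp add: indicator_def)
  ultimately show ?thesis unfolding borel_measurable_restrict_space_iff[OF S] by simp
qed

lemma integrable_const_interval: "integrable (lebesgue_on {a..b::real}) (\<lambda>_. c::real)"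
proof -
  interpret finite_measure "lebesgue_on {a..b}" by (rule finite_measure_lebesgue_on) simp
  show ?thesis by (rule integrable_const)
qed

lemma Lp_fun_restrict_iff:
  assumes "S \<in> sets lebesgue"
  shows "Lp_fun p UNIV (\<lambda>t. if t \<in> S then f t else 0) \<longleftrightarrow> Lp_fun p S f"
proof -
  have S: "S \<inter> space lebesgue \<in> sets lebesgue" using assms by simp
  have "integrable lebesgue (\<lambda>t. norm (if t \<in> S then f t else 0) powr p)
    \<longleftrightarrow> integrable (lebesgue_on S) (\<lambda>t. norm (f t) powr p)"
    unfolding integrable_restrict_space[OF S]
    by (intro Bochner_Integration.integrable_cong) (auto simp: indicator_def)
  then show ?thesis
    unfolding Lp_fun_def strongly_measurable_restrict_iff[OF assms] lebesgue_on_UNIV_eq by simp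
qed

lemma continuous_imp_strongly_measurable:
  fixes f :: "real \<Rightarrow> 'x::real_normed_vector"
  assumes f: "continuous_on {a..b} f"
  shows "strongly_measurable {a..b} f"
proof -
  \<comment> \<open>Rounding down to the grid of width \<open>1 / Suc n\<close> takes finitely many
    values on the interval; the maximum with \<open>a\<close> prevents the sample point from leaving
    it on the left.\<close>
  define g where "g n t = max a (real_of_int \<lfloor>real (Suc n) * t\<rfloor> / real (Suc n))" for n t
  have g_le: "g n t \<in> {a..b}" "\<bar>g n t - t\<bar> \<le> 1 / real (Suc n)" if "t \<in> {a..b}" for n t
  proof -
    have "real_of_int \<lfloor>real (Suc n) * t\<rfloor> \<le> real (Suc n) * t"
      "real (Suc n) * t < real_of_int \<lfloor>real (Suc n) * t\<rfloor> + 1" by linarith+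
    then have "real_of_int \<lfloor>real (Suc n) * t\<rfloor> / real (Suc n) \<le> t"
      "t \<le> real_of_int \<lfloor>real (Suc n) * t\<rfloor> / real (Suc n) + 1 / real (Suc n)"
      by (simp_all add: field_simps)
    then show "g n t \<in> {a..b}" "\<bar>g n t - t\<bar> \<le> 1 / real (Suc n)" using that by (auto simp: g_def max_def)
  qed
  have "simple_function (lebesgue_on {a..b}) (g n)" for n
  proof (rule simple_function_borel_measurable)
    have "g n \<in> borel_measurable borel" unfolding g_def by measurable
    then show "g n \<in> borel_measurable (lebesgue_on {a..b})"
      by (intro measurable_restrict_space1 measurable_completion) simp
    have "g n ` {a..b} \<subseteq> (\<lambda>i. max a (real_of_int i / real (Suc n))) ` {\<lfloor>real (Suc n) * a\<rfloor>..\<lfloor>real (Suc n) * b\<rfloor>}"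
      unfolding g_def by (auto intro!: imageI floor_mono mult_left_mono)
    then show "finite (g n ` space (lebesgue_on {a..b}))"
      by (simp add: space_restrict_space) (meson finite_atLeastAtMost_int finite_imageI finite_subset)
  qed
  then have "simple_function (lebesgue_on {a..b}) (\<lambda>t. f (g n t))" for n
    by (rule simple_function_compose1)
  moreover have "(\<lambda>n. f (g n t)) \<longlonglongrightarrow> f t" if t: "t \<in> {a..b}" for t
  proof -
    have "(\<lambda>n. g n t - t) \<longlonglongrightarrow> 0"
      by (rule Lim_null_comparison[OF _ LIMSEQ_Suc[OF lim_1_over_n]])
        (use g_le(2)[OF t] in \<open>simp add: always_eventually\<close>)
    then have "(\<lambda>n. g n t) \<longlonglongrightarrow> t" by (simp add: LIM_zero_iff)
    then show ?thesis using f g_le(1) t unfolding continuous_on_sequentially by (auto simp: o_def)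
  qed
  then have "AE t in lebesgue_on {a..b}. (\<lambda>n. f (g n t)) \<longlonglongrightarrow> f t"
    by (intro AE_I2) (simp add: space_restrict_space)
  ultimately show ?thesis
    unfolding strongly_measurable_def by (intro exI[of _ "\<lambda>n t. f (g n t)"]) blast
qed

lemma simple_function_L1_approximation:
  fixes f :: "real \<Rightarrow> 'x::real_normed_vector"
  assumes f: "strongly_measurable UNIV f" and int: "integrable lebesgue (\<lambda>t. norm (f t))" and e: "0 < e"
  shows "\<exists>s. simple_function lebesgue s \<and> integrable lebesgue (\<lambda>t. norm (s t)) \<and>
    integrable lebesgue (\<lambda>t. norm (f t - s t)) \<and> integral\<^sup>L lebesgue (\<lambda>t. norm (f t - s t)) < e"
proof -
  obtain s where s: "\<And>n::nat. simple_function lebesgue (s n)"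
    and lim: "AE t in lebesgue. (\<lambda>n. s n t) \<longlonglongrightarrow> f t"
    using f unfolding strongly_measurable_def lebesgue_on_UNIV_eq by blast
  \<comment> \<open>The approximants are set to 0 where they exceed twice the norm of
    \<open>f\<close>, so that \<open>3 * norm (f t)\<close> dominates the error. Where
    \<open>f t\<close> is nonzero the cut is eventually inactive; where it is zero the truncated
    values vanish.\<close>
  define A where "A n = {t. norm (s n t) \<le> 2 * norm (f t)}" for n
  define r where "r n t = (if t \<in> A n then s n t else 0)" for n t
  have mf: "(\<lambda>t. norm (f t)) \<in> borel_measurable lebesgue"
    by (rule strongly_measurable_norm_UNIV[OF f])
  have A: "A n \<inter> space lebesgue \<in> sets lebesgue" for n
  proof -
    have "{t \<in> space lebesgue. norm (s n t) \<le> 2 * norm (f t)} \<in> sets lebesgue"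
      by (intro borel_measurable_le simple_function_norm_measurable s borel_measurable_times mf) simp
    then show ?thesis by (simp add: A_def)
  qed
  have r: "simple_function lebesgue (r n)" for n
    unfolding r_def by (rule simple_function_If_set[OF s _ A]) simp
  have bound: "norm (r n t) \<le> 2 * norm (f t)" for n t by (simp add: r_def A_def)
  have meas: "(\<lambda>t. norm (f t - r n t)) \<in> borel_measurable lebesgue" for n
    using r[of n] by (intro strongly_measurable_norm_UNIV strongly_measurable_diff f
        strongly_measurable_simple_function) (simp add: lebesgue_on_UNIV_eq)
  have lim': "AE t in lebesgue. (\<lambda>n. norm (f t - r n t)) \<longlonglongrightarrow> 0"
    using lim
  proof eventually_elim
    case (elim t)
    have "(\<lambda>n. r n t) \<longlonglongrightarrow> f t"
    proof (cases "f t = 0")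
      case True
      then have "r n t = 0" for n using bound[of n t] by simp
      then show ?thesis using True by simp
    next
      case False
      have "(\<lambda>n. norm (s n t)) \<longlonglongrightarrow> norm (f t)" using elim by (rule tendsto_norm)
      from order_tendstoD(2)[OF this, of "2 * norm (f t)"]
      have ev: "\<forall>\<^sub>F n in sequentially. s n t = r n t"
        using False by (auto simp: r_def A_def elim: eventually_mono)
      show ?thesis by (rule Lim_transform_eventually[OF elim ev])
    qed
    then have "(\<lambda>n. norm (f t - r n t)) \<longlonglongrightarrow> norm (f t - f t)" by (intro tendsto_intros)
    then show ?case by simp
  qed
  have dom: "AE t in lebesgue. norm (norm (f t - r n t)) \<le> 3 * norm (f t)" for n
  proof -
    have "norm (f t - r n t) \<le> 3 * norm (f t)" for t
      using norm_triangle_ineq4[of "f t" "r n t"] bound[of n t] by linarith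
    then show ?thesis by (intro AE_I2) simp
  qed
  have int3: "integrable lebesgue (\<lambda>t. 3 * norm (f t))" using int by simp
  have zero: "(\<lambda>t::real. 0::real) \<in> borel_measurable lebesgue" by simp
  have "(\<lambda>n. integral\<^sup>L lebesgue (\<lambda>t. norm (f t - r n t))) \<longlonglongrightarrow> integral\<^sup>L lebesgue (\<lambda>t::real. 0::real)"
    by (rule integral_dominated_convergence[where w = "\<lambda>t. 3 * norm (f t)" and
          s = "\<lambda>n t. norm (f t - r n t)"]) (fact zero meas int3 lim' dom)+
  then have "\<forall>\<^sub>F n in sequentially. integral\<^sup>L lebesgue (\<lambda>t. norm (f t - r n t)) < e"
    using e by (intro order_tendstoD(2)) simp_all
  then obtain n where n: "integral\<^sup>L lebesgue (\<lambda>t. norm (f t - r n t)) < e"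
    using eventually_happens'[OF sequentially_bot] by blast
  moreover have "integrable lebesgue (\<lambda>t. norm (f t - r n t))"
    by (rule Bochner_Integration.integrable_bound[OF int3 meas]) (use dom in auto)
  moreover have "integrable lebesgue (\<lambda>t. norm (r n t))"
    by (rule Bochner_Integration.integrable_bound[of _ "\<lambda>t. 2 * norm (f t)"])
      (use int bound simple_function_norm_measurable[OF r] in auto)
  ultimately show ?thesis using r by blast
qed

lemma simple_function_integrable_on:
  fixes s :: "real \<Rightarrow> 'x::real_normed_vector"
  assumes s: "simple_function lebesgue s"
  shows "s integrable_on {a..b}"
proof -
  have fin: "finite (range s)" using s by (simp add: simple_function_def)
  have "(\<lambda>t. \<Sum>v\<in>range s. indicator (s -` {v}) t *\<^sub>R v) integrable_on {a..b}"
  proof (intro integrable_sum fin)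
    fix v assume "v \<in> range s"
    then have "s -` {v} \<in> sets lebesgue" using s by (auto simp: simple_function_def)
    then have "s -` {v} \<inter> {a..b} \<in> lmeasurable"
      by (intro bounded_set_imp_lmeasurable) (auto intro: bounded_subset[of "{a..b}"])
    then have "indicat_real (s -` {v}) integrable_on {a..b}" by (simp add: integrable_on_indicator)
    from integrable_linear[OF this bounded_linear_scaleR_left[of v]]
    show "(\<lambda>t. indicator (s -` {v}) t *\<^sub>R v) integrable_on {a..b}" by (simp add: o_def)
  qed
  moreover have "(\<Sum>v\<in>range s. indicator (s -` {v}) t *\<^sub>R v) = s t" for t
  proof -
    have "(\<Sum>v\<in>range s. indicator (s -` {v}) t *\<^sub>R v) = (\<Sum>v\<in>range s. if v = s t then v else 0)"
      by (intro sum.cong) (auto simp: indicator_def)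
    then show ?thesis using fin by simp
  qed
  ultimately show ?thesis by simp
qed

text \<open>Riemann sums of \<open>f - s\<close> are dominated by those of \<open>norm (f - s)\<close>, which are close to its
  Lebesgue integral; hence an approximation in \<open>L\<^sup>1\<close> by simple functions suffices.\<close>

lemma strongly_measurable_integrable_on:
  fixes f :: "real \<Rightarrow> 'x::banach"
  assumes f: "strongly_measurable UNIV f" and int: "integrable lebesgue (\<lambda>t. norm (f t))"
  shows "f integrable_on {a..b}"
proof -
  have "f integrable_on cbox a b"
    unfolding integrable_Cauchy
  proof (intro allI impI)
    fix e :: real assume e: "0 < e"
    then have e8: "0 < e / 8" by simp
    obtain s where s: "simple_function lebesgue s" and k_int: "integrable lebesgue (\<lambda>t. norm (f t - s t))"
      and k_small: "integral\<^sup>L lebesgue (\<lambda>t. norm (f t - s t)) < e / 8"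
      using simple_function_L1_approximation[OF f int e8] by blast
    define k where "k t = norm (f t - s t)" for t
    have kU: "(k has_integral integral\<^sup>L lebesgue k) UNIV"
      using has_integral_integral_lebesgue[OF k_int] by (simp add: k_def[abs_def])
    then have k_on: "k integrable_on cbox a b"
      by (intro integrable_on_subcbox[of k UNIV]) auto
    have "integral (cbox a b) k \<le> integral UNIV k"
      using kU k_on by (intro integral_subset_le) (auto simp: k_def)
    then have k8: "integral (cbox a b) k < e / 8"
      using k_small integral_unique[OF kU] by (simp add: k_def[abs_def])
    obtain g1 where g1: "gauge g1" "\<And>D. D tagged_division_of cbox a b \<Longrightarrow> g1 fine D \<Longrightarrow>
        norm ((\<Sum>(x, K)\<in>D. measure lborel K *\<^sub>R k x) - integral (cbox a b) k) < e / 8"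
      using has_integralD[OF integrable_integral[OF k_on] e8] by blast
    have s_on: "s integrable_on cbox a b" using simple_function_integrable_on[OF s, of a b] by simp
    obtain g2 where g2: "gauge g2" "\<And>D. D tagged_division_of cbox a b \<Longrightarrow> g2 fine D \<Longrightarrow>
        norm ((\<Sum>(x, K)\<in>D. measure lborel K *\<^sub>R s x) - integral (cbox a b) s) < e / 8"
      using has_integralD[OF integrable_integral[OF s_on] e8] by blast
    have close: "norm ((\<Sum>(x, K)\<in>D. measure lborel K *\<^sub>R f x) - integral (cbox a b) s) < 3 * e / 8"
      if D: "D tagged_division_of cbox a b" "(\<lambda>x. g1 x \<inter> g2 x) fine D" for D
    proof -
      have fine: "g1 fine D" "g2 fine D" using D(2) by (auto simp: fine_def)
      have "norm ((\<Sum>(x, K)\<in>D. measure lborel K *\<^sub>R f x) - (\<Sum>(x, K)\<in>D. measure lborel K *\<^sub>R s x))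
          = norm (\<Sum>(x, K)\<in>D. measure lborel K *\<^sub>R (f x - s x))"
        by (simp add: case_prod_beta' sum_subtractf scaleR_diff_right)
      also have "\<dots> \<le> (\<Sum>(x, K)\<in>D. measure lborel K *\<^sub>R k x)"
        unfolding case_prod_beta' by (intro sum_norm_le) (simp add: k_def)
      also have "\<dots> < e / 4"
        using g1(2)[OF D(1) fine(1)] k8 unfolding real_norm_def by linarith
      finally have "norm ((\<Sum>(x, K)\<in>D. measure lborel K *\<^sub>R f x) - (\<Sum>(x, K)\<in>D. measure lborel K *\<^sub>R s x)) < e / 4" .
      from norm_diff_triangle_less[OF this g2(2)[OF D(1) fine(2)]] show ?thesis by simp
    qed
    show "\<exists>\<gamma>. gauge \<gamma> \<and> (\<forall>D1 D2. D1 tagged_division_of cbox a b \<and> \<gamma> fine D1 \<and>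
        D2 tagged_division_of cbox a b \<and> \<gamma> fine D2 \<longrightarrow>
        norm ((\<Sum>(x, K)\<in>D1. measure lborel K *\<^sub>R f x) - (\<Sum>(x, K)\<in>D2. measure lborel K *\<^sub>R f x)) < e)"
    proof (intro exI[of _ "\<lambda>x. g1 x \<inter> g2 x"] conjI allI impI gauge_Int g1(1) g2(1))
      fix D1 D2 assume D: "D1 tagged_division_of cbox a b \<and> (\<lambda>x. g1 x \<inter> g2 x) fine D1 \<and>
        D2 tagged_division_of cbox a b \<and> (\<lambda>x. g1 x \<inter> g2 x) fine D2"
      have "norm ((\<Sum>(x, K)\<in>D1. measure lborel K *\<^sub>R f x) - integral (cbox a b) s) < 3 * e / 8"
        using D by (intro close) auto
      moreover have "norm (integral (cbox a b) s - (\<Sum>(x, K)\<in>D2. measure lborel K *\<^sub>R f x)) < 3 * e / 8"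
        using close[of D2] D by (subst norm_minus_commute) auto
      ultimately have "norm ((\<Sum>(x, K)\<in>D1. measure lborel K *\<^sub>R f x) - (\<Sum>(x, K)\<in>D2. measure lborel K *\<^sub>R f x))
          < 3 * e / 8 + 3 * e / 8" by (rule norm_diff_triangle_less)
      then show "norm ((\<Sum>(x, K)\<in>D1. measure lborel K *\<^sub>R f x) - (\<Sum>(x, K)\<in>D2. measure lborel K *\<^sub>R f x)) < e"
        using e by simp
    qed
  qed
  then show ?thesis by simp
qed

lemma le_one_plus_powr: "0 \<le> x \<Longrightarrow> 1 \<le> p \<Longrightarrow> x \<le> 1 + x powr p" for x p :: real
proof (cases "x \<le> 1")
  case False
  assume "1 \<le> p"
  then have "x powr 1 \<le> x powr p" using False by (intro powr_mono) auto
  then show ?thesis using False by simp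
next
  case True
  have "0 \<le> x powr p" by simp
  then show ?thesis using True by linarith
qed

lemma Lp_fun_norm_integrable:
  assumes p: "1 \<le> p" and f: "Lp_fun p {a..b} f"
  shows "integrable (lebesgue_on {a..b}) (\<lambda>t. norm (f t))"
proof (rule Bochner_Integration.integrable_bound)
  show "integrable (lebesgue_on {a..b}) (\<lambda>t. 1 + norm (f t) powr p)"
    using f by (intro Bochner_Integration.integrable_add integrable_const_interval) (simp add: Lp_fun_def)
  show "(\<lambda>t. norm (f t)) \<in> borel_measurable (lebesgue_on {a..b})"
    using f by (intro strongly_measurable_norm) (simp_all add: Lp_fun_def)
  show "AE t in lebesgue_on {a..b}. norm (norm (f t)) \<le> norm (1 + norm (f t) powr p)"
    using le_one_plus_powr[OF norm_ge_zero p] by (intro AE_I2) simp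
qed

lemma Lp_fun_integrable_on:
  fixes f :: "real \<Rightarrow> 'x::banach"
  assumes p: "1 \<le> p" and f: "Lp_fun p {a..b} f"
  shows "f integrable_on {a..b}"
proof -
  have S: "{a..b} \<in> sets lebesgue" "{a..b} \<inter> space lebesgue \<in> sets lebesgue" by auto
  have "(\<lambda>t. if t \<in> {a..b} then f t else 0) integrable_on {a..b}"
  proof (rule strongly_measurable_integrable_on)
    show "strongly_measurable UNIV (\<lambda>t. if t \<in> {a..b} then f t else 0)"
      using f unfolding strongly_measurable_restrict_iff[OF S(1)] Lp_fun_def by simp
    have eq: "(\<lambda>t. norm (if t \<in> {a..b} then f t else 0)) = (\<lambda>t. indicat_real {a..b} t *\<^sub>R norm (f t))"
      by (auto simp: fun_eq_iff indicator_def)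
    show "integrable lebesgue (\<lambda>t. norm (if t \<in> {a..b} then f t else 0))"
      unfolding eq using Lp_fun_norm_integrable[OF assms] unfolding integrable_restrict_space[OF S(2)] .
  qed
  then show ?thesis by (rule integrable_eq) simp
qed

section \<open>Closure properties of p-integrable functions\<close>

lemma powr_add_le:
  fixes x y :: real
  assumes "0 \<le> x" "0 \<le> y" "0 \<le> p"
  shows "(x + y) powr p \<le> 2 powr p * (x powr p + y powr p)"
proof -
  have "(x + y) powr p \<le> (2 * max x y) powr p" using assms by (intro powr_mono2) auto
  also have "\<dots> = 2 powr p * max x y powr p" using assms by (intro powr_mult)
  also have "\<dots> \<le> 2 powr p * (x powr p + y powr p)"
    by (intro mult_left_mono) (auto simp: max_def)
  finally show ?thesis .
qed

lemma Lp_fun_add: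
  assumes S: "S \<in> sets lebesgue" and p: "1 \<le> p" and f: "Lp_fun p S f" and g: "Lp_fun p S g"
  shows "Lp_fun p S (\<lambda>t. f t + g t)"
proof -
  have sm: "strongly_measurable S (\<lambda>t. f t + g t)"
    using f g by (intro strongly_measurable_add) (simp_all add: Lp_fun_def)
  have "integrable (lebesgue_on S) (\<lambda>t. norm (f t + g t) powr p)"
  proof (rule Bochner_Integration.integrable_bound)
    show "integrable (lebesgue_on S) (\<lambda>t. 2 powr p * (norm (f t) powr p + norm (g t) powr p))"
      using f g by (simp add: Lp_fun_def)
    show "(\<lambda>t. norm (f t + g t) powr p) \<in> borel_measurable (lebesgue_on S)"
      using strongly_measurable_norm[OF S sm] by (intro powr_real_measurable) simp_all
    have "norm (f t + g t) powr p \<le> 2 powr p * (norm (f t) powr p + norm (g t) powr p)" for t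
    proof -
      have "norm (f t + g t) powr p \<le> (norm (f t) + norm (g t)) powr p"
        using p by (intro powr_mono2 norm_triangle_ineq) simp_all
      also have "\<dots> \<le> 2 powr p * (norm (f t) powr p + norm (g t) powr p)"
        using p by (intro powr_add_le) simp_all
      finally show ?thesis .
    qed
    then show "AE t in lebesgue_on S. norm (norm (f t + g t) powr p)
        \<le> norm (2 powr p * (norm (f t) powr p + norm (g t) powr p))"
      by (intro AE_I2) simp
  qed
  then show ?thesis using sm by (simp add: Lp_fun_def)
qed

lemma Lp_fun_scaleR:
  assumes f: "Lp_fun p S f"
  shows "Lp_fun p S (\<lambda>t. c *\<^sub>R f t)"
proof -
  have "norm (c *\<^sub>R f t) powr p = \<bar>c\<bar> powr p * norm (f t) powr p" for t
    by (simp add: powr_mult)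
  then show ?thesis using f by (simp add: Lp_fun_def strongly_measurable_scaleR)
qed

lemma Lp_fun_diff:
  "S \<in> sets lebesgue \<Longrightarrow> 1 \<le> p \<Longrightarrow> Lp_fun p S f \<Longrightarrow> Lp_fun p S g \<Longrightarrow> Lp_fun p S (\<lambda>t. f t - g t)"
  using Lp_fun_add[of S p f "\<lambda>t. (-1) *\<^sub>R g t"] Lp_fun_scaleR[of p S g "-1"] by simp

lemma continuous_imp_Lp_fun:
  fixes f :: "real \<Rightarrow> 'x::real_normed_vector"
  assumes f: "continuous_on {a..b} f" and p: "0 \<le> p"
  shows "Lp_fun p {a..b} f"
proof -
  have sm: "strongly_measurable {a..b} f" by (rule continuous_imp_strongly_measurable[OF f])
  have "bounded (f ` {a..b})" by (intro compact_imp_bounded compact_continuous_image f) simp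
  then obtain B where "\<forall>x\<in>f ` {a..b}. norm x \<le> B" unfolding bounded_iff by blast
  then have B: "norm (f t) \<le> B" if "t \<in> {a..b}" for t using that by blast
  have "integrable (lebesgue_on {a..b}) (\<lambda>t. norm (f t) powr p)"
  proof (rule Bochner_Integration.integrable_bound)
    show "integrable (lebesgue_on {a..b}) (\<lambda>t. B powr p)"
      by (rule integrable_const_interval)
    show "(\<lambda>t. norm (f t) powr p) \<in> borel_measurable (lebesgue_on {a..b})"
      using strongly_measurable_norm[OF _ sm] by (intro powr_real_measurable) simp_all
    show "AE t in lebesgue_on {a..b}. norm (norm (f t) powr p) \<le> norm (B powr p)"
      by (intro AE_I2) (use B p in \<open>auto simp: space_restrict_space intro!: powr_mono2\<close>)
  qed
  then show ?thesis using sm by (simp add: Lp_fun_def)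
qed

lemma AE_lebesgue_on_negligible:
  assumes "AE t in lebesgue_on S. P t" "S \<in> sets lebesgue"
  shows "negligible {t \<in> S. \<not> P t}"
proof -
  have "AE t in lebesgue. t \<in> S \<longrightarrow> P t"
    using assms by (subst (asm) AE_restrict_space_iff) auto
  then obtain N where "\<And>t. t \<in> space lebesgue - N \<Longrightarrow> t \<in> S \<longrightarrow> P t" "N \<in> null_sets lebesgue"
    by (rule AE_E3) blast
  then show ?thesis
    using negligible_subset[of N "{t \<in> S. \<not> P t}"] by (auto simp: negligible_iff_null_sets)
qed

section \<open>Integrals in Banach lattices\<close>

text \<open>Riemann sums are positive combinations of values of \<open>f\<close>, and the positive
  cone is closed.\<close>

lemma has_integral_nonneg_lattice:
  fixes f :: "real \<Rightarrow> 'x::banach_lattice"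
  assumes I: "(f has_integral I) {a..b}" and f: "\<And>t. t \<in> {a..b} \<Longrightarrow> 0 \<le> f t"
  shows "0 \<le> I"
proof -
  have "\<exists>s. 0 \<le> s \<and> norm (s - I) < 1 / real (Suc n)" for n
  proof -
    have e: "0 < 1 / real (Suc n)" by simp
    have "(f has_integral I) (cbox a b)" using I by simp
    from has_integralD[OF this e] obtain g where g: "gauge g"
      "\<And>D. D tagged_division_of cbox a b \<Longrightarrow> g fine D \<Longrightarrow>
        norm ((\<Sum>(x, K)\<in>D. measure lborel K *\<^sub>R f x) - I) < 1 / real (Suc n)"
      by blast
    obtain D where D: "D tagged_division_of {a..b}" "g fine D"
      using fine_division_exists_real[OF g(1)] by blast
    have "0 \<le> (\<Sum>(x, K)\<in>D. measure lborel K *\<^sub>R f x)"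
    proof (rule sum_nonneg, safe)
      fix x K assume "(x, K) \<in> D"
      then have "x \<in> {a..b}" using tagged_division_ofD(2,3)[OF D(1)] by blast
      then show "0 \<le> measure lborel K *\<^sub>R f x" by (intro scaleR_nonneg_nonneg f) simp_all
    qed
    then show ?thesis using g(2)[of D] D by auto
  qed
  then obtain s where s: "\<And>n. 0 \<le> s n" "\<And>n. norm (s n - I) < 1 / real (Suc n)" by metis
  have "(\<lambda>n. s n - I) \<longlonglongrightarrow> 0"
    by (rule Lim_null_comparison[OF _ LIMSEQ_Suc[OF lim_1_over_n]])
      (use s(2) in \<open>simp add: always_eventually less_imp_le\<close>)
  then have "s \<longlonglongrightarrow> I" by (simp add: LIM_zero_iff)
  then show ?thesis using s(1) by (rule LIMSEQ_nonneg_lattice)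
qed

lemma integral_mono_lattice:
  fixes f g :: "real \<Rightarrow> 'x::banach_lattice"
  assumes "f integrable_on {a..b}" "g integrable_on {a..b}" "\<And>t. t \<in> {a..b} \<Longrightarrow> f t \<le> g t"
  shows "integral {a..b} f \<le> integral {a..b} g"
  using has_integral_nonneg_lattice[OF has_integral_diff[OF integrable_integral[OF assms(2)]
        integrable_integral[OF assms(1)]]] assms(3) by simp

lemma integral_nonneg_AE_lattice:
  fixes f :: "real \<Rightarrow> 'x::banach_lattice"
  assumes f: "f integrable_on {a..b}" and AE: "AE t in lebesgue_on {a..b}. 0 \<le> f t"
  shows "0 \<le> integral {a..b} f"
proof -
  have "((\<lambda>t. if 0 \<le> f t then f t else 0) has_integral integral {a..b} f) {a..b}"
    by (rule has_integral_spike[OF AE_lebesgue_on_negligible[OF AE lmeasurable_interval(1)[THEN fmeasurableD]] _ integrable_integral[OF f]]) auto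
  then show ?thesis by (rule has_integral_nonneg_lattice) simp
qed

section \<open>The equation \<open>l \<phi> - \<phi>' = \<psi>\<close> with \<open>\<phi> 0 = 0\<close>\<close>

text \<open>Since \<open>\<psi>\<close> is only in \<open>L\<^sup>p\<close>, the solution formula is integrated by parts, so that only the
  continuous primitive \<open>t \<mapsto> integral {t..0} \<psi>\<close> is differentiated or multiplied by exponentials.\<close>

definition shift_solution :: "real \<Rightarrow> (real \<Rightarrow> 'x::banach) \<Rightarrow> real \<Rightarrow> 'x" where
  "shift_solution l \<psi> t = integral {t..0} \<psi> -
    l *\<^sub>R (exp (l * t) *\<^sub>R integral {t..0} (\<lambda>s. exp (- l * s) *\<^sub>R integral {s..0} \<psi>))"

lemma integral_right_part:
  fixes f :: "real \<Rightarrow> 'x::banach"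
  assumes "f integrable_on {a..b}" "t \<in> {a..b}"
  shows "integral {t..b} f = integral {a..b} f - integral {a..t} f"
  using Henstock_Kurzweil_Integration.integral_combine[of a t b f] assms by (simp add: algebra_simps)

lemma continuous_on_integral_right:
  fixes f :: "real \<Rightarrow> 'x::banach"
  assumes "f integrable_on {a..b}"
  shows "continuous_on {a..b} (\<lambda>t. integral {t..b} f)"
proof -
  have "continuous_on {a..b} (\<lambda>t. integral {a..b} f - integral {a..t} f)"
    by (intro continuous_intros indefinite_integral_continuous_1 assms)
  then show ?thesis by (rule continuous_on_eq) (rule integral_right_part[OF assms, symmetric])
qed

lemma W1p_deriv_continuous:
  assumes p: "1 \<le> p" and f: "W1p_deriv p a b f g"
  shows "continuous_on {a..b} f"
proof -
  have "g integrable_on {a..b}" using f unfolding W1p_deriv_def by (intro Lp_fun_integrable_on[OF p]) blast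
  then have "continuous_on {a..b} (\<lambda>t. f a + integral {a..t} g)"
    by (intro continuous_intros indefinite_integral_continuous_1)
  then show ?thesis by (rule continuous_on_eq) (use f in \<open>unfold W1p_deriv_def, metis\<close>)
qed

lemma W1p_deriv_exp:
  assumes p: "1 \<le> p"
  shows "W1p_deriv p (-1) 0 (\<lambda>t. exp (l * t) *\<^sub>R x) (\<lambda>t. (l * exp (l * t)) *\<^sub>R x)"
  unfolding W1p_deriv_def
proof (intro conjI ballI)
  show "Lp_fun p {-1..0} (\<lambda>t. (l * exp (l * t)) *\<^sub>R x)"
    using p by (intro continuous_imp_Lp_fun continuous_intros) simp
  fix t :: real assume t: "t \<in> {-1..0}"
  have "((\<lambda>t. exp (l * t) *\<^sub>R x) has_vector_derivative (l * exp (l * s)) *\<^sub>R x) (at s within {-1..t})" for s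
    by (auto intro!: derivative_eq_intros)
  then have "((\<lambda>t. (l * exp (l * t)) *\<^sub>R x) has_integral (exp (l * t) *\<^sub>R x - exp (l * (-1)) *\<^sub>R x)) {-1..t}"
    using t by (intro fundamental_theorem_of_calculus) auto
  then show "exp (l * t) *\<^sub>R x = exp (l * (-1)) *\<^sub>R x + integral {-1..t} (\<lambda>t. (l * exp (l * t)) *\<^sub>R x)"
    by (simp add: integral_unique)
qed

lemma shift_solution_0 [simp]: "shift_solution l \<psi> 0 = 0"
  by (simp add: shift_solution_def)

text \<open>The function is \<open>\<Psi> - l Y\<close> with \<open>Y' = l Y - \<Psi>\<close> in the
  classical sense, while \<Psi> has the weak derivative \<open>- \<psi>\<close>. Hence its weak
  derivative is \<open>l (\<Psi> - l Y) - \<psi>\<close>.\<close>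

lemma shift_solution_W1p:
  fixes \<psi> :: "real \<Rightarrow> 'x::banach"
  assumes p: "1 \<le> p" and \<psi>: "Lp_fun p {-1..0} \<psi>"
  shows "W1p_deriv p (-1) 0 (shift_solution l \<psi>) (\<lambda>t. l *\<^sub>R shift_solution l \<psi> t - \<psi> t)"
proof -
  define \<Psi> where "\<Psi> t = integral {t..0} \<psi>" for t
  define h where "h s = exp (- l * s) *\<^sub>R \<Psi> s" for s
  define Y where "Y t = exp (l * t) *\<^sub>R integral {t..0} h" for t
  have \<psi>_int: "\<psi> integrable_on {-1..0}" by (rule Lp_fun_integrable_on[OF p \<psi>])
  have \<Psi>_cont: "continuous_on {-1..0} \<Psi>" unfolding \<Psi>_def by (rule continuous_on_integral_right[OF \<psi>_int])
  have h_cont: "continuous_on {-1..0} h" unfolding h_def by (intro continuous_intros \<Psi>_cont)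
  have h_int: "h integrable_on {-1..0}" by (rule integrable_continuous_real[OF h_cont])
  have Y_cont: "continuous_on {-1..0} Y"
    unfolding Y_def by (intro continuous_intros continuous_on_integral_right h_int)
  have E: "shift_solution l \<psi> t = \<Psi> t - l *\<^sub>R Y t" for t
    by (simp add: shift_solution_def \<Psi>_def Y_def h_def[abs_def])
  have E_cont: "continuous_on {-1..0} (shift_solution l \<psi>)"
    unfolding E by (intro continuous_intros \<Psi>_cont Y_cont)
  have Y_deriv: "(Y has_vector_derivative l *\<^sub>R Y t - \<Psi> t) (at t within {-1..0})" if t: "t \<in> {-1..0}" for t
  proof -
    have "((\<lambda>t. integral {-1..0} h - integral {-1..t} h) has_vector_derivative 0 - h t) (at t within {-1..0})"
      by (intro has_vector_derivative_diff has_vector_derivative_const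
          integral_has_vector_derivative h_cont t)
    note d = this
    have "((\<lambda>t. integral {t..0} h) has_vector_derivative 0 - h t) (at t within {-1..0})"
      by (rule has_vector_derivative_transform[OF t _ d]) (rule integral_right_part[OF h_int])
    then have "((\<lambda>t. exp (l * t) *\<^sub>R integral {t..0} h) has_vector_derivative
        exp (l * t) *\<^sub>R (0 - h t) + (l * exp (l * t)) *\<^sub>R integral {t..0} h) (at t within {-1..0})"
      by (intro has_vector_derivative_scaleR) (auto intro!: derivative_eq_intros)
    moreover have "exp (l * t) *\<^sub>R (0 - h t) + (l * exp (l * t)) *\<^sub>R integral {t..0} h = l *\<^sub>R Y t - \<Psi> t"
      by (simp add: h_def Y_def exp_minus)
    ultimately show ?thesis unfolding Y_def[abs_def] by simp
  qed
  show ?thesis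
    unfolding W1p_deriv_def
  proof (intro conjI ballI)
    show "Lp_fun p {-1..0} (\<lambda>t. l *\<^sub>R shift_solution l \<psi> t - \<psi> t)"
      using p by (intro Lp_fun_diff \<psi> continuous_imp_Lp_fun continuous_intros E_cont) simp_all
    fix t :: real assume t: "t \<in> {-1..0}"
    have sub: "{-1..t} \<subseteq> {-1..0}" using t by auto
    have "((\<lambda>s. l *\<^sub>R Y s - \<Psi> s) has_integral Y t - Y (-1)) {-1..t}"
    proof (rule fundamental_theorem_of_calculus)
      show "-1 \<le> t" using t by simp
      show "(Y has_vector_derivative l *\<^sub>R Y s - \<Psi> s) (at s within {-1..t})" if "s \<in> {-1..t}" for s
        using that sub by (intro has_vector_derivative_within_subset[OF Y_deriv]) auto
    qed
    from has_integral_cmul[OF this, of "- l"]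
    have "((\<lambda>s. (- l) *\<^sub>R (l *\<^sub>R Y s - \<Psi> s)) has_integral (- l) *\<^sub>R (Y t - Y (-1))) {-1..t}" .
    moreover have "(\<psi> has_integral integral {-1..t} \<psi>) {-1..t}"
      by (intro integrable_integral integrable_subinterval_real[OF \<psi>_int sub])
    ultimately have "((\<lambda>s. (- l) *\<^sub>R (l *\<^sub>R Y s - \<Psi> s) - \<psi> s) has_integral
        (- l) *\<^sub>R (Y t - Y (-1)) - integral {-1..t} \<psi>) {-1..t}" by (rule has_integral_diff)
    moreover have "(\<lambda>s. (- l) *\<^sub>R (l *\<^sub>R Y s - \<Psi> s) - \<psi> s) = (\<lambda>s. l *\<^sub>R shift_solution l \<psi> s - \<psi> s)"
      by (simp add: E algebra_simps)
    ultimately have "integral {-1..t} (\<lambda>s. l *\<^sub>R shift_solution l \<psi> s - \<psi> s)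
        = (- l) *\<^sub>R (Y t - Y (-1)) - integral {-1..t} \<psi>" by (simp add: integral_unique)
    moreover have "\<Psi> t - \<Psi> (-1) = - integral {-1..t} \<psi>"
      using integral_right_part[OF \<psi>_int t] by (simp add: \<Psi>_def)
    moreover have "shift_solution l \<psi> t = shift_solution l \<psi> (-1) + ((\<Psi> t - \<Psi> (-1)) - l *\<^sub>R (Y t - Y (-1)))"
      by (simp add: E algebra_simps)
    ultimately show "shift_solution l \<psi> t = shift_solution l \<psi> (-1) +
        integral {-1..t} (\<lambda>s. l *\<^sub>R shift_solution l \<psi> s - \<psi> s)"
      by simp
  qed
qed

text \<open>The integrated form hides the sign of the solution. It is recovered from monotonicity:
  \<Psi> decreases because \<psi> is nonnegative, so replacing \<open>\<Psi> s\<close> by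
  \<open>\<Psi> t\<close> under the integral bounds the subtracted term by
  \<open>(1 - exp (l * t)) *\<^sub>R \<Psi> t\<close>, which is at most
  \<open>\<Psi> t\<close>.\<close>

lemma shift_solution_nonneg:
  fixes \<psi> :: "real \<Rightarrow> 'x::banach_lattice"
  assumes p: "1 \<le> p" and \<psi>: "Lp_fun p {-1..0} \<psi>" and l: "0 < l"
    and pos: "AE t in lebesgue_on {-1..0}. 0 \<le> \<psi> t" and t: "t \<in> {-1..0}"
  shows "0 \<le> shift_solution l \<psi> t"
proof -
  define \<Psi> where "\<Psi> t = integral {t..0} \<psi>" for t
  have \<psi>_int: "\<psi> integrable_on {-1..0}" by (rule Lp_fun_integrable_on[OF p \<psi>])
  have sub_pos: "0 \<le> integral {s..r} \<psi>" if "-1 \<le> s" "r \<le> 0" for s r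
  proof (rule integral_nonneg_AE_lattice)
    show "\<psi> integrable_on {s..r}" using that by (intro integrable_subinterval_real[OF \<psi>_int]) auto
    have *: "{a..b} \<inter> space lebesgue \<in> sets lebesgue" for a b :: real by simp
    show "AE t in lebesgue_on {s..r}. 0 \<le> \<psi> t"
      using pos unfolding AE_restrict_space_iff[OF *] by eventually_elim (use that in auto)
  qed
  have mono: "\<Psi> s \<le> \<Psi> t" if "s \<in> {t..0}" for s
  proof -
    have "\<psi> integrable_on {t..0}" using t by (intro integrable_subinterval_real[OF \<psi>_int]) auto
    from Henstock_Kurzweil_Integration.integral_combine[OF _ _ this, of s] that have "\<Psi> t = integral {t..s} \<psi> + \<Psi> s"
      by (simp add: \<Psi>_def)
    then show ?thesis using sub_pos[of t s] t that by simp
  qed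
  have \<Psi>0: "0 \<le> \<Psi> t" unfolding \<Psi>_def using t by (intro sub_pos) simp_all
  have \<Psi>_cont: "continuous_on {-1..0} \<Psi>" unfolding \<Psi>_def by (rule continuous_on_integral_right[OF \<psi>_int])
  have \<Psi>_cont': "continuous_on {t..0} \<Psi>" using t by (intro continuous_on_subset[OF \<Psi>_cont]) auto
  have "integral {t..0} (\<lambda>s. exp (- l * s) *\<^sub>R \<Psi> s) \<le> integral {t..0} (\<lambda>s. exp (- l * s) *\<^sub>R \<Psi> t)"
    by (intro integral_mono_lattice integrable_continuous_real continuous_intros \<Psi>_cont'
        scaleR_left_mono mono) simp_all
  also have "integral {t..0} (\<lambda>s. exp (- l * s) *\<^sub>R \<Psi> t) = ((exp (- l * t) - 1) / l) *\<^sub>R \<Psi> t"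
  proof -
    have "((\<lambda>s. (- exp (- l * s) / l) *\<^sub>R \<Psi> t) has_vector_derivative exp (- l * s) *\<^sub>R \<Psi> t) (at s within {t..0})" for s
      using l by (auto intro!: derivative_eq_intros)
    then have "((\<lambda>s. exp (- l * s) *\<^sub>R \<Psi> t) has_integral
        ((- exp (- l * 0) / l) *\<^sub>R \<Psi> t - (- exp (- l * t) / l) *\<^sub>R \<Psi> t)) {t..0}"
      using t by (intro fundamental_theorem_of_calculus) auto
    then have "integral {t..0} (\<lambda>s. exp (- l * s) *\<^sub>R \<Psi> t)
        = (- exp (- l * 0) / l) *\<^sub>R \<Psi> t - (- exp (- l * t) / l) *\<^sub>R \<Psi> t" by (rule integral_unique)
    also have "\<dots> = ((exp (- l * t) - 1) / l) *\<^sub>R \<Psi> t" by (simp add: diff_divide_distrib scaleR_diff_left)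
    finally show ?thesis .
  qed
  finally have "(l * exp (l * t)) *\<^sub>R integral {t..0} (\<lambda>s. exp (- l * s) *\<^sub>R \<Psi> s)
      \<le> (l * exp (l * t)) *\<^sub>R (((exp (- l * t) - 1) / l) *\<^sub>R \<Psi> t)"
    using l by (intro scaleR_left_mono) simp_all
  also have "\<dots> = (1 - exp (l * t)) *\<^sub>R \<Psi> t"
  proof -
    have "exp (l * t) * exp (- l * t) = 1" by (simp flip: exp_add)
    then have "exp (l * t) * (exp (- l * t) - 1) = 1 - exp (l * t)"
      by (simp only: right_diff_distrib mult_1_right)
    then have "l * exp (l * t) * ((exp (- l * t) - 1) / l) = 1 - exp (l * t)"
      using l by simp
    then show ?thesis by simp
  qed
  also have "\<dots> \<le> 1 *\<^sub>R \<Psi> t" by (intro scaleR_right_mono \<Psi>0) simp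
  finally show ?thesis by (simp add: shift_solution_def \<Psi>_def[abs_def])
qed

text \<open>The difference \<delta> of the two sides satisfies \<open>\<delta>' = l \<delta>\<close>
  in integrated form. Being continuous it is differentiable, so
  \<open>exp (- l * s) *\<^sub>R \<delta> s\<close> is constant, and it vanishes at 0.\<close>

lemma W1p_deriv_eq_shift_solution:
  fixes \<phi> :: "real \<Rightarrow> 'x::banach"
  assumes p: "1 \<le> p" and \<phi>: "W1p_deriv p (-1) 0 \<phi> \<phi>'" and t: "t \<in> {-1..0}"
  shows "\<phi> t = exp (l * t) *\<^sub>R \<phi> 0 + shift_solution l (\<lambda>s. l *\<^sub>R \<phi> s - \<phi>' s) t"
proof -
  define \<psi> where "\<psi> s = l *\<^sub>R \<phi> s - \<phi>' s" for s
  define \<delta> where "\<delta> s = \<phi> s - exp (l * s) *\<^sub>R \<phi> 0 - shift_solution l \<psi> s" for s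
  have \<phi>_cont: "continuous_on {-1..0} \<phi>" by (rule W1p_deriv_continuous[OF p \<phi>])
  have \<phi>'_Lp: "Lp_fun p {-1..0} \<phi>'" using \<phi> unfolding W1p_deriv_def by blast
  have \<psi>_Lp: "Lp_fun p {-1..0} \<psi>"
    unfolding \<psi>_def using p by (intro Lp_fun_diff \<phi>'_Lp continuous_imp_Lp_fun continuous_intros \<phi>_cont) simp_all
  note E = shift_solution_W1p[OF p \<psi>_Lp, of l] and X = W1p_deriv_exp[OF p, of l "\<phi> 0"]
  have \<delta>_cont: "continuous_on {-1..0} \<delta>"
    unfolding \<delta>_def by (intro continuous_intros \<phi>_cont W1p_deriv_continuous[OF p E])
  have \<delta>_int: "\<delta> s = \<delta> (-1) + integral {-1..s} (\<lambda>r. l *\<^sub>R \<delta> r)" if s: "s \<in> {-1..0}" for s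
  proof -
    have prim: "(g has_integral (f s - f (-1))) {-1..s}" if W: "W1p_deriv p (-1) 0 f g"
      for f g :: "real \<Rightarrow> 'x"
    proof -
      have "g integrable_on {-1..0}" using W unfolding W1p_deriv_def by (intro Lp_fun_integrable_on[OF p]) blast
      then have "g integrable_on {-1..s}" using s by (rule_tac integrable_subinterval_real) auto
      moreover have "f s - f (-1) = integral {-1..s} g"
        using W s unfolding W1p_deriv_def by (metis add_diff_cancel_left')
      ultimately show ?thesis by (simp add: integrable_integral)
    qed
    from has_integral_diff[OF has_integral_diff[OF prim[OF \<phi>] prim[OF X]] prim[OF E]]
    have "((\<lambda>r. \<phi>' r - (l * exp (l * r)) *\<^sub>R \<phi> 0 - (l *\<^sub>R shift_solution l \<psi> r - \<psi> r))
        has_integral \<delta> s - \<delta> (-1)) {-1..s}" by (simp add: \<delta>_def algebra_simps)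
    moreover have "(\<lambda>r. \<phi>' r - (l * exp (l * r)) *\<^sub>R \<phi> 0 - (l *\<^sub>R shift_solution l \<psi> r - \<psi> r)) = (\<lambda>r. l *\<^sub>R \<delta> r)"
      by (simp add: \<delta>_def \<psi>_def algebra_simps)
    ultimately have "((\<lambda>r. l *\<^sub>R \<delta> r) has_integral \<delta> s - \<delta> (-1)) {-1..s}" by (simp only:)
    then show ?thesis by (simp only: integral_unique) simp
  qed
  have \<delta>_deriv: "(\<delta> has_vector_derivative l *\<^sub>R \<delta> s) (at s within {-1..0})" if s: "s \<in> {-1..0}" for s
  proof -
    have "((\<lambda>s. \<delta> (-1) + integral {-1..s} (\<lambda>r. l *\<^sub>R \<delta> r)) has_vector_derivative 0 + l *\<^sub>R \<delta> s) (at s within {-1..0})"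
      by (intro has_vector_derivative_add has_vector_derivative_const integral_has_vector_derivative
          continuous_intros \<delta>_cont s)
    then have d: "((\<lambda>s. \<delta> (-1) + integral {-1..s} (\<lambda>r. l *\<^sub>R \<delta> r)) has_vector_derivative l *\<^sub>R \<delta> s)
        (at s within {-1..0})" unfolding add_0_left .
    show ?thesis by (rule has_vector_derivative_transform[OF s _ d]) (rule \<delta>_int)
  qed
  have "((\<lambda>s. exp (- l * s) *\<^sub>R \<delta> s) has_vector_derivative 0) (at s within {-1..0})" if s: "s \<in> {-1..0}" for s
  proof -
    have "((\<lambda>s. exp (- l * s) *\<^sub>R \<delta> s) has_vector_derivative
        exp (- l * s) *\<^sub>R (l *\<^sub>R \<delta> s) + (- l * exp (- l * s)) *\<^sub>R \<delta> s) (at s within {-1..0})"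
      by (intro has_vector_derivative_scaleR \<delta>_deriv s) (auto intro!: derivative_eq_intros)
    then show ?thesis by (simp add: mult.commute)
  qed
  then have "\<exists>c. \<forall>s\<in>{-1..0}. exp (- l * s) *\<^sub>R \<delta> s = c"
    by (intro has_derivative_zero_constant) (simp_all add: has_vector_derivative_def)
  then obtain c where c: "\<And>s. s \<in> {-1..0} \<Longrightarrow> exp (- l * s) *\<^sub>R \<delta> s = c" by blast
  have "c = 0" using c[of 0] by (simp add: \<delta>_def)
  then have "\<delta> t = 0" using c[OF t] by simp
  then show ?thesis by (simp add: \<delta>_def \<psi>_def[abs_def] diff_eq_eq add.commute)
qed

section \<open>Minkowski's inequality and completeness of \<open>L\<^sup>p\<close>\<close>

lemma powr_convex_ineq:
  fixes x y u p :: real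
  assumes p: "1 \<le> p" and u: "0 \<le> u" "u \<le> 1" and x: "0 \<le> x" and y: "0 \<le> y"
  shows "(u * x + (1 - u) * y) powr p \<le> u * x powr p + (1 - u) * y powr p"
proof -
  \<comment> \<open>Convexity is applied on the open half line; when \<open>x\<close> or
    \<open>y\<close> is zero, the inequality reduces to \<open>v powr p \<le> v\<close> on the unit
    interval.\<close>
  have scale: "(v * z) powr p \<le> v * z powr p" if "0 \<le> v" "v \<le> 1" "0 \<le> z" for v z :: real
  proof -
    have "v powr p \<le> v" using powr_mono'[of 1 p v] that p by simp
    then have "v powr p * z powr p \<le> v * z powr p" by (intro mult_right_mono) simp_all
    then show ?thesis using that by (simp add: powr_mult)
  qed
  consider "x = 0" | "y = 0" | "0 < x" "0 < y" using x y by fastforce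
  then show ?thesis
  proof cases
    case 3
    have "convex_on {0<..} (\<lambda>x::real. x powr p)" by (rule powr_convex[OF p])
    from convex_onD[OF this, of "1 - u" x y] u 3 show ?thesis by simp
  qed (use scale[of "1 - u" y] scale[of u x] u x y in simp_all)
qed

lemma Lp_fun_UNIV:
  "Lp_fun p UNIV f \<longleftrightarrow> strongly_measurable UNIV f \<and> integrable lebesgue (\<lambda>t. norm (f t) powr p)"
  by (simp add: Lp_fun_def lebesgue_on_UNIV_eq)

lemma Lp_fun_norm_UNIV:
  "Lp_fun_norm p UNIV f = (integral\<^sup>L lebesgue (\<lambda>t. norm (f t) powr p)) powr (1 / p)"
  by (simp add: Lp_fun_norm_def lebesgue_on_UNIV_eq)

lemma Lp_fun_norm_nonneg [simp]: "0 \<le> Lp_fun_norm p S f"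
  by (simp add: Lp_fun_norm_def)

lemma Lp_fun_norm_powr:
  "0 < p \<Longrightarrow> Lp_fun_norm p UNIV f powr p = integral\<^sup>L lebesgue (\<lambda>t. norm (f t) powr p)"
  by (simp add: Lp_fun_norm_UNIV powr_powr)

lemma Lp_fun_norm_leI:
  assumes "0 < p" "0 \<le> c" "integral\<^sup>L lebesgue (\<lambda>t. norm (f t) powr p) \<le> c powr p"
  shows "Lp_fun_norm p UNIV f \<le> c"
proof -
  have "Lp_fun_norm p UNIV f \<le> (c powr p) powr (1 / p)"
    unfolding Lp_fun_norm_UNIV using assms by (intro powr_mono2) simp_all
  then show ?thesis using assms by (simp add: powr_powr)
qed

text \<open>Minkowski's inequality from convexity alone: \<open>norm (f t) + norm (g t)\<close> is
  \<open>a + b\<close> times the convex combination of \<open>norm (f t) / a\<close> and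
  \<open>norm (g t) / b\<close> with weight \<open>u = a / (a + b)\<close>. Enlarging the norms by
  \<open>e / 2\<close> makes \<open>a\<close> and \<open>b\<close> positive even if a norm is
  zero.\<close>

lemma Lp_fun_norm_triangle:
  assumes p: "1 \<le> p" and f: "Lp_fun p UNIV f" and g: "Lp_fun p UNIV g"
  shows "Lp_fun_norm p UNIV (\<lambda>t. f t + g t) \<le> Lp_fun_norm p UNIV f + Lp_fun_norm p UNIV g"
proof (rule field_le_epsilon)
  fix e :: real assume e: "0 < e"
  define a where "a = Lp_fun_norm p UNIV f + e / 2"
  define b where "b = Lp_fun_norm p UNIV g + e / 2"
  have a: "0 < a" "Lp_fun_norm p UNIV f \<le> a" using e by (simp_all add: a_def add_nonneg_pos)
  have b: "0 < b" "Lp_fun_norm p UNIV g \<le> b" using e by (simp_all add: b_def add_nonneg_pos)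
  define u where "u = a / (a + b)"
  have u: "0 \<le> u" "u \<le> 1" "1 - u = b / (a + b)" using a b by (simp_all add: u_def field_simps)
  define c where "c = (a + b) powr p"
  have fi: "integrable lebesgue (\<lambda>t. norm (f t) powr p)" and gi: "integrable lebesgue (\<lambda>t. norm (g t) powr p)"
    using f g by (simp_all add: Lp_fun_UNIV)
  have fgi: "integrable lebesgue (\<lambda>t. norm (f t + g t) powr p)"
    using Lp_fun_add[OF _ p f g] by (simp add: Lp_fun_UNIV)
  have pointwise: "norm (f t + g t) powr p
      \<le> c * u / a powr p * norm (f t) powr p + c * (1 - u) / b powr p * norm (g t) powr p" for t
  proof -
    have eq: "norm (f t) + norm (g t) = (a + b) * (u * (norm (f t) / a) + (1 - u) * (norm (g t) / b))"
    proof -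
      have "(a + b) * u = a" "(a + b) * (1 - u) = b" unfolding u(3) using a(1) b(1) by (simp_all add: u_def)
      then have "((a + b) * u) * (norm (f t) / a) + ((a + b) * (1 - u)) * (norm (g t) / b) = norm (f t) + norm (g t)"
        using a(1) b(1) by simp
      then show ?thesis by (simp only: distrib_left mult.assoc)
    qed
    have "norm (f t + g t) powr p \<le> (norm (f t) + norm (g t)) powr p"
      using p by (intro powr_mono2 norm_triangle_ineq) simp_all
    also have "\<dots> = c * (u * (norm (f t) / a) + (1 - u) * (norm (g t) / b)) powr p"
      unfolding eq c_def by (rule powr_mult)
    also have "\<dots> \<le> c * (u * (norm (f t) / a) powr p + (1 - u) * (norm (g t) / b) powr p)"
      using a b u p by (intro mult_left_mono powr_convex_ineq) (simp_all add: c_def)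
    also have "\<dots> = c * u / a powr p * norm (f t) powr p + c * (1 - u) / b powr p * norm (g t) powr p"
      using a b by (simp add: powr_divide algebra_simps)
    finally show ?thesis .
  qed
  have "integral\<^sup>L lebesgue (\<lambda>t. norm (f t + g t) powr p)
      \<le> integral\<^sup>L lebesgue (\<lambda>t. c * u / a powr p * norm (f t) powr p + c * (1 - u) / b powr p * norm (g t) powr p)"
    by (intro integral_mono fgi Bochner_Integration.integrable_add integrable_mult_right fi gi pointwise)
  also have "\<dots> = c * u / a powr p * integral\<^sup>L lebesgue (\<lambda>t. norm (f t) powr p)
      + c * (1 - u) / b powr p * integral\<^sup>L lebesgue (\<lambda>t. norm (g t) powr p)"
    using fi gi by simp
  also have "\<dots> \<le> c * u / a powr p * a powr p + c * (1 - u) / b powr p * b powr p"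
  proof (intro add_mono mult_left_mono)
    show "integral\<^sup>L lebesgue (\<lambda>t. norm (f t) powr p) \<le> a powr p"
      using p a by (subst Lp_fun_norm_powr[symmetric]) (auto intro!: powr_mono2)
    show "integral\<^sup>L lebesgue (\<lambda>t. norm (g t) powr p) \<le> b powr p"
      using p b by (subst Lp_fun_norm_powr[symmetric]) (auto intro!: powr_mono2)
    show "0 \<le> c * u / a powr p" "0 \<le> c * (1 - u) / b powr p" using u(1,2) by (simp_all add: c_def)
  qed
  also have "\<dots> = c * u + c * (1 - u)" using a b by simp
  also have "\<dots> = c" by (simp add: algebra_simps)
  finally have "Lp_fun_norm p UNIV (\<lambda>t. f t + g t) \<le> a + b"
    using p a b by (intro Lp_fun_norm_leI) (simp_all add: c_def)
  then show "Lp_fun_norm p UNIV (\<lambda>t. f t + g t) \<le> Lp_fun_norm p UNIV f + Lp_fun_norm p UNIV g + e"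
    by (simp add: a_def b_def)
qed

lemma Lp_fun_norm_scaleR:
  assumes "0 < p"
  shows "Lp_fun_norm p UNIV (\<lambda>t. c *\<^sub>R f t) = \<bar>c\<bar> * Lp_fun_norm p UNIV f"
proof -
  have "norm (c *\<^sub>R f t) powr p = \<bar>c\<bar> powr p * norm (f t) powr p" for t by (simp add: powr_mult)
  then show ?thesis
    using assms by (simp add: Lp_fun_norm_UNIV powr_mult powr_powr)
qed

section \<open>Almost everywhere convergence and completeness\<close>

lemma AE_summable_of_integrals:
  fixes g :: "nat \<Rightarrow> 'a \<Rightarrow> real"
  assumes int: "\<And>n. integrable M (g n)" and nonneg: "\<And>n t. 0 \<le> g n t"
    and c: "\<And>n. integral\<^sup>L M (g n) \<le> c n" "summable c"
  shows "AE t in M. summable (\<lambda>n. g n t)"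
proof -
  have c0: "0 \<le> c n" for n using c(1)[of n] integral_nonneg_AE[of "g n" M] nonneg by (meson AE_I2 order_trans)
  have "(\<integral>\<^sup>+ t. (\<Sum>n. ennreal (g n t)) \<partial>M) = (\<Sum>n. \<integral>\<^sup>+ t. ennreal (g n t) \<partial>M)"
    using int by (intro nn_integral_suminf) simp
  also have "\<dots> \<le> (\<Sum>n. ennreal (c n))"
    using int nonneg c(1) by (intro suminf_le) (simp_all add: nn_integral_eq_integral ennreal_leI)
  also have "\<dots> < \<infinity>" using c(2) c0 by (simp add: suminf_ennreal2 less_top)
  finally have "(\<integral>\<^sup>+ t. (\<Sum>n. ennreal (g n t)) \<partial>M) \<noteq> \<infinity>" by simp
  then have "AE t in M. (\<Sum>n. ennreal (g n t)) \<noteq> \<infinity>"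
    using int by (intro nn_integral_PInf_AE) simp_all
  then show ?thesis
  proof eventually_elim
    case (elim t)
    then show ?case using nonneg by (intro summable_suminf_not_top) simp_all
  qed
qed

text \<open>Each \<open>F n\<close> is replaced by one simple function within
  \<open>(1 / 2) ^ n\<close> in mean. The errors are summable almost everywhere, hence tend to 0,
  and the simple functions have the same limit as \<open>F\<close>.\<close>

lemma strongly_measurable_limit:
  fixes F :: "nat \<Rightarrow> real \<Rightarrow> 'x::real_normed_vector"
  assumes F: "\<And>n. strongly_measurable UNIV (F n)" "\<And>n. integrable lebesgue (\<lambda>t. norm (F n t))"
    and lim: "AE t in lebesgue. (\<lambda>n. F n t) \<longlonglongrightarrow> f t"
  shows "strongly_measurable UNIV f"
proof -
  have "\<exists>s. simple_function lebesgue s \<and> integrable lebesgue (\<lambda>t. norm (F n t - s t)) \<and>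
      integral\<^sup>L lebesgue (\<lambda>t. norm (F n t - s t)) < (1 / 2) ^ n" for n
    using simple_function_L1_approximation[OF F(1)[of n] F(2)[of n], of "(1 / 2) ^ n"] by auto
  then obtain s where s: "\<And>n. simple_function lebesgue (s n)"
    "\<And>n. integrable lebesgue (\<lambda>t. norm (F n t - s n t))"
    "\<And>n. integral\<^sup>L lebesgue (\<lambda>t. norm (F n t - s n t)) < (1 / 2) ^ n" by metis
  have "AE t in lebesgue. summable (\<lambda>n. norm (F n t - s n t))"
    by (rule AE_summable_of_integrals[where c = "\<lambda>n. (1 / 2) ^ n"])
      (use s(2) less_imp_le[OF s(3)] in \<open>auto intro!: summable_geometric\<close>)
  with lim have "AE t in lebesgue. (\<lambda>n. s n t) \<longlonglongrightarrow> f t"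
  proof eventually_elim
    case (elim t)
    have "(\<lambda>n. norm (F n t - s n t)) \<longlonglongrightarrow> 0" by (rule summable_LIMSEQ_zero[OF elim(2)])
    then have "(\<lambda>n. F n t - s n t) \<longlonglongrightarrow> 0" by (rule tendsto_norm_zero_cancel)
    from tendsto_diff[OF elim(1) this] show ?case by simp
  qed
  then show ?thesis using s(1) unfolding strongly_measurable_def lebesgue_on_UNIV_eq by blast
qed

lemma powr_tendsto_0_cancel:
  fixes x :: "nat \<Rightarrow> real"
  assumes "(\<lambda>n. x n powr p) \<longlonglongrightarrow> 0" "\<And>n. 0 \<le> x n" "0 < p"
  shows "x \<longlonglongrightarrow> 0"
proof -
  have "(\<lambda>n. (x n powr p) powr (1 / p)) \<longlonglongrightarrow> 0 powr (1 / p)"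
    using assms(3) by (intro tendsto_powr' assms(1) tendsto_const) simp
  then show ?thesis using assms by (simp add: powr_powr)
qed

lemma Lp_fun_bounded_support_integrable:
  assumes p: "1 \<le> p" and f: "Lp_fun p UNIV f" and supp: "\<And>t. t \<notin> {a..b} \<Longrightarrow> f t = 0"
  shows "integrable lebesgue (\<lambda>t. norm (f t))"
proof -
  have eq: "(\<lambda>t. if t \<in> {a..b} then f t else 0) = f" using supp by auto
  have S: "{a..b} \<in> sets lebesgue" "{a..b} \<inter> space lebesgue \<in> sets lebesgue" by auto
  have "Lp_fun p {a..b} f" using Lp_fun_restrict_iff[OF S(1), of p f] f unfolding eq by simp
  from Lp_fun_norm_integrable[OF p this]
  have "integrable lebesgue (\<lambda>t. indicat_real {a..b} t *\<^sub>R norm (f t))"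
    unfolding integrable_restrict_space[OF S(2)] .
  moreover have "(\<lambda>t. indicat_real {a..b} t *\<^sub>R norm (f t)) = (\<lambda>t. norm (f t))"
    using supp by (auto simp: indicator_def fun_eq_iff)
  ultimately show ?thesis by (simp only:)
qed

lemma Lp_fun_sum:
  assumes "1 \<le> p" "\<And>i. i \<in> I \<Longrightarrow> Lp_fun p UNIV (f i)"
  shows "Lp_fun p UNIV (\<lambda>t. \<Sum>i\<in>I. f i t)"
  using assms(2)
proof (induction I rule: infinite_finite_induct)
  case (insert i I)
  then show ?case using Lp_fun_add[OF _ assms(1), of UNIV "f i" "\<lambda>t. \<Sum>i\<in>I. f i t"] by simp
qed (use assms(1) in \<open>simp_all add: Lp_fun_UNIV strongly_measurable_const0\<close>)

text \<open>The series converges pointwise almost everywhere, and Fatou's lemma turns the uniform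
  bounds on its finite tails into convergence in norm. The common bounded support makes the partial
  sums integrable, as \<open>strongly_measurable_limit\<close> demands.\<close>

lemma Lp_fun_complete:
  fixes f :: "nat \<Rightarrow> real \<Rightarrow> 'x::banach"
  assumes p: "1 \<le> p" and f: "\<And>n. Lp_fun p UNIV (f n)" and supp: "\<And>n t. t \<notin> {a..b} \<Longrightarrow> f n t = 0"
    and N: "\<And>n. Lp_fun_norm p UNIV (f n) \<le> (1 / 3) ^ n"
  shows "\<exists>g. Lp_fun p UNIV g \<and> (\<forall>t. t \<notin> {a..b} \<longrightarrow> g t = 0) \<and>
    (\<lambda>n. Lp_fun_norm p UNIV (\<lambda>t. (\<Sum>i<n. f i t) - g t)) \<longlonglongrightarrow> 0"
proof -
  have p0: "0 < p" using p by simp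
  have fi: "integrable lebesgue (\<lambda>t. norm (f n t) powr p)" for n using f[of n] by (simp add: Lp_fun_UNIV)
  \<comment> \<open>The decay \<open>(1 / 3) ^ n\<close> leaves room for the weight
    \<open>2 ^ n\<close>. Summability of the weighted powers then forces
    \<open>norm (f n t) \<le> (1 / 2) ^ n\<close> eventually, so that absolute convergence follows
    for every \<open>p\<close>.\<close>
  have int_le: "integral\<^sup>L lebesgue (\<lambda>t. (2 ^ n * norm (f n t)) powr p) \<le> (2 / 3) ^ n" for n
  proof -
    have "integral\<^sup>L lebesgue (\<lambda>t. (2 ^ n * norm (f n t)) powr p)
        = (2 ^ n) powr p * integral\<^sup>L lebesgue (\<lambda>t. norm (f n t) powr p)"
      by (simp add: powr_mult)
    also have "\<dots> = (2 ^ n) powr p * Lp_fun_norm p UNIV (f n) powr p"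
      by (simp only: Lp_fun_norm_powr[OF p0])
    also have "\<dots> \<le> (2 ^ n) powr p * ((1 / 3) ^ n) powr p"
      using p by (intro mult_left_mono powr_mono2 N) simp_all
    also have "\<dots> = ((2 / 3) ^ n) powr p"
      by (simp add: powr_mult[symmetric] power_mult_distrib[symmetric])
    also have "\<dots> \<le> ((2 / 3) ^ n) powr 1"
      using p by (intro powr_mono') (simp_all add: power_le_one)
    finally show ?thesis by simp
  qed
  have "AE t in lebesgue. summable (\<lambda>n. (2 ^ n * norm (f n t)) powr p)"
  proof (rule AE_summable_of_integrals[where c = "\<lambda>n. (2 / 3) ^ n"])
    show "integrable lebesgue (\<lambda>t. (2 ^ n * norm (f n t)) powr p)" for n
      using fi[of n] by (simp add: powr_mult)
  qed (use int_le in \<open>simp_all add: summable_geometric\<close>)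
  then have "AE t in lebesgue. summable (\<lambda>n. f n t)"
  proof eventually_elim
    case (elim t)
    have "\<forall>\<^sub>F n in sequentially. (2 ^ n * norm (f n t)) powr p < 1"
      using summable_LIMSEQ_zero[OF elim] by (rule order_tendstoD(2)) simp
    then have "\<forall>\<^sub>F n in sequentially. norm (f n t) \<le> (1 / 2) ^ n"
    proof eventually_elim
      case (elim n)
      then have "\<not> 1 \<le> 2 ^ n * norm (f n t)" using ge_one_powr_ge_zero[of "2 ^ n * norm (f n t)" p] p by linarith
      then show ?case by (simp add: power_one_over field_simps)
    qed
    then show ?case by (rule summable_comparison_test_ev) (simp add: summable_geometric)
  qed
  then have lim: "AE t in lebesgue. (\<lambda>n. \<Sum>i<n. f i t) \<longlonglongrightarrow> (\<Sum>n. f n t)"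
    by eventually_elim (rule summable_LIMSEQ)
  define g where "g t = (\<Sum>n. f n t)" for t
  define F where "F n t = (\<Sum>i<n. f i t)" for n t
  have FL: "Lp_fun p UNIV (F n)" for n unfolding F_def by (intro Lp_fun_sum p f)
  have Fsupp: "F n t = 0" if "t \<notin> {a..b}" for n t using supp[OF that] by (simp add: F_def)
  have gsupp: "g t = 0" if "t \<notin> {a..b}" for t using supp[OF that] by (simp add: g_def)
  have g_sm: "strongly_measurable UNIV g"
  proof (rule strongly_measurable_limit)
    show "strongly_measurable UNIV (F n)" for n using FL[of n] by (simp add: Lp_fun_UNIV)
    show "integrable lebesgue (\<lambda>t. norm (F n t))" for n
      by (rule Lp_fun_bounded_support_integrable[OF p FL Fsupp])
    show "AE t in lebesgue. (\<lambda>n. F n t) \<longlonglongrightarrow> g t" using lim by (simp add: F_def g_def)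
  qed
  have tail: "Lp_fun_norm p UNIV (\<lambda>t. F (n + k) t - F n t) \<le> 3 / 2 * (1 / 3) ^ n" for n k
  proof -
    have "Lp_fun_norm p UNIV (\<lambda>t. F (n + k) t - F n t) \<le> 3 / 2 * (1 / 3) ^ n - 3 / 2 * (1 / 3) ^ (n + k)"
    proof (induction k)
      case 0
      show ?case using p by (simp add: Lp_fun_norm_UNIV)
    next
      case (Suc k)
      have "Lp_fun_norm p UNIV (\<lambda>t. F (n + Suc k) t - F n t)
          = Lp_fun_norm p UNIV (\<lambda>t. (F (n + k) t - F n t) + f (n + k) t)"
        by (simp add: F_def algebra_simps)
      also have "\<dots> \<le> Lp_fun_norm p UNIV (\<lambda>t. F (n + k) t - F n t) + Lp_fun_norm p UNIV (f (n + k))"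
        by (intro Lp_fun_norm_triangle p f Lp_fun_diff FL) simp
      also have "\<dots> \<le> (3 / 2 * (1 / 3) ^ n - 3 / 2 * (1 / 3) ^ (n + k)) + (1 / 3) ^ (n + k)"
        by (intro add_mono Suc N)
      also have "\<dots> = 3 / 2 * (1 / 3) ^ n - 3 / 2 * (1 / 3) ^ (n + Suc k)" by simp
      finally show ?case .
    qed
    also have "\<dots> \<le> 3 / 2 * (1 / 3) ^ n" by simp
    finally show ?thesis .
  qed
  have diff_sm: "strongly_measurable UNIV (\<lambda>t. F n t - g t)" for n
    using FL[of n] g_sm by (intro strongly_measurable_diff) (simp_all add: Lp_fun_UNIV)
  have diff_meas: "(\<lambda>t. norm (F n t - g t) powr p) \<in> borel_measurable lebesgue" for n
    by (intro powr_real_measurable strongly_measurable_norm_UNIV diff_sm borel_measurable_const)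
  \<comment> \<open>The bound on the finite tails does not depend on \<open>k\<close>, so it
    survives the limit in \<open>k\<close>. It also provides the p-integrability of
    \<open>F n - g\<close>, and thereby of \<open>g\<close>.\<close>
  have fatou: "(\<integral>\<^sup>+ t. ennreal (norm (F n t - g t) powr p) \<partial>lebesgue) \<le> ennreal ((3 / 2 * (1 / 3) ^ n) powr p)" for n
  proof -
    have dL: "Lp_fun p UNIV (\<lambda>t. F (n + k) t - F n t)" for k by (intro Lp_fun_diff p FL) simp
    have "(\<integral>\<^sup>+ t. ennreal (norm (F n t - g t) powr p) \<partial>lebesgue)
        = (\<integral>\<^sup>+ t. liminf (\<lambda>k. ennreal (norm (F (n + k) t - F n t) powr p)) \<partial>lebesgue)"
    proof (rule nn_integral_cong_AE)
      show "AE t in lebesgue. ennreal (norm (F n t - g t) powr p)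
          = liminf (\<lambda>k. ennreal (norm (F (n + k) t - F n t) powr p))"
        using lim
      proof eventually_elim
        case (elim t)
        then have "(\<lambda>k. F (k + n) t) \<longlonglongrightarrow> g t" unfolding F_def g_def by (rule LIMSEQ_ignore_initial_segment)
        then have "(\<lambda>k. ennreal (norm (F (n + k) t - F n t) powr p)) \<longlonglongrightarrow> ennreal (norm (g t - F n t) powr p)"
          unfolding add.commute[of n] using p
          by (intro tendsto_ennrealI tendsto_powr' tendsto_intros) simp_all
        from lim_imp_Liminf[OF sequentially_bot this] show ?case by (simp add: norm_minus_commute)
      qed
    qed
    also have "\<dots> \<le> liminf (\<lambda>k. \<integral>\<^sup>+ t. ennreal (norm (F (n + k) t - F n t) powr p) \<partial>lebesgue)"
    proof (rule nn_integral_liminf)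
      have "(\<lambda>t. norm (F (n + k) t - F n t) powr p) \<in> borel_measurable lebesgue" for k
        using dL[of k] unfolding Lp_fun_UNIV by (intro borel_measurable_integrable) blast
      then show "(\<lambda>t. ennreal (norm (F (n + k) t - F n t) powr p)) \<in> borel_measurable lebesgue" for k
        by simp
    qed
    also have "\<dots> \<le> liminf (\<lambda>k. ennreal ((3 / 2 * (1 / 3) ^ n) powr p))"
    proof (rule Liminf_mono, rule always_eventually, rule allI)
      fix k
      have "(\<integral>\<^sup>+ t. ennreal (norm (F (n + k) t - F n t) powr p) \<partial>lebesgue)
          = ennreal (integral\<^sup>L lebesgue (\<lambda>t. norm (F (n + k) t - F n t) powr p))"
        using dL[of k] by (intro nn_integral_eq_integral) (simp_all add: Lp_fun_UNIV)
      also have "\<dots> = ennreal (Lp_fun_norm p UNIV (\<lambda>t. F (n + k) t - F n t) powr p)"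
        by (simp only: Lp_fun_norm_powr[OF p0])
      also have "\<dots> \<le> ennreal ((3 / 2 * (1 / 3) ^ n) powr p)"
        using p tail by (intro ennreal_leI powr_mono2) simp_all
      finally show "(\<integral>\<^sup>+ t. ennreal (norm (F (n + k) t - F n t) powr p) \<partial>lebesgue)
          \<le> ennreal ((3 / 2 * (1 / 3) ^ n) powr p)" .
    qed
    also have "\<dots> = ennreal ((3 / 2 * (1 / 3) ^ n) powr p)" by (rule Liminf_const) simp
    finally show ?thesis .
  qed
  have diff_int: "integrable lebesgue (\<lambda>t. norm (F n t - g t) powr p)" for n
    using le_less_trans[OF fatou ennreal_less_top] diff_meas by (intro integrableI_nonneg) simp_all
  have diff_Lp: "Lp_fun p UNIV (\<lambda>t. F n t - g t)" for n
    using diff_sm diff_int by (simp add: Lp_fun_UNIV)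
  have diff_norm: "Lp_fun_norm p UNIV (\<lambda>t. F n t - g t) \<le> 3 / 2 * (1 / 3) ^ n" for n
  proof (rule Lp_fun_norm_leI)
    have "ennreal (integral\<^sup>L lebesgue (\<lambda>t. norm (F n t - g t) powr p)) \<le> ennreal ((3 / 2 * (1 / 3) ^ n) powr p)"
      using fatou[of n] diff_int[of n] by (subst (asm) nn_integral_eq_integral) simp_all
    then show "integral\<^sup>L lebesgue (\<lambda>t. norm (F n t - g t) powr p) \<le> (3 / 2 * (1 / 3) ^ n) powr p"
      by (simp add: ennreal_le_iff)
  qed (use p in simp_all)
  have "Lp_fun p UNIV (\<lambda>t. F 0 t - (F 0 t - g t))" by (intro Lp_fun_diff p FL diff_Lp) simp
  then have gL: "Lp_fun p UNIV g" by simp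
  have "(\<lambda>n. 3 / 2 * (1 / 3 :: real) ^ n) \<longlonglongrightarrow> 3 / 2 * 0"
    by (intro tendsto_intros LIMSEQ_power_zero) simp
  then have lim0: "(\<lambda>n. 3 / 2 * (1 / 3 :: real) ^ n) \<longlonglongrightarrow> 0" by simp
  have "(\<lambda>n. Lp_fun_norm p UNIV (\<lambda>t. F n t - g t)) \<longlonglongrightarrow> 0"
    by (rule Lim_null_comparison[OF _ lim0]) (use diff_norm in \<open>simp add: always_eventually\<close>)
  then show ?thesis using gL gsupp unfolding F_def by blast
qed

section \<open>The classes of \<open>L\<^sup>p\<close> functions\<close>

lemma abs_L0_eq_iff:
  assumes "strongly_measurable UNIV f" "strongly_measurable UNIV g"
  shows "abs_L0 f = abs_L0 g \<longleftrightarrow> (AE t in lebesgue. f t = g t)"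
  using Quotient_rel[OF Quotient_L0, of f g] assms by simp

lemma abs_L0_plus:
  "strongly_measurable UNIV f \<Longrightarrow> strongly_measurable UNIV g \<Longrightarrow>
    abs_L0 f + abs_L0 g = abs_L0 (\<lambda>t. f t + g t)"
  by (simp add: plus_L0.abs_eq)

lemma abs_L0_minus:
  "strongly_measurable UNIV f \<Longrightarrow> strongly_measurable UNIV g \<Longrightarrow>
    abs_L0 f - abs_L0 g = abs_L0 (\<lambda>t. f t - g t)"
  by (simp add: minus_L0.abs_eq)

lemma abs_L0_scaleR:
  "strongly_measurable UNIV f \<Longrightarrow> c *\<^sub>R abs_L0 f = abs_L0 (\<lambda>t. c *\<^sub>R f t)"
  by (simp add: scaleR_L0.abs_eq)

lemma abs_L0_sum:
  assumes "\<And>i. i \<in> I \<Longrightarrow> strongly_measurable UNIV (f i)"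
  shows "strongly_measurable UNIV (\<lambda>t. \<Sum>i\<in>I. f i t) \<and> (\<Sum>i\<in>I. abs_L0 (f i)) = abs_L0 (\<lambda>t. \<Sum>i\<in>I. f i t)"
  using assms
  by (induction I rule: infinite_finite_induct)
    (simp_all add: strongly_measurable_const0 zero_L0_def abs_L0_plus strongly_measurable_add)

lemma Lp_norm_abs:
  "strongly_measurable UNIV f \<Longrightarrow> Lp_norm p (abs_L0 f) = Lp_fun_norm p UNIV f"
  by (simp add: Lp_norm.abs_eq Lp_fun_norm_UNIV)

lemma abs_L0_le_iff:
  "strongly_measurable UNIV f \<Longrightarrow> strongly_measurable UNIV g \<Longrightarrow>
    abs_L0 f \<le> abs_L0 g \<longleftrightarrow> (AE t in lebesgue. f t \<le> g t)"
  by (simp add: less_eq_L0.abs_eq)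

lemma zero_le_abs_L0_iff:
  "strongly_measurable UNIV f \<Longrightarrow> 0 \<le> abs_L0 f \<longleftrightarrow> (AE t in lebesgue. 0 \<le> f t)"
  unfolding zero_L0_def by (simp add: abs_L0_le_iff strongly_measurable_const0)

lemma LpE:
  assumes "F \<in> Lp p S" "S \<in> sets lebesgue"
  obtains f where "F = abs_L0 f" "Lp_fun p UNIV f" "\<And>t. t \<notin> S \<Longrightarrow> f t = 0"
proof -
  obtain h where h: "F = L0_of S h" "Lp_fun p S h" using assms(1) by (auto simp: Lp_def)
  show thesis
    by (rule that[of "\<lambda>t. if t \<in> S then h t else 0"])
      (use h assms(2) in \<open>simp_all add: L0_of_def Lp_fun_restrict_iff\<close>)
qed

lemma abs_L0_in_Lp:
  assumes "Lp_fun p UNIV f" "\<And>t. t \<notin> S \<Longrightarrow> f t = 0" "S \<in> sets lebesgue"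
  shows "abs_L0 f \<in> Lp p S"
proof -
  have eq: "(\<lambda>t. if t \<in> S then f t else 0) = f" using assms(2) by auto
  have "Lp_fun p S f" using assms(1) Lp_fun_restrict_iff[OF assms(3), of p f] unfolding eq by simp
  moreover have "abs_L0 f = L0_of S f" by (simp only: L0_of_def eq)
  ultimately show ?thesis unfolding Lp_def by blast
qed

lemma Lp_fun_UNIV_sm: "Lp_fun p UNIV f \<Longrightarrow> strongly_measurable UNIV f"
  by (simp add: Lp_fun_UNIV)

lemma normed_subspace_Lp:
  assumes p: "1 \<le> p"
  shows "normed_subspace (Lp p {a..b} :: 'x::banach L0 set) (Lp_norm p)"
proof
  have S: "{a..b} \<in> sets lebesgue" by simp
  have p0: "0 < p" using p by simp
  have U: "UNIV \<in> sets lebesgue" by simp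
  have z: "Lp_fun p UNIV (\<lambda>_. 0 :: 'x)" by (simp add: Lp_fun_UNIV strongly_measurable_const0)
  show "(0 :: 'x L0) \<in> Lp p {a..b}"
    unfolding zero_L0_def by (rule abs_L0_in_Lp[OF z _ S]) simp
  fix F :: "'x L0"
  show "0 \<le> Lp_norm p F" by transfer simp
  assume "F \<in> Lp p {a..b}"
  then obtain f where f: "F = abs_L0 f" "Lp_fun p UNIV f" "\<And>t. t \<notin> {a..b} \<Longrightarrow> f t = 0" by (rule LpE[OF _ S]) blast
  note fs = Lp_fun_UNIV_sm[OF f(2)]
  show "c *\<^sub>R F \<in> Lp p {a..b}" for c
    unfolding f(1) abs_L0_scaleR[OF fs] by (rule abs_L0_in_Lp[OF Lp_fun_scaleR[OF f(2)] _ S]) (simp add: f(3))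
  show "Lp_norm p (c *\<^sub>R F) = \<bar>c\<bar> * Lp_norm p F" for c
    unfolding f(1) abs_L0_scaleR[OF fs]
    by (simp add: Lp_norm_abs fs strongly_measurable_scaleR Lp_fun_norm_scaleR[OF p0])
  show "F = 0" if "Lp_norm p F = 0"
  proof -
    have "integral\<^sup>L lebesgue (\<lambda>t. norm (f t) powr p) = 0"
      using that p0 Lp_fun_norm_powr[OF p0, of f] by (simp add: f(1) Lp_norm_abs[OF fs])
    then have "AE t in lebesgue. norm (f t) powr p = 0"
      using f(2) by (subst (asm) integral_nonneg_eq_0_iff_AE) (simp_all add: Lp_fun_UNIV)
    then have "AE t in lebesgue. f t = 0" by eventually_elim simp
    then show ?thesis
      unfolding f(1) zero_L0_def by (simp add: abs_L0_eq_iff fs strongly_measurable_const0)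
  qed
  fix G :: "'x L0" assume "G \<in> Lp p {a..b}"
  then obtain g where g: "G = abs_L0 g" "Lp_fun p UNIV g" "\<And>t. t \<notin> {a..b} \<Longrightarrow> g t = 0" by (rule LpE[OF _ S]) blast
  note gs = Lp_fun_UNIV_sm[OF g(2)]
  show "F + G \<in> Lp p {a..b}"
    unfolding f(1) g(1) abs_L0_plus[OF fs gs]
    by (rule abs_L0_in_Lp[OF Lp_fun_add[OF U p f(2) g(2)] _ S]) (simp add: f(3) g(3))
  show "Lp_norm p (F + G) \<le> Lp_norm p F + Lp_norm p G"
    unfolding f(1) g(1) abs_L0_plus[OF fs gs]
    using Lp_fun_norm_triangle[OF p f(2) g(2)] by (simp add: Lp_norm_abs fs gs strongly_measurable_add)
next
  have S: "{a..b} \<in> sets lebesgue" by simp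
  fix F :: "nat \<Rightarrow> 'x L0"
  assume F: "\<And>n. F n \<in> Lp p {a..b}" and N: "\<And>n. Lp_norm p (F n) \<le> (1 / 3) ^ n"
  have "\<exists>f. F n = abs_L0 f \<and> Lp_fun p UNIV f \<and> (\<forall>t. t \<notin> {a..b} \<longrightarrow> f t = 0)" for n
    by (rule LpE[OF F[of n] S]) blast
  then obtain f where f: "\<And>n. F n = abs_L0 (f n)" "\<And>n. Lp_fun p UNIV (f n)" "\<And>n t. t \<notin> {a..b} \<Longrightarrow> f n t = 0"
    by metis
  have Nf: "Lp_fun_norm p UNIV (f n) \<le> (1 / 3) ^ n" for n
    using N[of n] by (simp add: f(1) Lp_norm_abs Lp_fun_UNIV_sm[OF f(2)])
  obtain g where g: "Lp_fun p UNIV g" "\<And>t. t \<notin> {a..b} \<Longrightarrow> g t = 0"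
    "(\<lambda>n. Lp_fun_norm p UNIV (\<lambda>t. (\<Sum>i<n. f i t) - g t)) \<longlonglongrightarrow> 0"
    using Lp_fun_complete[OF p f(2,3) Nf] by blast
  have "Lp_norm p ((\<Sum>i<n. F i) - abs_L0 g) = Lp_fun_norm p UNIV (\<lambda>t. (\<Sum>i<n. f i t) - g t)" for n
    using abs_L0_sum[of "{..<n}" f] Lp_fun_UNIV_sm[OF f(2)] Lp_fun_UNIV_sm[OF g(1)]
    by (simp add: f(1) abs_L0_minus Lp_norm_abs strongly_measurable_diff)
  then have "(\<lambda>n. Lp_norm p ((\<Sum>i<n. F i) - abs_L0 g)) \<longlonglongrightarrow> 0" using g(3) by simp
  moreover have "abs_L0 g \<in> Lp p {a..b}" by (rule abs_L0_in_Lp[OF g(1,2) S])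
  ultimately show "\<exists>G\<in>Lp p {a..b}. (\<lambda>n. Lp_norm p ((\<Sum>i<n. F i) - G)) \<longlonglongrightarrow> 0" by blast
qed

lemma normed_subspace_state_space:
  assumes p: "1 \<le> p"
  shows "normed_subspace (state_space p :: ('x::banach \<times> 'x L0) set) (state_norm p)"
proof -
  interpret L: normed_subspace "Lp p {-1..0} :: 'x L0 set" "Lp_norm p" by (rule normed_subspace_Lp[OF p])
  show ?thesis
  proof
    show "(0 :: 'x \<times> 'x L0) \<in> state_space p" by (simp add: state_space_def zero_prod_def)
    fix x y :: "'x \<times> 'x L0" and c :: real
    obtain x1 x2 y1 y2 where xy: "x = (x1, x2)" "y = (y1, y2)" by (cases x, cases y) blast
    show "0 \<le> state_norm p x" by (simp add: state_norm_def xy)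
    assume x: "x \<in> state_space p"
    then have x2: "x2 \<in> Lp p {-1..0}" by (simp add: state_space_def xy)
    show "c *\<^sub>R x \<in> state_space p" using x2 by (simp add: state_space_def xy)
    show "state_norm p (c *\<^sub>R x) = \<bar>c\<bar> * state_norm p x"
      using x2 by (simp add: state_norm_def xy L.N_scale algebra_simps)
    show "x = 0" if "state_norm p x = 0"
    proof -
      have "norm x1 + Lp_norm p x2 = 0" using that by (simp add: state_norm_def xy)
      then have "norm x1 = 0" "Lp_norm p x2 = 0" using norm_ge_zero[of x1] L.N_nonneg[of x2] by linarith+
      then show ?thesis using L.N_eq_0[OF x2] by (simp add: xy zero_prod_def)
    qed
    assume y: "y \<in> state_space p"
    then have y2: "y2 \<in> Lp p {-1..0}" by (simp add: state_space_def xy)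
    show "x + y \<in> state_space p" using x2 y2 by (simp add: state_space_def xy)
    show "state_norm p (x + y) \<le> state_norm p x + state_norm p y"
      using norm_triangle_ineq[of x1 y1] L.N_triangle[OF x2 y2] by (simp add: state_norm_def xy)
  next
    fix f :: "nat \<Rightarrow> 'x \<times> 'x L0"
    assume f: "\<And>n. f n \<in> state_space p" and N: "\<And>n. state_norm p (f n) \<le> (1 / 3) ^ n"
    have f2: "snd (f n) \<in> Lp p {-1..0}" for n using f[of n] by (auto simp: state_space_def)
    have Nf: "norm (fst (f n)) + Lp_norm p (snd (f n)) \<le> (1 / 3) ^ n" for n
      using N[of n] by (simp add: state_norm_def case_prod_beta')
    have N1: "norm (fst (f n)) \<le> (1 / 3) ^ n" and N2: "Lp_norm p (snd (f n)) \<le> (1 / 3) ^ n" for n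
      using Nf[of n] norm_ge_zero[of "fst (f n)"] L.N_nonneg[of "snd (f n)"] by linarith+
    have "summable (\<lambda>n. fst (f n))"
      by (rule summable_comparison_test[of _ "\<lambda>n. (1 / 3) ^ n"])
        (use N1 in \<open>auto intro!: summable_geometric\<close>)
    then have "(\<lambda>n. \<Sum>i<n. fst (f i)) \<longlonglongrightarrow> (\<Sum>n. fst (f n))" by (rule summable_LIMSEQ)
    then have 1: "(\<lambda>n. norm ((\<Sum>i<n. fst (f i)) - (\<Sum>n. fst (f n)))) \<longlonglongrightarrow> 0"
      by (simp add: LIM_zero tendsto_norm_zero)
    obtain G where G: "G \<in> Lp p {-1..0}" "(\<lambda>n. Lp_norm p ((\<Sum>i<n. snd (f i)) - G)) \<longlonglongrightarrow> 0"
      using L.N_complete[OF f2 N2] by blast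
    have "state_norm p ((\<Sum>i<n. f i) - (\<Sum>n. fst (f n), G))
      = norm ((\<Sum>i<n. fst (f i)) - (\<Sum>n. fst (f n))) + Lp_norm p ((\<Sum>i<n. snd (f i)) - G)" for n
      by (simp add: state_norm_def case_prod_beta' fst_sum snd_sum)
    then have "(\<lambda>n. state_norm p ((\<Sum>i<n. f i) - (\<Sum>n. fst (f n), G))) \<longlonglongrightarrow> 0"
      using tendsto_add[OF 1 G(2)] by simp
    moreover have "(\<Sum>n. fst (f n), G) \<in> state_space p" using G(1) by (simp add: state_space_def)
    ultimately show "\<exists>s\<in>state_space p. (\<lambda>n. state_norm p ((\<Sum>i<n. f i) - s)) \<longlonglongrightarrow> 0" by blast
  qed
qed

text \<open>A subsequence converging fast enough in norm converges almost everywhere, and there the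
  closedness of the cone in \<open>'x\<close> applies pointwise.\<close>

lemma Lp_nonneg_closed:
  fixes F :: "nat \<Rightarrow> 'x::banach_lattice L0"
  assumes p: "1 \<le> p" and F: "\<And>n. F n \<in> Lp p {a..b}" "\<And>n. 0 \<le> F n" and G: "G \<in> Lp p {a..b}"
    and lim: "(\<lambda>n. Lp_norm p (F n - G)) \<longlonglongrightarrow> 0"
  shows "0 \<le> G"
proof -
  have S: "{a..b} \<in> sets lebesgue" by simp
  have p0: "0 < p" using p by simp
  obtain g where g: "G = abs_L0 g" "Lp_fun p UNIV g" by (rule LpE[OF G S]) blast
  note gs = Lp_fun_UNIV_sm[OF g(2)]
  have "\<exists>f. F n = abs_L0 f \<and> Lp_fun p UNIV f" for n by (rule LpE[OF F(1)[of n] S]) blast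
  then obtain f where f: "\<And>n. F n = abs_L0 (f n)" "\<And>n. Lp_fun p UNIV (f n)" by metis
  note fs = Lp_fun_UNIV_sm[OF f(2)]
  have f0: "AE t in lebesgue. 0 \<le> f n t" for n
    using F(2)[of n] unfolding f(1) by (simp add: zero_le_abs_L0_iff fs)
  have N: "Lp_norm p (F n - G) = Lp_fun_norm p UNIV (\<lambda>t. f n t - g t)" for n
    by (simp add: f(1) g(1) abs_L0_minus fs gs Lp_norm_abs strongly_measurable_diff)
  have "\<exists>n. Lp_fun_norm p UNIV (\<lambda>t. f n t - g t) < (1 / 2) ^ k" for k
  proof -
    have "\<forall>\<^sub>F n in sequentially. Lp_norm p (F n - G) < (1 / 2) ^ k" by (rule order_tendstoD(2)[OF lim]) simp
    then show ?thesis unfolding N by (rule eventually_happens'[OF sequentially_bot])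
  qed
  then obtain r where r: "\<And>k. Lp_fun_norm p UNIV (\<lambda>t. f (r k) t - g t) < (1 / 2) ^ k" for k :: nat by metis
  have int_le: "integral\<^sup>L lebesgue (\<lambda>t. norm (f (r k) t - g t) powr p) \<le> (1 / 2) ^ k" for k
  proof -
    have "integral\<^sup>L lebesgue (\<lambda>t. norm (f (r k) t - g t) powr p) \<le> ((1 / 2) ^ k) powr p"
      unfolding Lp_fun_norm_powr[OF p0, symmetric] using p r[of k] by (intro powr_mono2) simp_all
    also have "\<dots> \<le> ((1 / 2) ^ k) powr 1" using p by (intro powr_mono') (simp_all add: power_le_one)
    finally show ?thesis by simp
  qed
  have "AE t in lebesgue. summable (\<lambda>k. norm (f (r k) t - g t) powr p)"
  proof (rule AE_summable_of_integrals[where c = "\<lambda>k. (1 / 2) ^ k"])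
    have "Lp_fun p UNIV (\<lambda>t. f (r k) t - g t)" for k by (intro Lp_fun_diff p f(2) g(2)) simp
    then show "integrable lebesgue (\<lambda>t. norm (f (r k) t - g t) powr p)" for k by (simp add: Lp_fun_UNIV)
  qed (use int_le in \<open>simp_all add: summable_geometric\<close>)
  moreover have "AE t in lebesgue. \<forall>n. 0 \<le> f n t" using f0 by (simp add: AE_all_countable)
  ultimately have "AE t in lebesgue. 0 \<le> g t"
  proof eventually_elim
    case (elim t)
    have "(\<lambda>k. norm (f (r k) t - g t)) \<longlonglongrightarrow> 0"
      by (rule powr_tendsto_0_cancel[OF summable_LIMSEQ_zero[OF elim(1)] _ p0]) simp
    then have "(\<lambda>k. f (r k) t) \<longlonglongrightarrow> g t" by (simp add: tendsto_norm_zero_iff LIM_zero_iff)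
    then show ?case by (rule LIMSEQ_nonneg_lattice) (use elim(2) in blast)
  qed
  then show ?thesis unfolding g(1) by (simp add: zero_le_abs_L0_iff gs)
qed

section \<open>Resolvents and Dirichlet operators\<close>

text \<open>At a real point the complexified equation decouples into two copies of the real one.
  Uniqueness of the pair gives uniqueness of its first component when the second is kept.\<close>

lemma resolvent_set_real_unique:
  assumes "complex_of_real l \<in> resolvent_set A"
  shows "\<exists>!x. (x, l *\<^sub>R x - y) \<in> A"
proof -
  have "\<exists>!z. (z, cscale (complex_of_real l) z - (y, y)) \<in> complexify A"
    using assms by (simp add: resolvent_set_def)
  then have ex: "\<exists>!z. (fst z, l *\<^sub>R fst z - y) \<in> A \<and> (snd z, l *\<^sub>R snd z - y) \<in> A"
    by (simp add: cscale_def complexify_def case_prod_beta')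
  then obtain z where z: "(fst z, l *\<^sub>R fst z - y) \<in> A" "(snd z, l *\<^sub>R snd z - y) \<in> A" by blast
  show ?thesis
  proof (rule ex1I[of _ "fst z"])
    fix x assume "(x, l *\<^sub>R x - y) \<in> A"
    then have "(x, snd z) = z" using ex z by (metis fst_conv snd_conv)
    then show "x = fst z" by (metis fst_conv)
  qed (rule z(1))
qed

lemma spectral_bound_less_imp_resolvent_set:
  assumes "spectral_bound A < ereal l"
  shows "complex_of_real l \<in> resolvent_set A"
proof (rule ccontr)
  assume "complex_of_real l \<notin> resolvent_set A"
  then have "complex_of_real l \<in> spectrum A" by (simp add: spectrum_def)
  then have "ereal (Re (complex_of_real l)) \<le> spectral_bound A"
    unfolding spectral_bound_def by (rule SUP_upper)
  then show False using assms by simp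
qed

text \<open>Real numbers \<open>s \<ge> 1\<close> lie outside the spectrum. The resulting
  solvability and bound on this half line are the inputs of \<open>positive_inverse\<close>.\<close>

lemma spectral_radius_less_one:
  fixes S :: "'x::real_normed_vector \<Rightarrow> 'x"
  assumes r: "spectral_radius S < 1" and S: "linear S" and s: "1 \<le> s"
  shows "\<exists>z. s *\<^sub>R z - S z = y" and "\<exists>K. \<forall>z. norm z \<le> K * norm (s *\<^sub>R z - S z)"
proof -
  have res: "complex_of_real s \<in> resolvent_set {(x, S x) | x. True}"
  proof (rule ccontr)
    assume "complex_of_real s \<notin> resolvent_set {(x, S x) | x. True}"
    then have "complex_of_real s \<in> spectrum {(x, S x) | x. True}" by (simp add: spectrum_def)
    then have "ennreal (cmod (complex_of_real s)) \<le> spectral_radius S"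
      unfolding spectral_radius_def by (rule SUP_upper)
    also have "\<dots> < 1" by (rule r)
    finally have "ennreal s < 1" using s by simp
    then show False using s by (metis ennreal_1 ennreal_leI not_le)
  qed
  obtain x where "(x, s *\<^sub>R x - y) \<in> {(x, S x) | x. True}"
    using resolvent_set_real_unique[OF res, of y] by blast
  then have "s *\<^sub>R x - S x = y" by (auto simp: algebra_simps)
  then show "\<exists>z. s *\<^sub>R z - S z = y" ..
  obtain K where K: "\<And>z w. (z, cscale (complex_of_real s) z - w) \<in> complexify {(x, S x) | x. True}
      \<Longrightarrow> norm z \<le> K * norm w"
    using res by (auto simp: resolvent_set_def)
  have "norm z \<le> K * norm (s *\<^sub>R z - S z)" for z
  proof -
    have "norm (z, 0 :: 'x) \<le> K * norm (s *\<^sub>R z - S z, 0 :: 'x)"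
      by (rule K) (simp add: cscale_def complexify_def linear_0[OF S])
    then show ?thesis by (simp add: norm_Pair)
  qed
  then show "\<exists>K. \<forall>z. norm z \<le> K * norm (s *\<^sub>R z - S z)" by blast
qed

section \<open>The stationary boundary value problem\<close>

locale boundary_system =
  fixes J Am :: "'z::real_vector \<Rightarrow> 'x::banach_lattice" and G M :: "'z \<Rightarrow> 'u::banach_lattice"
  assumes J_lin: "linear J" and J_inj: "inj J" and Am_lin: "linear Am"
    and G_lin: "linear G" and G_surj: "surj G" and M_lin: "linear M"
    and M_pos: "0 \<le> J z \<Longrightarrow> 0 \<le> M z"
    and R_pos: "spectral_bound (ker_graph J Am G) < ereal l \<Longrightarrow> 0 \<le> x \<Longrightarrow>
      0 \<le> resolvent l (ker_graph J Am G) x"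
    and D_pos: "spectral_bound (ker_graph J Am G) < ereal l \<Longrightarrow> 0 \<le> u \<Longrightarrow>
      0 \<le> J (dirichlet J Am G l u)"
begin

abbreviation "sA \<equiv> spectral_bound (ker_graph J Am G)"

text \<open>\<open>bvp l y u\<close> is \<open>R(l,A) y + D\<^sub>l u\<close> as an element of \<open>Z\<close>.\<close>

definition bvp :: "real \<Rightarrow> 'x \<Rightarrow> 'u \<Rightarrow> 'z" where
  "bvp l y u = (THE z. l *\<^sub>R J z - Am z = y \<and> G z = u)"

lemma bvp_unique:
  assumes l: "sA < ereal l" and eq: "l *\<^sub>R J z - Am z = l *\<^sub>R J z' - Am z'" "G z = G z'"
  shows "z = z'"
proof -
  have "(J (z - z'), l *\<^sub>R J (z - z') - 0) \<in> ker_graph J Am G"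
    unfolding ker_graph_def using eq
    by (auto simp: linear_diff[OF J_lin] linear_diff[OF Am_lin] linear_diff[OF G_lin] algebra_simps
        intro!: exI[of _ "z - z'"])
  moreover have "(0, l *\<^sub>R 0 - 0) \<in> ker_graph J Am G"
    unfolding ker_graph_def
    by (auto simp: linear_0[OF J_lin] linear_0[OF Am_lin] linear_0[OF G_lin] intro!: exI[of _ 0])
  ultimately have "J (z - z') = 0"
    using resolvent_set_real_unique[OF spectral_bound_less_imp_resolvent_set[OF l], of 0] by blast
  then have "J z = J z'" by (simp add: linear_diff[OF J_lin])
  then show ?thesis by (rule injD[OF J_inj])
qed

text \<open>Any \<open>z0\<close> with boundary value \<open>u\<close> is corrected by an element of
  the kernel of \<open>G\<close>, which the resolvent of \<open>A\<close> provides.\<close>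

lemma bvp_ex:
  assumes l: "sA < ereal l"
  shows "\<exists>z. l *\<^sub>R J z - Am z = y \<and> G z = u"
proof -
  obtain z0 where z0: "G z0 = u" using G_surj by (metis surjD)
  obtain x where "(x, l *\<^sub>R x - (y - (l *\<^sub>R J z0 - Am z0))) \<in> ker_graph J Am G"
    using resolvent_set_real_unique[OF spectral_bound_less_imp_resolvent_set[OF l]] by blast
  then obtain z1 where z1: "x = J z1" "l *\<^sub>R x - (y - (l *\<^sub>R J z0 - Am z0)) = Am z1" "G z1 = 0"
    by (auto simp: ker_graph_def)
  have "l *\<^sub>R J (z0 + z1) - Am (z0 + z1) = y" "G (z0 + z1) = u"
    using z0 z1 by (simp_all add: linear_add[OF J_lin] linear_add[OF Am_lin] linear_add[OF G_lin]
        algebra_simps flip: z1(2))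
  then show ?thesis by blast
qed

lemma bvp:
  assumes l: "sA < ereal l"
  shows "l *\<^sub>R J (bvp l y u) - Am (bvp l y u) = y" "G (bvp l y u) = u"
proof -
  have "\<exists>!z. l *\<^sub>R J z - Am z = y \<and> G z = u"
    using bvp_ex[OF l, of y u] bvp_unique[OF l] by (metis (no_types, lifting))
  from theI'[OF this] show "l *\<^sub>R J (bvp l y u) - Am (bvp l y u) = y" "G (bvp l y u) = u"
    by (simp_all add: bvp_def)
qed

lemma bvp_eqI: "sA < ereal l \<Longrightarrow> l *\<^sub>R J z - Am z = y \<Longrightarrow> G z = u \<Longrightarrow> bvp l y u = z"
  using bvp_unique[of l "bvp l y u" z] bvp[of l y u] by simp

lemma bvp_add: "sA < ereal l \<Longrightarrow> bvp l (y + y') (u + u') = bvp l y u + bvp l y' u'"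
  using bvp[of l y u] bvp[of l y' u']
  by (intro bvp_eqI)
    (simp_all add: linear_add[OF J_lin] linear_add[OF Am_lin] linear_add[OF G_lin] scaleR_add_right
      add_diff_add)

lemma bvp_scaleR:
  assumes l: "sA < ereal l"
  shows "bvp l (c *\<^sub>R y) (c *\<^sub>R u) = c *\<^sub>R bvp l y u"
proof (rule bvp_eqI[OF l])
  have "l *\<^sub>R J (c *\<^sub>R bvp l y u) - Am (c *\<^sub>R bvp l y u) = c *\<^sub>R (l *\<^sub>R J (bvp l y u) - Am (bvp l y u))"
    by (simp add: linear_scale[OF J_lin] linear_scale[OF Am_lin] scaleR_diff_right mult.commute)
  then show "l *\<^sub>R J (c *\<^sub>R bvp l y u) - Am (c *\<^sub>R bvp l y u) = c *\<^sub>R y" by (simp only: bvp(1)[OF l])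
  show "G (c *\<^sub>R bvp l y u) = c *\<^sub>R u" by (simp only: linear_scale[OF G_lin] bvp(2)[OF l])
qed

lemma bvp_linear_left: "sA < ereal l \<Longrightarrow> linear (\<lambda>y. bvp l y 0)"
  using bvp_add[of l _ _ 0 0] bvp_scaleR[of l _ _ 0] by (intro linearI) simp_all

lemma bvp_linear_right: "sA < ereal l \<Longrightarrow> linear (\<lambda>u. bvp l 0 u)"
  using bvp_add[of l 0 0] bvp_scaleR[of l _ 0] by (intro linearI) simp_all

lemma bvp_split: "sA < ereal l \<Longrightarrow> bvp l y u = bvp l y 0 + bvp l 0 u"
  using bvp_add[of l y 0 0 u] by simp

lemma dirichlet_eq_bvp: "dirichlet J Am G l u = bvp l 0 u"
  by (simp add: dirichlet_def bvp_def)

lemma resolvent_eq_bvp: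
  assumes l: "sA < ereal l"
  shows "resolvent l (ker_graph J Am G) y = J (bvp l y 0)"
proof -
  have "(J (bvp l y 0), l *\<^sub>R J (bvp l y 0) - y) \<in> ker_graph J Am G"
    unfolding ker_graph_def using bvp[OF l, of y 0] by (auto simp: algebra_simps intro!: exI[of _ "bvp l y 0"])
  then show ?thesis
    unfolding resolvent_def
    using resolvent_set_real_unique[OF spectral_bound_less_imp_resolvent_set[OF l], of y]
    by (intro the1_equality)
qed

lemma J_bvp_left_pos: "sA < ereal l \<Longrightarrow> 0 \<le> y \<Longrightarrow> 0 \<le> J (bvp l y 0)"
  using R_pos[of l y] by (simp add: resolvent_eq_bvp)

lemma J_bvp_right_pos: "sA < ereal l \<Longrightarrow> 0 \<le> u \<Longrightarrow> 0 \<le> J (bvp l 0 u)"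
  using D_pos[of l u] by (simp add: dirichlet_eq_bvp)

lemma J_bvp_pos: "sA < ereal l \<Longrightarrow> 0 \<le> y \<Longrightarrow> 0 \<le> u \<Longrightarrow> 0 \<le> J (bvp l y u)"
  by (subst bvp_split) (simp_all add: linear_add[OF J_lin] J_bvp_left_pos J_bvp_right_pos)

text \<open>A resolvent identity for \<open>R(l,A)\<close> and \<open>D\<^sub>l\<close> at once: the
  solution for \<open>l0\<close> solves the problem for \<open>l\<close> with
  \<open>(l - l0) *\<^sub>R J (bvp l0 y u)\<close> added to the data. For positive data and
  \<open>l \<ge> l0\<close> the correction is positive, hence solutions decrease as \<open>l\<close>
  grows.\<close>

lemma bvp_resolvent_identity:
  assumes l0: "sA < ereal l0" and l: "sA < ereal l"
  shows "bvp l0 y u = bvp l y u + (l - l0) *\<^sub>R bvp l (J (bvp l0 y u)) 0"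
proof -
  have "bvp l (y + (l - l0) *\<^sub>R J (bvp l0 y u)) (u + (l - l0) *\<^sub>R 0) = bvp l0 y u"
    using bvp[OF l0, of y u] by (intro bvp_eqI l) (simp_all add: algebra_simps)
  then show ?thesis by (simp only: bvp_add[OF l] bvp_scaleR[OF l])
qed

lemma bvp_antimono:
  assumes l0: "sA < ereal l0" and l: "l0 \<le> l" and y: "0 \<le> y" and u: "0 \<le> u"
  shows "J (bvp l y u) \<le> J (bvp l0 y u)" "M (bvp l y u) \<le> M (bvp l0 y u)"
proof -
  have l': "sA < ereal l" using l0 l by (meson ereal_less_eq(3) less_le_trans)
  define z where "z = bvp l (J (bvp l0 y u)) 0"
  have z: "0 \<le> J z" unfolding z_def by (intro J_bvp_left_pos l' J_bvp_pos l0 y u)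
  note id = bvp_resolvent_identity[OF l0 l', of y u, folded z_def]
  have "0 \<le> (l - l0) *\<^sub>R J z" "0 \<le> (l - l0) *\<^sub>R M z"
    using l z M_pos[OF z] by (auto intro: scaleR_nonneg_nonneg)
  then show "J (bvp l y u) \<le> J (bvp l0 y u)" "M (bvp l y u) \<le> M (bvp l0 y u)"
    by (subst id, simp add: linear_add[OF J_lin] linear_scale[OF J_lin] linear_add[OF M_lin] linear_scale[OF M_lin])+
qed

lemma linear_compose_bvp:
  assumes l: "sA < ereal l"
  shows "linear (\<lambda>y. J (bvp l y 0))" "linear (\<lambda>u. J (bvp l 0 u))"
    "linear (\<lambda>y. M (bvp l y 0))" "linear (\<lambda>u. M (bvp l 0 u))"
  using linear_compose[OF bvp_linear_left[OF l] J_lin] linear_compose[OF bvp_linear_right[OF l] J_lin]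
    linear_compose[OF bvp_linear_left[OF l] M_lin] linear_compose[OF bvp_linear_right[OF l] M_lin]
  by (simp_all add: o_def)

text \<open>A positive operator is bounded in norm by its action on absolute values, so domination
  by \<open>S l0\<close> on the positive cone makes a bound for \<open>S l0\<close> valid for all
  larger parameters.\<close>

lemma uniform_norm_bound:
  fixes S :: "real \<Rightarrow> 'a::banach_lattice \<Rightarrow> 'b::banach_lattice"
  assumes lin: "\<And>l. l0 \<le> l \<Longrightarrow> linear (S l)" and pos: "\<And>l x. l0 \<le> l \<Longrightarrow> 0 \<le> x \<Longrightarrow> 0 \<le> S l x"
    and anti: "\<And>l x. l0 \<le> l \<Longrightarrow> 0 \<le> x \<Longrightarrow> S l x \<le> S l0 x"
  shows "\<exists>K>0. \<forall>l\<ge>l0. \<forall>x. norm (S l x) \<le> K * norm x"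
proof -
  have "bounded_linear (S l0)" by (rule positive_linear_bounded[OF lin pos]) simp_all
  then obtain K where K: "K > 0" "\<And>x. norm (S l0 x) \<le> norm x * K" using bounded_linear.pos_bounded by blast
  have "norm (S l x) \<le> K * norm x" if l: "l0 \<le> l" for l x
  proof -
    have "norm (S l x) \<le> norm (S l \<bar>x\<bar>)" by (rule positive_linear_norm_le[OF lin[OF l] pos[OF l]])
    also have "\<dots> \<le> norm (S l0 \<bar>x\<bar>)" by (intro norm_mono_nonneg pos anti l abs_ge_zero)
    also have "\<dots> \<le> K * norm x" using K(2)[of "\<bar>x\<bar>"] by (simp add: norm_abs_lattice mult.commute)
    finally show ?thesis .
  qed
  then show ?thesis using K(1) by blast
qed

end

section \<open>The resolvent of the delay operator\<close>

lemma delay_op_exp_linear: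
  fixes m :: "real \<Rightarrow> 'x::real_normed_vector \<Rightarrow>\<^sub>L 'y::banach"
  assumes m: "delay_kernel m"
  shows "linear (\<lambda>x. delay_op m (\<lambda>t. exp (l * t) *\<^sub>R x))"
proof (rule linearI)
  have cont: "continuous_on {-1..0} (\<lambda>t. exp (l * t) *\<^sub>R x)" for x :: 'x by (intro continuous_intros)
  fix x y :: 'x and c :: real
  show "delay_op m (\<lambda>t. exp (l * t) *\<^sub>R (x + y)) = delay_op m (\<lambda>t. exp (l * t) *\<^sub>R x) + delay_op m (\<lambda>t. exp (l * t) *\<^sub>R y)"
    using delay_op_add[OF m cont cont, of x y] by (simp add: scaleR_add_right)
  show "delay_op m (\<lambda>t. exp (l * t) *\<^sub>R (c *\<^sub>R x)) = c *\<^sub>R delay_op m (\<lambda>t. exp (l * t) *\<^sub>R x)"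
    using delay_op_scaleR[OF m cont, of c x] by (simp add: mult.commute)
qed

lemma positive_on_W1pD:
  assumes "positive_on_W1p p S" "W1p_deriv p (-1) 0 f g" "\<And>t. t \<in> {-1..0} \<Longrightarrow> 0 \<le> f t"
  shows "0 \<le> S f"
proof -
  have "f \<in> W1p p (-1) 0" using assms(2) by (auto simp: W1p_def)
  moreover have "AE t in lebesgue_on {-1..0}. 0 \<le> f t"
    using assms(3) by (intro AE_I2) (simp add: space_restrict_space)
  ultimately show ?thesis using assms(1) by (simp add: positive_on_W1p_def)
qed

lemma L0_of_eq_abs: "L0_of S f = abs_L0 (\<lambda>t. if t \<in> S then f t else 0)"
  by (simp add: L0_of_def)

lemma Lp_fun_restrict_sm:
  "Lp_fun p S f \<Longrightarrow> S \<in> sets lebesgue \<Longrightarrow> strongly_measurable UNIV (\<lambda>t. if t \<in> S then f t else 0)"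
  by (simp add: strongly_measurable_restrict_iff Lp_fun_def)

lemma L0_of_scale_diff:
  assumes "Lp_fun p S f" "Lp_fun p S g" "S \<in> sets lebesgue"
  shows "l *\<^sub>R L0_of S f - L0_of S g = L0_of S (\<lambda>t. l *\<^sub>R f t - g t)"
proof -
  note sm = Lp_fun_restrict_sm[OF assms(1,3)] Lp_fun_restrict_sm[OF assms(2,3)]
  have "(\<lambda>t. l *\<^sub>R (if t \<in> S then f t else 0) - (if t \<in> S then g t else 0))
      = (\<lambda>t. if t \<in> S then l *\<^sub>R f t - g t else 0)" by auto
  then show ?thesis
    by (simp add: L0_of_eq_abs abs_L0_scaleR abs_L0_minus sm strongly_measurable_scaleR)
qed

lemma zero_le_L0_of_iff:
  assumes "Lp_fun p S f" "S \<in> sets lebesgue"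
  shows "0 \<le> L0_of S f \<longleftrightarrow> (AE t in lebesgue_on S. 0 \<le> f t)"
proof -
  have S: "S \<inter> space lebesgue \<in> sets lebesgue" using assms(2) by simp
  have "0 \<le> L0_of S f \<longleftrightarrow> (AE t in lebesgue. 0 \<le> (if t \<in> S then f t else 0))"
    unfolding L0_of_eq_abs by (rule zero_le_abs_L0_iff[OF Lp_fun_restrict_sm[OF assms]])
  also have "\<dots> \<longleftrightarrow> (AE t in lebesgue. t \<in> S \<longrightarrow> 0 \<le> f t)" by (intro AE_cong) auto
  finally show ?thesis unfolding AE_restrict_space_iff[OF S] .
qed

locale delay_system = boundary_system J Am G M
  for J Am :: "'z::real_vector \<Rightarrow> 'x::banach_lattice" and G M :: "'z \<Rightarrow> 'u::banach_lattice" +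
  fixes p l0 :: real and \<mu> :: "real \<Rightarrow> 'x \<Rightarrow>\<^sub>L 'x" and \<nu> :: "real \<Rightarrow> 'x \<Rightarrow>\<^sub>L 'u"
  assumes p: "1 \<le> p" and \<mu>: "delay_kernel \<mu>" and \<nu>: "delay_kernel \<nu>"
    and P_pos: "positive_on_W1p p (delay_op \<mu>)" and L_pos: "positive_on_W1p p (delay_op \<nu>)"
    and l0: "sA < ereal l0" and radius: "spectral_radius (\<lambda>u. M (dirichlet J Am G l0 u)) < 1"
begin

abbreviation "Pe l x \<equiv> delay_op \<mu> (\<lambda>t. exp (l * t) *\<^sub>R x)"
abbreviation "Le l x \<equiv> delay_op \<nu> (\<lambda>t. exp (l * t) *\<^sub>R x)"

lemma Pe_pos: "0 \<le> x \<Longrightarrow> 0 \<le> Pe l x"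
  by (rule positive_on_W1pD[OF P_pos W1p_deriv_exp[OF p]]) (simp add: scaleR_nonneg_nonneg)

lemma Le_pos: "0 \<le> x \<Longrightarrow> 0 \<le> Le l x"
  by (rule positive_on_W1pD[OF L_pos W1p_deriv_exp[OF p]]) (simp add: scaleR_nonneg_nonneg)

lemma Pe_linear: "linear (Pe l)" and Le_linear: "linear (Le l)"
  by (rule delay_op_exp_linear[OF \<mu>], rule delay_op_exp_linear[OF \<nu>])

text \<open>The resolvent equation of the delay operator becomes this system with \<open>x = \<phi> 0\<close> and \<open>u = G z\<close>.\<close>

lemma reduced_system:
  "\<exists>l1. \<forall>l\<ge>l1. 0 < l \<and> sA < ereal l \<and>
    (\<forall>x u. 0 \<le> x - (J (bvp l (Pe l x) 0) + J (bvp l 0 u)) \<longrightarrow>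
      0 \<le> u - ((M (bvp l (Pe l x) 0) + Le l x) + M (bvp l 0 u)) \<longrightarrow> 0 \<le> x \<and> 0 \<le> u) \<and>
    (\<forall>f g. \<exists>x u. x - (J (bvp l (Pe l x) 0) + J (bvp l 0 u)) = f \<and>
      u - ((M (bvp l (Pe l x) 0) + Le l x) + M (bvp l 0 u)) = g)"
proof -
  have sA_mono: "sA < ereal l" if "l0 \<le> l" for l
    using l0 that by (meson ereal_less_eq(3) less_le_trans)
  note lin = linear_compose_bvp[OF sA_mono]
  obtain K1 where K1: "K1 > 0" "\<And>l y. l0 \<le> l \<Longrightarrow> norm (J (bvp l y 0)) \<le> K1 * norm y"
    using uniform_norm_bound[of l0 "\<lambda>l y. J (bvp l y 0)"] lin(1) J_bvp_left_pos sA_mono bvp_antimono(1)[OF l0]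
    by (metis order_refl)
  obtain K2 where K2: "K2 > 0" "\<And>l u. l0 \<le> l \<Longrightarrow> norm (J (bvp l 0 u)) \<le> K2 * norm u"
    using uniform_norm_bound[of l0 "\<lambda>l u. J (bvp l 0 u)"] lin(2) J_bvp_right_pos sA_mono bvp_antimono(1)[OF l0]
    by (metis order_refl)
  obtain K3 where K3: "K3 > 0" "\<And>l y. l0 \<le> l \<Longrightarrow> norm (M (bvp l y 0)) \<le> K3 * norm y"
    using uniform_norm_bound[of l0 "\<lambda>l y. M (bvp l y 0)"] lin(3) M_pos[OF J_bvp_left_pos] sA_mono bvp_antimono(2)[OF l0]
    by (metis order_refl)
  define d0 where "d0 u = M (bvp l0 0 u)" for u
  have d0_lin: "linear d0" unfolding d0_def by (rule lin(4)) simp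
  have d0_pos: "0 \<le> d0 u" if "0 \<le> u" for u unfolding d0_def by (intro M_pos J_bvp_right_pos l0 that)
  have d0_radius: "spectral_radius d0 < 1" using radius by (simp add: d0_def[abs_def] dirichlet_eq_bvp)
  \<comment> \<open>\<open>C\<close> belongs to \<open>d0\<close>, the operator at
    \<open>l0\<close>, and is fixed before \<open>l\<close> is chosen.\<close>
  obtain C where C: "0 < C" "\<And>u v. 0 \<le> u \<Longrightarrow> u \<le> d0 u + v \<Longrightarrow> norm u \<le> C * norm v"
    using subinvariant_norm_bound[OF d0_lin d0_pos spectral_radius_less_one[OF d0_radius d0_lin]] by blast
  \<comment> \<open>The entries starting from \<open>x\<close> will be bounded by
    \<open>K1 * \<eta>\<close> and \<open>(K3 + 1) * \<eta>\<close>. The smallness condition of the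
    coupled system then reads \<open>H * \<eta> \<le> 1 / 2\<close>, which determines
    \<eta>.\<close>
  define H where "H = K1 + K2 * C * (K3 + 1)"
  have H: "H > 0" unfolding H_def using K1(1) K2(1) K3(1) C(1) by (intro add_pos_pos mult_pos_pos) simp_all
  define \<eta> where "\<eta> = 1 / (2 * H)"
  have \<eta>: "0 < \<eta>" using H by (simp add: \<eta>_def)
  obtain l1 where l1: "\<And>l x. l1 \<le> l \<Longrightarrow> norm (Pe l x) \<le> \<eta> * norm x" using delay_op_exp_small[OF \<mu> \<eta>] by blast
  obtain l2 where l2: "\<And>l x. l2 \<le> l \<Longrightarrow> norm (Le l x) \<le> \<eta> * norm x" using delay_op_exp_small[OF \<nu> \<eta>] by blast
  show ?thesis
  proof (intro exI[of _ "max (max l1 l2) (max l0 1)"] allI impI)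
    fix l assume "max (max l1 l2) (max l0 1) \<le> l"
    then have l: "l1 \<le> l" "l2 \<le> l" "l0 \<le> l" "1 \<le> l" by simp_all
    note sl = sA_mono[OF l(3)]
    define a where "a x = J (bvp l (Pe l x) 0)" for x
    define b where "b u = J (bvp l 0 u)" for u
    define c where "c x = M (bvp l (Pe l x) 0) + Le l x" for x
    define d where "d u = M (bvp l 0 u)" for u
    have lins: "linear a" "linear b" "linear c" "linear d"
      unfolding a_def[abs_def] b_def[abs_def] c_def[abs_def] d_def[abs_def]
      using linear_compose[OF Pe_linear lin(1)[OF l(3)]] lin(2)[OF l(3)]
        linear_compose_add[OF linear_compose[OF Pe_linear lin(3)[OF l(3)]] Le_linear] lin(4)[OF l(3)]
      by (simp_all add: o_def)
    have pos: "0 \<le> a x" "0 \<le> c x" if "0 \<le> x" for x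
      unfolding a_def c_def
      by (intro J_bvp_left_pos Pe_pos sl that add_nonneg_nonneg M_pos Le_pos)+
    have pos': "0 \<le> b u" "0 \<le> d u" if "0 \<le> u" for u
      unfolding b_def d_def by (intro J_bvp_right_pos sl that M_pos)+
    have dom: "d u \<le> d0 u" if "0 \<le> u" for u
      unfolding d_def d0_def by (intro bvp_antimono l0 l that order_refl)
    have b_le: "norm (b u) \<le> K2 * norm u" for u unfolding b_def by (rule K2(2)[OF l(3)])
    have a_le: "norm (a x) \<le> (K1 * \<eta>) * norm x" for x
    proof -
      have "norm (a x) \<le> K1 * norm (Pe l x)" unfolding a_def by (rule K1(2)[OF l(3)])
      also have "\<dots> \<le> K1 * (\<eta> * norm x)" using K1(1) by (intro mult_left_mono l1 l) simp
      finally show ?thesis by simp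
    qed
    have c_le: "norm (c x) \<le> ((K3 + 1) * \<eta>) * norm x" for x
    proof -
      have "norm (c x) \<le> norm (M (bvp l (Pe l x) 0)) + norm (Le l x)" unfolding c_def by (rule norm_triangle_ineq)
      also have "\<dots> \<le> K3 * norm (Pe l x) + \<eta> * norm x" by (intro add_mono K3(2)[OF l(3)] l2 l)
      also have "\<dots> \<le> K3 * (\<eta> * norm x) + \<eta> * norm x"
        using K3(1) by (intro add_right_mono mult_left_mono l1 l) simp
      finally show ?thesis by (simp add: algebra_simps)
    qed
    have small: "K1 * \<eta> + K2 * C * ((K3 + 1) * \<eta>) \<le> 1 / 2"
    proof -
      have "K1 * \<eta> + K2 * C * ((K3 + 1) * \<eta>) = H * \<eta>" by (simp add: H_def algebra_simps)
      also have "\<dots> = 1 / 2" using H by (simp add: \<eta>_def)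
      finally show ?thesis by simp
    qed
    have K2': "0 \<le> K2" and c0: "0 \<le> (K3 + 1) * \<eta>" using K2(1) K3(1) \<eta> by simp_all
    have nonneg: "0 \<le> x \<and> 0 \<le> u" if "0 \<le> x - (a x + b u)" "0 \<le> u - (c x + d u)" for x u
      by (rule block_system_nonneg[of a b c d d0 C K2 "K1 * \<eta>" "(K3 + 1) * \<eta>" x u];
          fact lins pos pos' dom C b_le K2' a_le c_le c0 small that)
    have solv: "\<exists>x u. x - (a x + b u) = f \<and> u - (c x + d u) = g" for f g
      by (rule block_system_solvable[of a b c d d0 C K2 "K1 * \<eta>" "(K3 + 1) * \<eta>" f g];
          fact lins pos pos' dom C b_le K2' a_le c_le c0 small)
    show "0 < l \<and> sA < ereal l \<and>
      (\<forall>x u. 0 \<le> x - (J (bvp l (Pe l x) 0) + J (bvp l 0 u)) \<longrightarrow>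
        0 \<le> u - ((M (bvp l (Pe l x) 0) + Le l x) + M (bvp l 0 u)) \<longrightarrow> 0 \<le> x \<and> 0 \<le> u) \<and>
      (\<forall>f g. \<exists>x u. x - (J (bvp l (Pe l x) 0) + J (bvp l 0 u)) = f \<and>
        u - ((M (bvp l (Pe l x) 0) + Le l x) + M (bvp l 0 u)) = g)"
      using l(4) sl nonneg solv unfolding a_def b_def c_def d_def by auto
  qed
qed

abbreviation "AA \<equiv> delay_graph p J Am G M (delay_op \<mu>) (delay_op \<nu>)"

lemma W1p_derivD:
  assumes "W1p_deriv p (-1) 0 \<phi> \<phi>'"
  shows "continuous_on {-1..0} \<phi>" "Lp_fun p {-1..0} \<phi>" "Lp_fun p {-1..0} \<phi>'"
proof -
  show c: "continuous_on {-1..0} \<phi>" by (rule W1p_deriv_continuous[OF p assms])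
  show "Lp_fun p {-1..0} \<phi>" using p by (intro continuous_imp_Lp_fun c) simp
  show "Lp_fun p {-1..0} \<phi>'" using assms unfolding W1p_deriv_def by blast
qed

lemma delay_op_split:
  fixes m :: "real \<Rightarrow> 'x \<Rightarrow>\<^sub>L 'y::banach"
  assumes m: "delay_kernel m" and \<psi>: "Lp_fun p {-1..0} \<psi>"
    and \<phi>: "\<And>t. t \<in> {-1..0} \<Longrightarrow> \<phi> t = exp (l * t) *\<^sub>R x + shift_solution l \<psi> t"
  shows "delay_op m \<phi> = delay_op m (\<lambda>t. exp (l * t) *\<^sub>R x) + delay_op m (shift_solution l \<psi>)"
proof -
  have "delay_op m \<phi> = delay_op m (\<lambda>t. exp (l * t) *\<^sub>R x + shift_solution l \<psi> t)"
    by (rule delay_op_cong[OF \<phi>])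
  also have "\<dots> = delay_op m (\<lambda>t. exp (l * t) *\<^sub>R x) + delay_op m (shift_solution l \<psi>)"
    by (intro delay_op_add m W1p_derivD(1)[OF shift_solution_W1p[OF p \<psi>]] continuous_intros)
  finally show ?thesis .
qed

lemma S_sets: "{-1..0::real} \<in> sets lebesgue" by simp

text \<open>The reduction is reversed: from a solution \<open>(x, u)\<close> of the system one
  builds \<phi> and \<open>z\<close>. The two equations are exactly the coupling
  \<open>J z = \<phi> 0\<close> and the boundary condition
  \<open>G z - M z = L \<phi>\<close>.\<close>

lemma delay_graph_surj:
  assumes l: "sA < ereal l"
    and solv: "\<And>f g. \<exists>x u. x - (J (bvp l (Pe l x) 0) + J (bvp l 0 u)) = f \<and>
      u - ((M (bvp l (Pe l x) 0) + Le l x) + M (bvp l 0 u)) = g"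
    and w: "w \<in> state_space p"
  shows "\<exists>v. (v, l *\<^sub>R v - w) \<in> AA"
proof -
  obtain y \<psi> where w_eq: "w = (y, L0_of {-1..0} \<psi>)" and \<psi>: "Lp_fun p {-1..0} \<psi>"
    using w by (auto simp: state_space_def Lp_def)
  define E where "E = shift_solution l \<psi>"
  note E_W = shift_solution_W1p[OF p \<psi>, of l, folded E_def]
  define PE where "PE = delay_op \<mu> E"
  define LE where "LE = delay_op \<nu> E"
  obtain x u where x: "x - (J (bvp l (Pe l x) 0) + J (bvp l 0 u)) = J (bvp l (y + PE) 0)"
    and u: "u - ((M (bvp l (Pe l x) 0) + Le l x) + M (bvp l 0 u)) = M (bvp l (y + PE) 0) + LE"
    using solv by blast
  define \<phi> where "\<phi> t = exp (l * t) *\<^sub>R x + E t" for t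
  have P\<phi>: "delay_op \<mu> \<phi> = Pe l x + PE" and L\<phi>: "delay_op \<nu> \<phi> = Le l x + LE"
    unfolding PE_def LE_def E_def
    by (rule delay_op_split[OF \<mu> \<psi>], simp add: \<phi>_def E_def)
      (rule delay_op_split[OF \<nu> \<psi>], simp add: \<phi>_def E_def)
  \<comment> \<open>Here \<open>z\<close> is built from \<open>u\<close> and \<phi>. That it
    restricts to \<open>x\<close>, so that \<open>J z = x\<close>, is the first equation of the
    system.\<close>
  define z where "z = bvp l (y + delay_op \<mu> \<phi>) u"
  have z_eq: "z = (bvp l (y + PE) 0 + bvp l (Pe l x) 0) + bvp l 0 u"
    using bvp_split[OF l, of "y + delay_op \<mu> \<phi>" u] bvp_add[OF l, of "y + PE" "Pe l x" 0 0]
    by (simp add: z_def P\<phi> algebra_simps)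
  have z: "l *\<^sub>R J z - Am z = y + delay_op \<mu> \<phi>" "G z = u" unfolding z_def using bvp[OF l] by auto
  have Jz: "J z = x" unfolding z_eq using x by (simp add: linear_add[OF J_lin] diff_eq_eq add_ac)
  have Mz: "M z + delay_op \<nu> \<phi> = u"
    unfolding z_eq L\<phi> using u by (simp add: linear_add[OF M_lin] diff_eq_eq add_ac)
  define \<phi>' where "\<phi>' t = l *\<^sub>R \<phi> t - \<psi> t" for t
  have \<phi>_W: "W1p_deriv p (-1) 0 \<phi> \<phi>'"
    unfolding W1p_deriv_def
  proof (intro conjI ballI)
    note X_W = W1p_deriv_exp[OF p, of l x]
    have \<phi>'_eq: "\<phi>' t = (l * exp (l * t)) *\<^sub>R x + (l *\<^sub>R E t - \<psi> t)" for t
      by (simp add: \<phi>'_def \<phi>_def algebra_simps)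
    show "Lp_fun p {-1..0} \<phi>'"
      unfolding \<phi>'_eq by (intro Lp_fun_add S_sets p W1p_derivD(3)[OF X_W] W1p_derivD(3)[OF E_W])
    fix t :: real assume t: "t \<in> {-1..0}"
    have sub: "{-1..t} \<subseteq> {-1..0}" using t by auto
    have int: "(\<lambda>t. (l * exp (l * t)) *\<^sub>R x) integrable_on {-1..t}" "(\<lambda>t. l *\<^sub>R E t - \<psi> t) integrable_on {-1..t}"
      by (rule integrable_subinterval_real[OF Lp_fun_integrable_on[OF p W1p_derivD(3)[OF X_W]] sub]
          integrable_subinterval_real[OF Lp_fun_integrable_on[OF p W1p_derivD(3)[OF E_W]] sub])+
    have I: "integral {-1..t} \<phi>' = integral {-1..t} (\<lambda>t. (l * exp (l * t)) *\<^sub>R x)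
        + integral {-1..t} (\<lambda>t. l *\<^sub>R E t - \<psi> t)"
      unfolding \<phi>'_eq[abs_def] by (rule Henstock_Kurzweil_Integration.integral_add[OF int])
    have X: "exp (l * t) *\<^sub>R x = exp (l * (-1)) *\<^sub>R x + integral {-1..t} (\<lambda>t. (l * exp (l * t)) *\<^sub>R x)"
      using X_W t unfolding W1p_deriv_def by blast
    have E: "E t = E (-1) + integral {-1..t} (\<lambda>t. l *\<^sub>R E t - \<psi> t)"
      using E_W t unfolding W1p_deriv_def by blast
    show "\<phi> t = \<phi> (-1) + integral {-1..t} \<phi>'"
      unfolding \<phi>_def I using arg_cong2[OF X E, of "(+)"] by (simp only: add_ac)
  qed
  have "l *\<^sub>R L0_of {-1..0} \<phi> - L0_of {-1..0} \<psi> = L0_of {-1..0} \<phi>'"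
    unfolding \<phi>'_def[abs_def] by (rule L0_of_scale_diff[OF W1p_derivD(2)[OF \<phi>_W] \<psi> S_sets])
  moreover have "l *\<^sub>R J z - y = Am z + delay_op \<mu> \<phi>" using z(1) by (simp add: algebra_simps)
  ultimately have eq: "l *\<^sub>R (J z, L0_of {-1..0} \<phi>) - w = (Am z + delay_op \<mu> \<phi>, L0_of {-1..0} \<phi>')"
    by (simp add: w_eq)
  have "G z - M z = delay_op \<nu> \<phi>" using z(2) Mz by (simp add: algebra_simps)
  moreover have "J z = \<phi> 0" by (simp add: Jz \<phi>_def E_def)
  ultimately have "((J z, L0_of {-1..0} \<phi>), (Am z + delay_op \<mu> \<phi>, L0_of {-1..0} \<phi>')) \<in> AA"
    unfolding delay_graph_def using \<phi>_W by blast
  then show ?thesis unfolding eq[symmetric] by blast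
qed

text \<open>Every solution of the resolvent equation, not just the one constructed before, has the
  form given by the reduction. Its data enter the system as \<open>J (bvp l (y + PE) 0)\<close> and
  \<open>M (bvp l (y + PE) 0) + LE\<close>, which are nonnegative together with
  \<open>w\<close>.\<close>

lemma delay_graph_resolvent_nonneg:
  assumes l: "0 < l" "sA < ereal l"
    and nonneg: "\<And>x u. 0 \<le> x - (J (bvp l (Pe l x) 0) + J (bvp l 0 u)) \<Longrightarrow>
      0 \<le> u - ((M (bvp l (Pe l x) 0) + Le l x) + M (bvp l 0 u)) \<Longrightarrow> 0 \<le> x \<and> 0 \<le> u"
    and v: "(v, l *\<^sub>R v - w) \<in> AA" and w: "0 \<le> w"
  shows "0 \<le> v"
proof -
  obtain z \<phi> \<phi>' where v_eq: "v = (J z, L0_of {-1..0} \<phi>)"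
    and lv: "l *\<^sub>R v - w = (Am z + delay_op \<mu> \<phi>, L0_of {-1..0} \<phi>')"
    and \<phi>_W: "W1p_deriv p (-1) 0 \<phi> \<phi>'" and Gz: "G z - M z = delay_op \<nu> \<phi>" and Jz: "J z = \<phi> 0"
    using v unfolding delay_graph_def by blast
  define \<psi> where "\<psi> t = l *\<^sub>R \<phi> t - \<phi>' t" for t
  define y where "y = l *\<^sub>R J z - Am z - delay_op \<mu> \<phi>"
  have \<psi>: "Lp_fun p {-1..0} \<psi>"
    unfolding \<psi>_def by (intro Lp_fun_diff Lp_fun_scaleR S_sets p W1p_derivD[OF \<phi>_W])
  have "w = l *\<^sub>R v - (l *\<^sub>R v - w)" by simp
  also have "\<dots> = (y, L0_of {-1..0} \<psi>)"
    unfolding lv unfolding v_eq y_def \<psi>_def[abs_def]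
    by (simp add: L0_of_scale_diff[OF W1p_derivD(2,3)[OF \<phi>_W] S_sets])
  finally have w_eq: "w = (y, L0_of {-1..0} \<psi>)" .
  have y: "0 \<le> y" and "0 \<le> L0_of {-1..0} \<psi>" using w by (simp_all add: w_eq less_eq_prod_def)
  then have \<psi>_pos: "AE t in lebesgue_on {-1..0}. 0 \<le> \<psi> t" by (simp add: zero_le_L0_of_iff[OF \<psi> S_sets])
  define E where "E = shift_solution l \<psi>"
  note E_W = shift_solution_W1p[OF p \<psi>, of l, folded E_def]
  have E_pos: "0 \<le> E t" if "t \<in> {-1..0}" for t
    unfolding E_def by (rule shift_solution_nonneg[OF p \<psi> l(1) \<psi>_pos that])
  define x where "x = J z"
  define u where "u = G z"
  have \<phi>_eq: "\<phi> t = exp (l * t) *\<^sub>R x + shift_solution l \<psi> t" if "t \<in> {-1..0}" for t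
    using W1p_deriv_eq_shift_solution[OF p \<phi>_W that, of l] by (simp add: x_def Jz \<psi>_def[abs_def])
  define PE where "PE = delay_op \<mu> E"
  define LE where "LE = delay_op \<nu> E"
  have P\<phi>: "delay_op \<mu> \<phi> = Pe l x + PE" and L\<phi>: "delay_op \<nu> \<phi> = Le l x + LE"
    unfolding PE_def LE_def E_def
    by (rule delay_op_split[OF \<mu> \<psi> \<phi>_eq], assumption) (rule delay_op_split[OF \<nu> \<psi> \<phi>_eq], assumption)
  have PE: "0 \<le> PE" and LE: "0 \<le> LE"
    unfolding PE_def LE_def
    by (rule positive_on_W1pD[OF P_pos E_W E_pos], assumption)
      (rule positive_on_W1pD[OF L_pos E_W E_pos], assumption)
  have "bvp l (y + delay_op \<mu> \<phi>) u = z" by (rule bvp_eqI[OF l(2)]) (simp_all add: y_def u_def)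
  then have z_eq: "z = (bvp l (y + PE) 0 + bvp l (Pe l x) 0) + bvp l 0 u"
    using bvp_split[OF l(2), of "y + delay_op \<mu> \<phi>" u] bvp_add[OF l(2), of "y + PE" "Pe l x" 0 0]
    by (simp add: P\<phi> algebra_simps)
  have yPE: "0 \<le> J (bvp l (y + PE) 0)" by (intro J_bvp_left_pos l(2) add_nonneg_nonneg y PE)
  have "x = J (bvp l (y + PE) 0) + J (bvp l (Pe l x) 0) + J (bvp l 0 u)"
    using arg_cong[OF z_eq, of J] by (simp add: x_def linear_add[OF J_lin])
  then have 1: "x - (J (bvp l (Pe l x) 0) + J (bvp l 0 u)) = J (bvp l (y + PE) 0)"
    by (simp add: diff_eq_eq add_ac)
  have "u = M z + delay_op \<nu> \<phi>" using Gz by (simp add: u_def algebra_simps)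
  also have "M z = M (bvp l (y + PE) 0) + M (bvp l (Pe l x) 0) + M (bvp l 0 u)"
    using arg_cong[OF z_eq, of M] by (simp add: linear_add[OF M_lin])
  finally have 2: "u - ((M (bvp l (Pe l x) 0) + Le l x) + M (bvp l 0 u)) = M (bvp l (y + PE) 0) + LE"
    unfolding L\<phi> by (simp add: diff_eq_eq add_ac)
  have "0 \<le> x \<and> 0 \<le> u"
    by (rule nonneg) (simp_all only: 1 2 yPE add_nonneg_nonneg[OF M_pos[OF yPE] LE])
  then have x: "0 \<le> x" by simp
  have "0 \<le> \<phi> t" if "t \<in> {-1..0}" for t
    unfolding \<phi>_eq[OF that] using E_pos[OF that] x by (intro add_nonneg_nonneg scaleR_nonneg_nonneg) (simp_all add: E_def)
  then have "AE t in lebesgue_on {-1..0}. 0 \<le> \<phi> t" by (intro AE_I2) (simp add: space_restrict_space)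
  then have "0 \<le> L0_of {-1..0} \<phi>" by (simp add: zero_le_L0_of_iff[OF W1p_derivD(2)[OF \<phi>_W] S_sets])
  then show ?thesis using x by (simp add: v_eq x_def less_eq_prod_def)
qed

section \<open>Invariance of the positive cone of the state space\<close>

lemma positive_semigroup_delay:
  assumes gen: "generates (state_space p) (state_norm p) AA TPL"
  shows "positive_semigroup (state_space p) TPL"
proof -
  interpret normed_subspace "state_space p :: ('x \<times> 'x L0) set" "state_norm p"
    by (rule normed_subspace_state_space[OF p])
  interpret L: normed_subspace "Lp p {-1..0} :: 'x L0 set" "Lp_norm p" by (rule normed_subspace_Lp[OF p])
  have C0: "C0_semigroup (state_space p) (state_norm p) TPL"
    and gen_eq: "generator (state_space p) (state_norm p) TPL = AA"
    using gen by (simp_all add: generates_def)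
  obtain l1 where l1: "\<And>l. l1 \<le> l \<Longrightarrow> 0 < l \<and> sA < ereal l \<and>
    (\<forall>x u. 0 \<le> x - (J (bvp l (Pe l x) 0) + J (bvp l 0 u)) \<longrightarrow>
      0 \<le> u - ((M (bvp l (Pe l x) 0) + Le l x) + M (bvp l 0 u)) \<longrightarrow> 0 \<le> x \<and> 0 \<le> u) \<and>
    (\<forall>f g. \<exists>x u. x - (J (bvp l (Pe l x) 0) + J (bvp l 0 u)) = f \<and>
      u - ((M (bvp l (Pe l x) 0) + Le l x) + M (bvp l 0 u)) = g)"
    using reduced_system by blast
  define C :: "('x \<times> 'x L0) set" where "C = {v \<in> state_space p. 0 \<le> v}"
  have "TPL t x \<in> C" if t: "0 \<le> t" and x: "x \<in> C" for t x
  proof (rule semigroup_invariant_set[OF C0 _ _ _ _ _ t x])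
    show "\<exists>z. (z, l *\<^sub>R z - y) \<in> generator (state_space p) (state_norm p) TPL"
      if "l1 \<le> l" "y \<in> state_space p" for l y
      unfolding gen_eq using l1[OF that(1)] by (intro delay_graph_surj that(2)) auto
    show "C \<subseteq> state_space p" by (auto simp: C_def)
    \<comment> \<open>On \<open>L0\<close> the order is declared only as a partial order, so its
      compatibility with nonnegative scalars is verified on representatives.\<close>
    show "c *\<^sub>R v \<in> C" if v: "v \<in> C" and c: "0 \<le> c" for c v
    proof -
      obtain v1 v2 where v_eq: "v = (v1, v2)" by (cases v) blast
      have v12: "0 \<le> v1" "0 \<le> v2" "v2 \<in> Lp p {-1..0}"
        using v by (simp_all add: C_def v_eq less_eq_prod_def state_space_def)
      obtain f where f: "v2 = L0_of {-1..0} f" "Lp_fun p {-1..0} f" using v12(3) by (auto simp: Lp_def)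
      have "0 \<le> c *\<^sub>R v2"
      proof -
        have "AE t in lebesgue_on {-1..0}. 0 \<le> f t" using v12(2) unfolding f(1) by (simp add: zero_le_L0_of_iff[OF f(2) S_sets])
        then have "AE t in lebesgue_on {-1..0}. 0 \<le> c *\<^sub>R f t"
          by eventually_elim (use c in \<open>simp add: scaleR_nonneg_nonneg\<close>)
        then have "0 \<le> L0_of {-1..0} (\<lambda>t. c *\<^sub>R f t)"
          by (simp add: zero_le_L0_of_iff[OF Lp_fun_scaleR[OF f(2)] S_sets])
        moreover have "c *\<^sub>R v2 = L0_of {-1..0} (\<lambda>t. c *\<^sub>R f t)"
        proof -
          have "(\<lambda>t. c *\<^sub>R (if t \<in> {-1..0} then f t else 0)) = (\<lambda>t. if t \<in> {-1..0} then c *\<^sub>R f t else 0)" by auto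
          then show ?thesis
            unfolding f(1) L0_of_eq_abs by (simp only: abs_L0_scaleR[OF Lp_fun_restrict_sm[OF f(2) S_sets]])
        qed
        ultimately show ?thesis by simp
      qed
      moreover have "0 \<le> c *\<^sub>R v1" using c v12(1) by (rule scaleR_nonneg_nonneg)
      ultimately show ?thesis using scale_in[of v c] v by (simp add: C_def v_eq less_eq_prod_def)
    qed
    show "v \<in> C" if f: "\<And>n. f n \<in> C" and v: "v \<in> state_space p"
      and lim: "(\<lambda>n. state_norm p (f n - v)) \<longlonglongrightarrow> 0" for f v
    proof -
      have f': "snd (f n) \<in> Lp p {-1..0}" "0 \<le> fst (f n)" "0 \<le> snd (f n)" for n
        using f[of n] by (auto simp: C_def state_space_def less_eq_prod_def)
      have v': "snd v \<in> Lp p {-1..0}" using v by (auto simp: state_space_def)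
      have N: "state_norm p (f n - v) = norm (fst (f n) - fst v) + Lp_norm p (snd (f n) - snd v)" for n
        by (simp add: state_norm_def case_prod_beta')
      have "(\<lambda>n. norm (fst (f n) - fst v)) \<longlonglongrightarrow> 0"
        by (rule Lim_null_comparison[OF _ lim]) (simp add: N always_eventually)
      then have "(\<lambda>n. fst (f n)) \<longlonglongrightarrow> fst v" by (simp add: tendsto_norm_zero_iff LIM_zero_iff)
      then have "0 \<le> fst v" by (rule LIMSEQ_nonneg_lattice[OF _ f'(2)])
      moreover have "(\<lambda>n. Lp_norm p (snd (f n) - snd v)) \<longlonglongrightarrow> 0"
        by (rule Lim_null_comparison[OF _ lim]) (simp add: N always_eventually)
      then have "0 \<le> snd v" by (rule Lp_nonneg_closed[OF p f'(1,3) v'])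
      ultimately show ?thesis using v by (simp add: C_def less_eq_prod_def)
    qed
    show "z \<in> C" if "l1 \<le> l" "(z, l *\<^sub>R z - y) \<in> generator (state_space p) (state_norm p) TPL" "y \<in> C" for l z y
    proof -
      have "z \<in> state_space p" using that(2) by (simp add: generator_def)
      moreover have "0 \<le> z"
        using l1[OF that(1)] that(2,3) unfolding gen_eq
        by (intro delay_graph_resolvent_nonneg[of l z y]) (auto simp: C_def)
      ultimately show ?thesis by (simp add: C_def)
    qed
  qed
  then show ?thesis by (auto simp: positive_semigroup_def C_def)
qed

end

theorem theorem4p2:
  fixes p l0 :: real
    and J Am :: "'z::banach \<Rightarrow> 'x::banach_lattice"
    and G M :: "'z \<Rightarrow> 'u::banach_lattice"
    and T :: "real \<Rightarrow> 'x \<Rightarrow> 'x"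
    and j :: "'x \<Rightarrow> 'e::banach"
    and \<mu> :: "real \<Rightarrow> 'x \<Rightarrow>\<^sub>L 'x"
    and \<nu> :: "real \<Rightarrow> 'x \<Rightarrow>\<^sub>L 'u"
    and TPL :: "real \<Rightarrow> 'x \<times> 'x L0 \<Rightarrow> 'x \<times> 'x L0"
  defines "A \<equiv> ker_graph J Am G"
    and "D \<equiv> dirichlet J Am G"
    and "P \<equiv> delay_op \<mu>"
    and "L \<equiv> delay_op \<nu>"
  assumes "p \<ge> 1"
    and "dense_embedding J"
    and "linear Am" and "closed (max_graph J Am)"
    and "linear G" and "linear M"
    and "delay_kernel \<mu>" and "delay_kernel \<nu>"
    and "generates UNIV norm A T"
    and "surj G"
    and "extrapolation_space A j"
    and "regular_triple p J Am G M T j"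
    and "\<exists>\<tau>>0. invertible_on (Lp p {0..\<tau>}) (Lp_norm p) (\<lambda>f. f - io_op p J Am G M T j \<tau> f)"
    and "\<forall>z. 0 \<le> J z \<longrightarrow> 0 \<le> M z"
    and "positive_on_W1p p L"
    and "positive_on_W1p p P"
    and "\<forall>l. ereal l > spectral_bound A \<longrightarrow> (\<forall>x\<ge>0. 0 \<le> resolvent l A x)"
    and "\<forall>l. ereal l > spectral_bound A \<longrightarrow> (\<forall>u\<ge>0. 0 \<le> J (D l u))"
    and "ereal l0 > spectral_bound A"
    and "spectral_radius (\<lambda>u. M (D l0 u)) < 1"
    and "generates (state_space p) (state_norm p) (delay_graph p J Am G M P L) TPL"
  shows "positive_semigroup (state_space p) TPL"
proof -
  have "linear J" "inj J"
    using \<open>dense_embedding J\<close> by (simp_all add: dense_embedding_def bounded_linear.linear)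
  then interpret delay_system J Am G M p l0 \<mu> \<nu>
  proof (intro delay_system.intro boundary_system.intro delay_system_axioms.intro)
    show "linear J" "inj J" "linear Am" "linear G" "surj G" "linear M" by fact+
    show "0 \<le> M z" if "0 \<le> J z" for z
      using \<open>\<forall>z. 0 \<le> J z \<longrightarrow> 0 \<le> M z\<close> that by blast
    show "0 \<le> resolvent l (ker_graph J Am G) x" if "spectral_bound (ker_graph J Am G) < ereal l" "0 \<le> x" for l x
      using \<open>\<forall>l. ereal l > spectral_bound A \<longrightarrow> (\<forall>x\<ge>0. 0 \<le> resolvent l A x)\<close> that
      unfolding A_def by blast
    show "0 \<le> J (dirichlet J Am G l u)" if "spectral_bound (ker_graph J Am G) < ereal l" "0 \<le> u" for l u
      using \<open>\<forall>l. ereal l > spectral_bound A \<longrightarrow> (\<forall>u\<ge>0. 0 \<le> J (D l u))\<close> that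
      unfolding A_def D_def by blast
    show "1 \<le> p" "delay_kernel \<mu>" "delay_kernel \<nu>" by fact+
    show "positive_on_W1p p (delay_op \<mu>)" "positive_on_W1p p (delay_op \<nu>)"
      using \<open>positive_on_W1p p P\<close> \<open>positive_on_W1p p L\<close> unfolding P_def L_def .
    show "spectral_bound (ker_graph J Am G) < ereal l0"
      using \<open>ereal l0 > spectral_bound A\<close> unfolding A_def .
    show "spectral_radius (\<lambda>u. M (dirichlet J Am G l0 u)) < 1"
      using \<open>spectral_radius (\<lambda>u. M (D l0 u)) < 1\<close> unfolding D_def .
  qed
  show ?thesis
    using \<open>generates (state_space p) (state_norm p) (delay_graph p J Am G M P L) TPL\<close>
    unfolding P_def L_def by (rule positive_semigroup_delay)
qed

end
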